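(* Let $G$ be a finite group with a (not necessarily faithful) representation $V=\mathbb{C}^n$, and let $\mathcal C$ be a set of representatives of the conjugacy classes of $G$. The parameter space of graded Hecke algebras for the pair $G,V$, i.e. the space of families $\{a_g\}_{g\in G}$ of skew-symmetric bilinear forms on $V$ that define a graded Hecke algebra, is isomorphic to the space of families $\{f_g\}_{g\in\mathcal C}$ of Hochschild semi-invariants ($f_g\in \mathrm{HH}^2(g)$) whose nonzero elements have degree $0$. The defining skew-symmetric bilinear forms $\{a_g\}_{g\in G}$ of the graded Hecke algebra corresponding to $\{f_g\}_{g\in\mathcal C}$ are given by $$a_g(v,w)\,\overline g=f_g(1\otimes1\otimes v\wedge w)\qquad\text{and}\qquad a_{h^{-1}gh}(v,w)=a_g(h(v),h(w))$$ for all $g\in\mathcal C$, $h\in G$ and $v,w\in V$.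
   Context: Work over $\mathbb{C}$, $\otimes=\otimes_{\mathbb C}$. For a $\mathbb{C}$-algebra $R$ with $G$-action ($R=S(V)$ or $T(V)$), the skew group algebra $R\#G$ is $R\otimes\mathbb{C}G$ with product $(r\otimes g)(s\otimes h)=r\,g(s)\otimes gh$; write $r\overline g$ for $r\otimes g$. Graded Hecke algebra: given skew-symmetric bilinear forms $a_g:V\times V\to\mathbb{C}$ ($g\in G$), let $$A=(T(V)\#G)\Big/\Bigl(vw-wv-\sum_{g\in G}a_g(v,w)\overline g:\ v,w\in V\Bigr),$$ filtered by giving elements of $V$ degree 1 and elements of $G$ degree 0. $A$ is called a graded Hecke algebra if the associated graded algebra $\mathrm{gr}A$ is isomorphic to $S(V)\#G$ (equivalently, $A$ is isomorphic to $S(V)\#G$ as a vector space via a choice of linear section $S(V)\hookrightarrow T(V)$ of the canonical projection). Hochschild semi-invariants: fix a $G$-invariant Hermitian inner product on $V$. For $g\in G$, $V^g=\{v:g(v)=v\}$ and $Z(g)$ is the centralizer of $g$ in $G$. For $h\in Z(g)$ let $h^\perp=h|_{(V^g)^\perp}$ and $\chi_g(h)=\det(h^\perp)$ (trivial if $(V^g)^\perp=0$). For a $Z(g)$-representation $U$, $U^{\chi_g}=\{u: h(u)=\chi_g(h)u\ \forall h\in Z(g)\}$. Define $$\mathrm{HH}^2(g)=\bigl(S(V^g)\otimes\textstyle\bigwedge^{2-\operatorname{codim}V^g}((V^g)^* )\bigr)^{\chi_g}$$ (diagonal action, contragredient action on duals; negative exterior powers are $0$). Its elements are the Hochschild semi-invariants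 of $g$. Writing $f_g\in\mathrm{HH}^2(g)$ as a linear combination of elements $p\otimes y$ with $p\in S(V^g)$, $y\in\bigwedge((V^g)^* )$ (with respect to fixed bases), $f_g$ has degree $m$ if the highest degree of the polynomials $p$ appearing is $m$. $f_g$ as a function: fix a nonzero element $x_1\wedge\dots\wedge x_m$ of the one-dimensional space $\bigwedge^{\operatorname{codim}V^g}(((V^g)^\perp)^* )$, $m=\operatorname{codim}V^g$. Using it, and the canonical identification of $\bigwedge^{2-m}((V^g)^* )\otimes\bigwedge^{m}(((V^g)^\perp)^* )$ with a subspace of $\bigwedge^2(V^* )$, and inserting the factor $\overline g$, regard $f_g$ as an element of $S(V^g)\overline g\otimes\bigwedge^2(V^* )$, i.e. as a linear combination of elements $p\overline g\otimes y$ with $p\in S(V^g)$, $y\in\bigwedge^2(V^* )$. Then for $r,s\in S(V)$ and $z\in\bigwedge^2(V)$, $f_g(r\otimes s\otimes z)\in S(V)\overline g$ is the corresponding linear combination of the elements $y(z)\,r\,p\,\overline g\,s$. *)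

theory Defs
  imports
    "HOL-Analysis.Analysis"
    "HOL-Algebra.QuotRing"
    "HOL-Algebra.Module"
    "HOL-Library.Poly_Mapping"
    "HOL-Combinatorics.Permutations"
begin

section \<open>The algebras $S(V)$ and $T(V)$\<close>

text \<open>Lists under concatenation form the free monoid. With this instance, the monoid algebra
  of words over \<open>'n\<close>, i.e. the tensor algebra of the vector space with basis \<open>'n\<close>, is a
  type of finitely supported functions with the convolution product of the library.\<close>

instantiation list :: (type) monoid_add
begin
definition zero_list :: "'a list" where "zero_list = []"
definition plus_list :: "'a list \<Rightarrow> 'a list \<Rightarrow> 'a list" where "plus_list xs ys = xs @ ys"
instance by standard (simp_all add: zero_list_def plus_list_def)
end

type_synonym 'n tens = "'n list \<Rightarrow>\<^sub>0 complex"
type_synonym 'n spoly = "('n \<Rightarrow>\<^sub>0 nat) \<Rightarrow>\<^sub>0 complex"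

definition scal :: "complex \<Rightarrow> 'b::monoid_add \<Rightarrow>\<^sub>0 complex" where
  "scal c = Poly_Mapping.single 0 c"

definition tens_vec :: "complex ^ 'n \<Rightarrow> 'n::finite tens" where
  "tens_vec v = (\<Sum>i\<in>UNIV. Poly_Mapping.single [i] (v $ i))"

definition sym_vec :: "complex ^ 'n \<Rightarrow> 'n::finite spoly" where
  "sym_vec v = (\<Sum>i\<in>UNIV. Poly_Mapping.single (Poly_Mapping.single i 1) (v $ i))"

text \<open>The endomorphisms of the algebras $T(V)$ and $S(V)$ extending the linear map \<open>v \<mapsto> M *v v\<close>.\<close>

definition tens_act :: "complex ^ 'n ^ 'n \<Rightarrow> 'n tens \<Rightarrow> 'n::finite tens" where
  "tens_act M p = (\<Sum>w\<in>Poly_Mapping.keys p. scal (Poly_Mapping.lookup p w) *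
     prod_list (map (\<lambda>i. tens_vec (column i M)) w))"

definition sym_act :: "complex ^ 'n ^ 'n \<Rightarrow> 'n spoly \<Rightarrow> 'n::finite spoly" where
  "sym_act M p = (\<Sum>e\<in>Poly_Mapping.keys p. scal (Poly_Mapping.lookup p e) *
     (\<Prod>i\<in>UNIV. sym_vec (column i M) ^ Poly_Mapping.lookup e i))"

definition mono_deg :: "('n::finite \<Rightarrow>\<^sub>0 nat) \<Rightarrow> nat" where
  "mono_deg e = (\<Sum>i\<in>UNIV. Poly_Mapping.lookup e i)"

definition sym_deg :: "'n::finite spoly \<Rightarrow> nat" where
  "sym_deg p = Max (insert 0 (mono_deg ` Poly_Mapping.keys p))"

text \<open>$S(W)$ for a subspace $W$ of $V$, as a subalgebra of $S(V)$.\<close>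

inductive_set sym_sub :: "(complex ^ 'n) set \<Rightarrow> 'n::finite spoly set"
  for W :: "(complex ^ 'n) set" where
  scal: "scal c \<in> sym_sub W"
| vec: "v \<in> W \<Longrightarrow> sym_vec v \<in> sym_sub W"
| add: "p \<in> sym_sub W \<Longrightarrow> q \<in> sym_sub W \<Longrightarrow> p + q \<in> sym_sub W"
| mult: "p \<in> sym_sub W \<Longrightarrow> q \<in> sym_sub W \<Longrightarrow> p * q \<in> sym_sub W"

section \<open>Representations and skew group algebras\<close>

definition is_representation ::
  "('g, 'm) monoid_scheme \<Rightarrow> ('g \<Rightarrow> complex ^ 'n ^ 'n) \<Rightarrow> bool" where
  "is_representation G \<rho> \<longleftrightarrow> \<rho> \<one>\<^bsub>G\<^esub> = mat 1 \<and>
     (\<forall>g\<in>carrier G. \<forall>h\<in>carrier G. \<rho> (g \<otimes>\<^bsub>G\<^esub> h) = \<rho> g ** \<rho> h)"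

text \<open>Elements of $R \# G$ are written as functions $G \to R$ (vanishing off the carrier), the
  function \<open>\<phi>\<close> standing for \<open>\<Sum>\<^sub>g \<phi>(g) \<otimes> g\<close>. The algebra structures below are
  \<open>module\<close> records because these are the ring records that also carry a scalar multiplication.\<close>

definition skew_elem :: "'r \<Rightarrow> 'g \<Rightarrow> 'g \<Rightarrow> 'r::zero" where
  "skew_elem r g = (\<lambda>k. if k = g then r else 0)"

definition skew_group_algebra ::
  "('g, 'm) monoid_scheme \<Rightarrow>
   ('g \<Rightarrow> ('b::monoid_add \<Rightarrow>\<^sub>0 complex) \<Rightarrow> ('b \<Rightarrow>\<^sub>0 complex)) \<Rightarrow>
   (complex, 'g \<Rightarrow> 'b \<Rightarrow>\<^sub>0 complex) module" where
  "skew_group_algebra G act =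
    \<lparr> carrier = {\<phi>. \<forall>g. g \<notin> carrier G \<longrightarrow> \<phi> g = 0},
      mult = (\<lambda>\<phi> \<psi> k. \<Sum>(g, h) | g \<in> carrier G \<and> h \<in> carrier G \<and> g \<otimes>\<^bsub>G\<^esub> h = k.
                \<phi> g * act g (\<psi> h)),
      one = skew_elem 1 \<one>\<^bsub>G\<^esub>,
      zero = (\<lambda>_. 0),
      add = (\<lambda>\<phi> \<psi> k. \<phi> k + \<psi> k),
      smult = (\<lambda>c \<phi> k. scal c * \<phi> k) \<rparr>"

definition sym_skew ::
  "('g, 'm) monoid_scheme \<Rightarrow> ('g \<Rightarrow> complex ^ 'n ^ 'n) \<Rightarrow>
   (complex, 'g \<Rightarrow> 'n::finite spoly) module" where
  "sym_skew G \<rho> = skew_group_algebra G (\<lambda>g. sym_act (\<rho> g))"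

definition tens_skew ::
  "('g, 'm) monoid_scheme \<Rightarrow> ('g \<Rightarrow> complex ^ 'n ^ 'n) \<Rightarrow>
   (complex, 'g \<Rightarrow> 'n::finite tens) module" where
  "tens_skew G \<rho> = skew_group_algebra G (\<lambda>g. tens_act (\<rho> g))"

text \<open>The degree-\<open>k\<close> component of $S(V)\#G$, where $G$ has degree 0.\<close>

definition sym_skew_component ::
  "('g, 'm) monoid_scheme \<Rightarrow> nat \<Rightarrow> ('g \<Rightarrow> 'n::finite spoly) set" where
  "sym_skew_component G k = {\<phi>. (\<forall>g. g \<notin> carrier G \<longrightarrow> \<phi> g = 0) \<and>
     (\<forall>g. \<forall>e\<in>Poly_Mapping.keys (\<phi> g). mono_deg e = k)}"

section \<open>Quotients, filtrations and associated graded algebras\<close>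

definition quot_algebra :: "(complex, 'a) module \<Rightarrow> 'a set \<Rightarrow> (complex, 'a set) module" where
  "quot_algebra R I =
     ring.extend (R Quot I) (module.fields (\<lambda>c X. \<Union>x\<in>X. I +>\<^bsub>R\<^esub> (c \<odot>\<^bsub>R\<^esub> x)))"

definition filt_prev :: "(complex, 'a) module \<Rightarrow> (nat \<Rightarrow> 'a set) \<Rightarrow> nat \<Rightarrow> 'a set" where
  "filt_prev A F k = (if k = 0 then {\<zero>\<^bsub>A\<^esub>} else F (k - 1))"

text \<open>\<open>gr A = \<Oplus>\<^sub>k F\<^sub>k / F\<^sub>k\<^sub>-\<^sub>1\<close>: an element is a sequence of cosets, all but finitely many of
  them zero. In the product the union runs over all choices of representatives; for a
  multiplicative filtration all the cosets in it coincide.\<close>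

definition assoc_graded ::
  "(complex, 'a) module \<Rightarrow> (nat \<Rightarrow> 'a set) \<Rightarrow> (complex, nat \<Rightarrow> 'a set) module" where
  "assoc_graded A F =
    \<lparr> carrier = {\<phi>. (\<forall>k. \<exists>x\<in>F k. \<phi> k = filt_prev A F k +>\<^bsub>A\<^esub> x) \<and>
                    finite {k. \<phi> k \<noteq> filt_prev A F k}},
      mult = (\<lambda>\<phi> \<psi> k. \<Union>x\<in>Pi UNIV \<phi>. \<Union>y\<in>Pi UNIV \<psi>.
                filt_prev A F k +>\<^bsub>A\<^esub> (\<Oplus>\<^bsub>A\<^esub>i\<in>{..k}. x i \<otimes>\<^bsub>A\<^esub> y (k - i))),
      one = (\<lambda>k. if k = 0 then filt_prev A F 0 +>\<^bsub>A\<^esub> \<one>\<^bsub>A\<^esub> else filt_prev A F k),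
      zero = filt_prev A F,
      add = (\<lambda>\<phi> \<psi> k. \<phi> k <+>\<^bsub>A\<^esub> \<psi> k),
      smult = (\<lambda>c \<phi> k. \<Union>x\<in>\<phi> k. filt_prev A F k +>\<^bsub>A\<^esub> (c \<odot>\<^bsub>A\<^esub> x)) \<rparr>"

definition graded_component ::
  "(complex, 'a) module \<Rightarrow> (nat \<Rightarrow> 'a set) \<Rightarrow> nat \<Rightarrow> (nat \<Rightarrow> 'a set) set" where
  "graded_component A F k =
     {\<phi> \<in> carrier (assoc_graded A F). \<forall>j. j \<noteq> k \<longrightarrow> \<phi> j = filt_prev A F j}"

definition graded_isomorphic ::
  "(complex, 'a) module \<Rightarrow> (nat \<Rightarrow> 'a set) \<Rightarrow> (complex, 'b) module \<Rightarrow> (nat \<Rightarrow> 'b set) \<Rightarrow> bool" where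
  "graded_isomorphic A A_comp B B_comp \<longleftrightarrow>
     (\<exists>\<theta>\<in>ring_iso A B. (\<forall>c. \<forall>x\<in>carrier A. \<theta> (c \<odot>\<^bsub>A\<^esub> x) = c \<odot>\<^bsub>B\<^esub> \<theta> x) \<and>
        (\<forall>k. \<theta> ` A_comp k = B_comp k))"

section \<open>Graded Hecke algebras\<close>

definition skew_form :: "(complex ^ 'n \<Rightarrow> complex ^ 'n \<Rightarrow> complex) \<Rightarrow> bool" where
  "skew_form b \<longleftrightarrow>
     (\<forall>u v w c. b (c *s u + v) w = c * b u w + b v w) \<and> (\<forall>v w. b v w = - b w v)"

definition hecke_relations ::
  "('g, 'm) monoid_scheme \<Rightarrow> ('g \<Rightarrow> complex ^ 'n \<Rightarrow> complex ^ 'n \<Rightarrow> complex) \<Rightarrow>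
   ('g \<Rightarrow> 'n::finite tens) set" where
  "hecke_relations G a =
     {(\<lambda>k. skew_elem (tens_vec v * tens_vec w - tens_vec w * tens_vec v) \<one>\<^bsub>G\<^esub> k
           - (\<Sum>g\<in>carrier G. skew_elem (scal (a g v w)) g k)) | v w. True}"

definition hecke_ideal ::
  "('g, 'm) monoid_scheme \<Rightarrow> ('g \<Rightarrow> complex ^ 'n ^ 'n) \<Rightarrow>
   ('g \<Rightarrow> complex ^ 'n \<Rightarrow> complex ^ 'n \<Rightarrow> complex) \<Rightarrow> ('g \<Rightarrow> 'n::finite tens) set" where
  "hecke_ideal G \<rho> a = Idl\<^bsub>tens_skew G \<rho>\<^esub> (hecke_relations G a)"

definition hecke_algebra ::
  "('g, 'm) monoid_scheme \<Rightarrow> ('g \<Rightarrow> complex ^ 'n ^ 'n) \<Rightarrow>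
   ('g \<Rightarrow> complex ^ 'n \<Rightarrow> complex ^ 'n \<Rightarrow> complex) \<Rightarrow>
   (complex, ('g \<Rightarrow> 'n::finite tens) set) module" where
  "hecke_algebra G \<rho> a = quot_algebra (tens_skew G \<rho>) (hecke_ideal G \<rho> a)"

text \<open>The image in the quotient of the elements of $T(V)\#G$ of degree at most \<open>k\<close>.\<close>

definition hecke_filtration ::
  "('g, 'm) monoid_scheme \<Rightarrow> ('g \<Rightarrow> complex ^ 'n ^ 'n) \<Rightarrow>
   ('g \<Rightarrow> complex ^ 'n \<Rightarrow> complex ^ 'n \<Rightarrow> complex) \<Rightarrow>
   nat \<Rightarrow> ('g \<Rightarrow> 'n::finite tens) set set" where
  "hecke_filtration G \<rho> a k =
     (\<lambda>\<phi>. hecke_ideal G \<rho> a +>\<^bsub>tens_skew G \<rho>\<^esub> \<phi>) `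
       {\<phi> \<in> carrier (tens_skew G \<rho>). \<forall>g. \<forall>w\<in>Poly_Mapping.keys (\<phi> g). length w \<le> k}"

definition is_graded_hecke ::
  "('g, 'm) monoid_scheme \<Rightarrow> ('g \<Rightarrow> complex ^ 'n ^ 'n) \<Rightarrow>
   ('g \<Rightarrow> complex ^ 'n \<Rightarrow> complex ^ 'n::finite \<Rightarrow> complex) \<Rightarrow> bool" where
  "is_graded_hecke G \<rho> a \<longleftrightarrow>
     graded_isomorphic
       (assoc_graded (hecke_algebra G \<rho> a) (hecke_filtration G \<rho> a))
       (graded_component (hecke_algebra G \<rho> a) (hecke_filtration G \<rho> a))
       (sym_skew G \<rho>) (sym_skew_component G)"

text \<open>The value of a family off the carrier is fixed to zero, so that a family is determined
  by its members indexed by $G$.\<close>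

definition hecke_parameters ::
  "('g, 'm) monoid_scheme \<Rightarrow> ('g \<Rightarrow> complex ^ 'n ^ 'n) \<Rightarrow>
   ('g \<Rightarrow> complex ^ 'n \<Rightarrow> complex ^ 'n::finite \<Rightarrow> complex) set" where
  "hecke_parameters G \<rho> =
     {a. (\<forall>g\<in>carrier G. skew_form (a g)) \<and> (\<forall>g. g \<notin> carrier G \<longrightarrow> a g = (\<lambda>_ _. 0)) \<and>
         is_graded_hecke G \<rho> a}"

section \<open>Linear algebra on subspaces\<close>

definition hermitian_inner_product :: "(complex ^ 'n \<Rightarrow> complex ^ 'n \<Rightarrow> complex) \<Rightarrow> bool" where
  "hermitian_inner_product ip \<longleftrightarrow>
     (\<forall>u v w c. ip (c *s u + v) w = c * ip u w + ip v w) \<and>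
     (\<forall>v w. ip w v = cnj (ip v w)) \<and> (\<forall>v. v \<noteq> 0 \<longrightarrow> Re (ip v v) > 0)"

definition invariant_ip ::
  "('g, 'm) monoid_scheme \<Rightarrow> ('g \<Rightarrow> complex ^ 'n ^ 'n) \<Rightarrow>
   (complex ^ 'n \<Rightarrow> complex ^ 'n::finite \<Rightarrow> complex) \<Rightarrow> bool" where
  "invariant_ip G \<rho> ip \<longleftrightarrow> (\<forall>g\<in>carrier G. \<forall>v w. ip (\<rho> g *v v) (\<rho> g *v w) = ip v w)"

definition fixed_space :: "complex ^ 'n ^ 'n \<Rightarrow> (complex ^ 'n::finite) set" where
  "fixed_space M = {v. M *v v = v}"

definition orth_compl ::
  "(complex ^ 'n \<Rightarrow> complex ^ 'n \<Rightarrow> complex) \<Rightarrow> (complex ^ 'n) set \<Rightarrow> (complex ^ 'n) set" where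
  "orth_compl ip W = {v. \<forall>w\<in>W. ip v w = 0}"

definition codim :: "(complex ^ 'n::finite) set \<Rightarrow> nat" where
  "codim W = CARD('n) - vec.dim W"

text \<open>The projection onto \<open>U\<close> along a complement \<open>W\<close>.\<close>

definition proj_along :: "(complex ^ 'n) set \<Rightarrow> (complex ^ 'n) set \<Rightarrow> complex ^ 'n \<Rightarrow> complex ^ 'n"
  where "proj_along U W v = (THE u. u \<in> U \<and> v - u \<in> W)"

text \<open>The determinant of a linear map \<open>f\<close> of a subspace \<open>U\<close> into itself: the (Leibniz)
  determinant of the matrix of \<open>f\<close> in any basis \<open>b\<close> of \<open>U\<close>; it is 1 if \<open>U = 0\<close>.\<close>

definition det_on :: "(complex ^ 'n) set \<Rightarrow> (complex ^ 'n \<Rightarrow> complex ^ 'n::finite) \<Rightarrow> complex" where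
  "det_on U f = (THE D. \<exists>b M.
     inj_on b {..<vec.dim U} \<and> vec.independent (b ` {..<vec.dim U}) \<and>
     vec.span (b ` {..<vec.dim U}) = U \<and>
     (\<forall>j<vec.dim U. f (b j) = (\<Sum>i<vec.dim U. M i j *s b i)) \<and>
     D = (\<Sum>\<sigma> | \<sigma> permutes {..<vec.dim U}. of_int (sign \<sigma>) * (\<Prod>i<vec.dim U. M i (\<sigma> i))))"

text \<open>\<open>\<And>\<^sup>k(W\<^sup>*)\<close> as the space of alternating \<open>k\<close>-linear forms on \<open>W\<close>, applied to lists of
  vectors, with value zero on all other lists. For negative \<open>k\<close> only the zero form remains.\<close>

definition ext_pow :: "(complex ^ 'n) set \<Rightarrow> int \<Rightarrow> ((complex ^ 'n) list \<Rightarrow> complex) set" where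
  "ext_pow W k = {y.
     (\<forall>xs. \<not> (int (length xs) = k \<and> set xs \<subseteq> W) \<longrightarrow> y xs = 0) \<and>
     (\<forall>us vs. \<forall>v\<in>W. \<forall>w\<in>W. \<forall>c.
        y (us @ (c *s v + w) # vs) = c * y (us @ v # vs) + y (us @ w # vs)) \<and>
     (\<forall>xs. \<not> distinct xs \<longrightarrow> y xs = 0)}"

text \<open>An element \<open>p \<otimes> y\<close> of \<open>S(W) \<otimes> \<And>\<^sup>k(W\<^sup>*)\<close> is regarded as the $S(W)$-valued form
  \<open>xs \<mapsto> y(xs) p\<close>; this embeds the tensor product into the $S(V)$-valued functions.\<close>

definition tensor_elem ::
  "'n spoly \<Rightarrow> ((complex ^ 'n) list \<Rightarrow> complex) \<Rightarrow> (complex ^ 'n) list \<Rightarrow> 'n::finite spoly" where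
  "tensor_elem p y = (\<lambda>xs. scal (y xs) * p)"

definition sym_tensor_ext ::
  "(complex ^ 'n) set \<Rightarrow> int \<Rightarrow> ((complex ^ 'n) list \<Rightarrow> 'n::finite spoly) set" where
  "sym_tensor_ext W k = {u. \<exists>N p y.
     (\<forall>i<(N::nat). p i \<in> sym_sub W \<and> y i \<in> ext_pow W k) \<and>
     u = (\<lambda>xs. \<Sum>i<N. tensor_elem (p i) (y i) xs)}"

text \<open>\<open>u\<close> is expanded in linearly independent forms \<open>y\<^sub>i\<close>, so that the polynomial coefficients
  \<open>p\<^sub>i\<close> are unique for given \<open>y\<^sub>i\<close>.\<close>

definition has_degree ::
  "(complex ^ 'n) set \<Rightarrow> int \<Rightarrow> ((complex ^ 'n) list \<Rightarrow> 'n::finite spoly) \<Rightarrow> nat \<Rightarrow> bool" where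
  "has_degree W k u d \<longleftrightarrow> (\<exists>N p y.
     (N::nat) > 0 \<and> (\<forall>i<N. p i \<in> sym_sub W \<and> y i \<in> ext_pow W k) \<and>
     (\<forall>c. (\<forall>xs. (\<Sum>i<N. c i * y i xs) = 0) \<longrightarrow> (\<forall>i<N. c i = 0)) \<and>
     u = (\<lambda>xs. \<Sum>i<N. tensor_elem (p i) (y i) xs) \<and>
     d = Max ((\<lambda>i. sym_deg (p i)) ` {..<N}))"

text \<open>The exterior product of a \<open>k\<close>-form \<open>u\<close> and an \<open>m\<close>-form \<open>y\<close>, normalised such that
  \<open>(y\<^sub>1 \<and> y\<^sub>2)(v, w) = y\<^sub>1(v) y\<^sub>2(w) - y\<^sub>1(w) y\<^sub>2(v)\<close> for 1-forms.\<close>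

definition wedge_form ::
  "nat \<Rightarrow> nat \<Rightarrow> ('v list \<Rightarrow> 'n::finite spoly) \<Rightarrow> ('v list \<Rightarrow> complex) \<Rightarrow> 'v list \<Rightarrow> 'n spoly" where
  "wedge_form k m u y xs = scal (1 / (fact k * fact m)) *
     (\<Sum>\<sigma> | \<sigma> permutes {..<k + m}.
        scal (of_int (sign \<sigma>) * y (map (\<lambda>i. xs ! \<sigma> i) [k..<k + m])) *
        u (map (\<lambda>i. xs ! \<sigma> i) [0..<k]))"

section \<open>Hochschild semi-invariants\<close>

definition centralizer :: "('g, 'm) monoid_scheme \<Rightarrow> 'g \<Rightarrow> 'g set" where
  "centralizer G g = {h \<in> carrier G. h \<otimes>\<^bsub>G\<^esub> g = g \<otimes>\<^bsub>G\<^esub> h}"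

definition conj_class_reps :: "('g, 'm) monoid_scheme \<Rightarrow> 'g set \<Rightarrow> bool" where
  "conj_class_reps G C \<longleftrightarrow> C \<subseteq> carrier G \<and>
     (\<forall>x\<in>carrier G. \<exists>!g. g \<in> C \<and> (\<exists>h\<in>carrier G. x = inv\<^bsub>G\<^esub> h \<otimes>\<^bsub>G\<^esub> g \<otimes>\<^bsub>G\<^esub> h))"

definition hoch_char ::
  "('g \<Rightarrow> complex ^ 'n ^ 'n) \<Rightarrow> (complex ^ 'n \<Rightarrow> complex ^ 'n::finite \<Rightarrow> complex) \<Rightarrow>
   'g \<Rightarrow> 'g \<Rightarrow> complex" where
  "hoch_char \<rho> ip g h = det_on (orth_compl ip (fixed_space (\<rho> g))) (\<lambda>v. \<rho> h *v v)"

definition diag_act ::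
  "('g, 'm) monoid_scheme \<Rightarrow> ('g \<Rightarrow> complex ^ 'n ^ 'n) \<Rightarrow> 'g \<Rightarrow>
   ((complex ^ 'n) list \<Rightarrow> 'n spoly) \<Rightarrow> (complex ^ 'n) list \<Rightarrow> 'n::finite spoly" where
  "diag_act G \<rho> h u = (\<lambda>xs. sym_act (\<rho> h) (u (map (\<lambda>v. \<rho> (inv\<^bsub>G\<^esub> h) *v v) xs)))"

abbreviation form_degree :: "('g \<Rightarrow> complex ^ 'n ^ 'n::finite) \<Rightarrow> 'g \<Rightarrow> int" where
  "form_degree \<rho> g \<equiv> 2 - int (codim (fixed_space (\<rho> g)))"

definition HH2 ::
  "('g, 'm) monoid_scheme \<Rightarrow> ('g \<Rightarrow> complex ^ 'n ^ 'n) \<Rightarrow>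
   (complex ^ 'n \<Rightarrow> complex ^ 'n \<Rightarrow> complex) \<Rightarrow> 'g \<Rightarrow>
   ((complex ^ 'n) list \<Rightarrow> 'n::finite spoly) set" where
  "HH2 G \<rho> ip g = {u \<in> sym_tensor_ext (fixed_space (\<rho> g)) (form_degree \<rho> g).
     \<forall>h\<in>centralizer G g. diag_act G \<rho> h u = (\<lambda>xs. scal (hoch_char \<rho> ip g h) * u xs)}"

text \<open>Families \<open>{f\<^sub>g}\<close> indexed by \<open>C\<close> (zero off \<open>C\<close>) whose nonzero members have degree 0.\<close>

definition semi_invariant_families ::
  "('g, 'm) monoid_scheme \<Rightarrow> ('g \<Rightarrow> complex ^ 'n ^ 'n) \<Rightarrow>
   (complex ^ 'n \<Rightarrow> complex ^ 'n \<Rightarrow> complex) \<Rightarrow> 'g set \<Rightarrow>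
   ('g \<Rightarrow> (complex ^ 'n) list \<Rightarrow> 'n::finite spoly) set" where
  "semi_invariant_families G \<rho> ip C = {f.
     (\<forall>g\<in>C. f g \<in> HH2 G \<rho> ip g \<and>
        (f g \<noteq> (\<lambda>_. 0) \<longrightarrow> has_degree (fixed_space (\<rho> g)) (form_degree \<rho> g) (f g) 0)) \<and>
     (\<forall>g. g \<notin> C \<longrightarrow> f g = (\<lambda>_. 0))}"

text \<open>The value at \<open>v \<and> w\<close> of the $S(V)$-valued 2-form on $V = V^g \oplus (V^g)^\perp$
  which is the exterior product of \<open>u\<close> and the fixed element \<open>\<omega>\<close> of the top exterior power of
  $((V^g)^\perp)^*$, both pulled back along the projections. If $\mathrm{codim} V^g > 2$,
  then \<open>u = 0\<close> and the value is 0.\<close>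

definition as_two_form ::
  "(complex ^ 'n \<Rightarrow> complex ^ 'n \<Rightarrow> complex) \<Rightarrow> (complex ^ 'n) set \<Rightarrow>
   ((complex ^ 'n) list \<Rightarrow> complex) \<Rightarrow> ((complex ^ 'n) list \<Rightarrow> 'n spoly) \<Rightarrow>
   complex ^ 'n \<Rightarrow> complex ^ 'n \<Rightarrow> 'n::finite spoly" where
  "as_two_form ip W \<omega> u v w = wedge_form (2 - codim W) (codim W)
     (\<lambda>xs. u (map (proj_along W (orth_compl ip W)) xs))
     (\<lambda>xs. \<omega> (map (proj_along (orth_compl ip W) W) xs)) [v, w]"

text \<open>\<open>f\<^sub>g(r \<otimes> s \<otimes> v \<and> w)\<close>, an element of $S(V)\#G$.\<close>

definition semi_inv_eval ::
  "('g, 'm) monoid_scheme \<Rightarrow> ('g \<Rightarrow> complex ^ 'n ^ 'n) \<Rightarrow>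
   (complex ^ 'n \<Rightarrow> complex ^ 'n \<Rightarrow> complex) \<Rightarrow> 'g \<Rightarrow>
   ((complex ^ 'n) list \<Rightarrow> complex) \<Rightarrow> ((complex ^ 'n) list \<Rightarrow> 'n spoly) \<Rightarrow>
   'n spoly \<Rightarrow> 'n spoly \<Rightarrow> complex ^ 'n \<Rightarrow> complex ^ 'n \<Rightarrow> 'g \<Rightarrow> 'n::finite spoly" where
  "semi_inv_eval G \<rho> ip g \<omega> u r s v w =
     skew_elem r \<one>\<^bsub>G\<^esub> \<otimes>\<^bsub>sym_skew G \<rho>\<^esub>
     skew_elem (as_two_form ip (fixed_space (\<rho> g)) \<omega> u v w) g \<otimes>\<^bsub>sym_skew G \<rho>\<^esub>
     skew_elem s \<one>\<^bsub>G\<^esub>"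

end

theory Submission
  imports Defs "HOL-Library.Function_Algebras"
begin

text \<open>A family \<open>a\<close> of skew forms defines a graded Hecke algebra iff it is equivariant under conjugation,
  $a_{h^{-1}gh}(v,w) = a_g(hv,hw)$, and each \<open>a\<^sub>g\<close> satisfies the Jacobi identity
  $a_g(u,v)(gw-w) + a_g(v,w)(gu-u) + a_g(w,u)(gv-v) = 0$. Necessity: commuting the relations with
  \<open>h \<in> G\<close> or with \<open>u \<in> V\<close> gives elements of degree at most 1 in the ideal, and by a dimension count the
  ideal meets degree at most 1 only in 0. Sufficiency: in the style of Bergman's diamond lemma, a linear
  functional on words that separates normal forms in degree \<open>k\<close> is continued degree by degree to one
  that vanishes on the ideal; equivariance and the Jacobi identity make the continuation
  independent of the order of the exchanges.

  By equivariance, \<open>a\<close> is determined by the forms \<open>a\<^sub>g\<close> at class representatives \<open>g\<close>, which have to be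
  invariant under the centralizer of \<open>g\<close> and satisfy the Jacobi identity. If \<open>g\<close> acts trivially the identity
  is void. If $\mathrm{codim} V^g \geq 2$, it forces $V^g$ into the radical of \<open>a\<^sub>g\<close>; in codimension 2
  the form is then a multiple of the determinant of $(V^g)^\perp$, in higher codimension it vanishes,
  and in codimension 1 invariance under \<open>g\<close> itself kills it. The semi-invariants of degree 0 are
  described by the same case distinction.\<close>

section \<open>Linear extension along a basis\<close>

text \<open>Both gr A and S(V)#G are quotients of T(V)#G (\<open>gr_map\<close>,
  \<open>proj\<close>). For arbitrary forms the kernel of \<open>proj\<close> lies in that of
  \<open>gr_map\<close>, since exchanging two adjacent letters costs only terms of lower degree.
  What has to be excluded for sufficiency is that the ideal contains elements with unexpected
  leading terms. A functional that vanishes on the ideal and reads off one leading coefficient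
  certifies this. Continuing such a functional by one degree means solving a difference equation for
  adjacent exchanges, and the two conditions on the forms answer to two Coxeter relations:
  equivariance makes exchanges of disjoint pairs commute, the Jacobi identity yields the braid
  relation. For necessity the obstacle is that the hypothesis supplies some graded isomorphism, not
  the one induced by \<open>proj\<close>. This is why dimensions are counted instead of comparing
  kernels; degrees 0 and 1, where T(V) and S(V) agree, are enough, because all consequences of the
  relations that matter live there.\<close>

definition lfun :: "('b \<Rightarrow> complex) \<Rightarrow> ('b \<Rightarrow>\<^sub>0 complex) \<Rightarrow> complex" where
  "lfun f p = (\<Sum>k\<in>Poly_Mapping.keys p. Poly_Mapping.lookup p k * f k)"

text \<open>The common source of \<open>tens_act\<close>, \<open>sym_act\<close>,
  \<open>sym_proj\<close> and \<open>deg_part\<close>: linearity comes for free, and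
  multiplicativity follows from that on the indexing monoid (\<open>lext_mult\<close>). So the laws
  of all these maps are instances of one set of lemmas.\<close>

definition lext :: "('b \<Rightarrow> 'c::monoid_add \<Rightarrow>\<^sub>0 complex) \<Rightarrow> ('b \<Rightarrow>\<^sub>0 complex) \<Rightarrow> 'c \<Rightarrow>\<^sub>0 complex" where
  "lext f p = (\<Sum>k\<in>Poly_Mapping.keys p. scal (Poly_Mapping.lookup p k) * f k)"

lemma scal_0 [simp]: "scal 0 = 0"
  by (simp add: scal_def)

lemma scal_1 [simp]: "scal 1 = 1"
  by (simp add: scal_def)

lemma scal_add: "scal (c + d) = scal c + scal d"
  by (simp add: scal_def single_add)

lemma scal_minus: "scal (- c) = - scal c"
  by (simp add: scal_def single_uminus)

lemma scal_mult: "scal c * scal d = scal (c * d)"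
  by (simp add: scal_def mult_single)

lemma scal_mult_assoc: "scal c * (scal d * p) = scal (c * d) * p"
  by (simp add: scal_mult flip: mult.assoc)

lemma scal_sum: "scal (sum f A) = (\<Sum>x\<in>A. scal (f x))"
  by (induction A rule: infinite_finite_induct) (simp_all add: scal_add)

lemma scal_eq_iff [simp]: "scal c = scal d \<longleftrightarrow> c = d"
  by (metis lookup_single_eq scal_def)

lemma lookup_scal_0 [simp]: "Poly_Mapping.lookup (scal c) 0 = c"
  by (simp add: scal_def)

lemma scal_single: "scal c * Poly_Mapping.single k d = Poly_Mapping.single k (c * d)"
  by (simp add: scal_def mult_single)

lemma single_scal: "Poly_Mapping.single k d * scal c = Poly_Mapping.single k (c * d)"
  by (simp add: scal_def mult_single mult.commute)

text \<open>The summands may overlap, so every identity between additive expressions reduces to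
  single monomials.\<close>

lemma poly_mapping_induct [case_names single add]:
  fixes p :: "'b \<Rightarrow>\<^sub>0 complex"
  assumes "\<And>k c. P (Poly_Mapping.single k c)" and "\<And>p q. P p \<Longrightarrow> P q \<Longrightarrow> P (p + q)"
  shows "P p"
proof (induction p rule: update_induct)
  case const
  show ?case using assms(1)[of undefined 0] by simp
next
  case (update f a b)
  have "Poly_Mapping.update a b f = f + Poly_Mapping.single a b"
    using update(1) by (intro poly_mapping_eqI)
      (auto simp: lookup_update lookup_add lookup_single when_def in_keys_iff)
  then show ?case using assms update by metis
qed

text \<open>Scalars have to be shown central, because the indexing monoid, here that of words, need
  not be commutative.\<close>

lemma scal_comm: "p * scal c = scal c * p"
  by (induction p rule: poly_mapping_induct) (simp_all add: scal_single single_scal algebra_simps)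

lemma lookup_scal_mult [simp]: "Poly_Mapping.lookup (scal c * p) k = c * Poly_Mapping.lookup p k"
  by (induction p rule: poly_mapping_induct)
    (simp_all add: scal_single lookup_add lookup_single when_def distrib_left)

lemma lfun_superset:
  assumes "finite S" "Poly_Mapping.keys p \<subseteq> S"
  shows "lfun f p = (\<Sum>k\<in>S. Poly_Mapping.lookup p k * f k)"
  unfolding lfun_def using assms by (intro sum.mono_neutral_left) (auto simp: in_keys_iff)

lemma lfun_0 [simp]: "lfun f 0 = 0"
  by (simp add: lfun_def)

lemma lfun_single [simp]: "lfun f (Poly_Mapping.single k c) = c * f k"
  by (simp add: lfun_def)

lemma lfun_add: "lfun f (p + q) = lfun f p + lfun f q"
proof -
  let ?S = "Poly_Mapping.keys p \<union> Poly_Mapping.keys q"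
  have "Poly_Mapping.keys (p + q) \<subseteq> ?S" by (rule Poly_Mapping.keys_add)
  then show ?thesis
    by (simp add: lfun_superset[of ?S] lookup_add distrib_right sum.distrib)
qed

lemma lfun_minus: "lfun f (- p) = - lfun f p"
  using lfun_add[of f p "- p"] by (simp add: eq_neg_iff_add_eq_0 add.commute)

lemma lfun_diff: "lfun f (p - q) = lfun f p - lfun f q"
  using lfun_add[of f p "- q"] by (simp add: lfun_minus)

lemma lfun_sum: "lfun f (sum g A) = (\<Sum>x\<in>A. lfun f (g x))"
  by (induction A rule: infinite_finite_induct) (simp_all add: lfun_add)

lemma lfun_scal: "lfun f (scal c * p) = c * lfun f p"
  by (induction p rule: poly_mapping_induct) (simp_all add: scal_single lfun_add distrib_left)

lemma lfun_cong: "(\<And>k. k \<in> Poly_Mapping.keys p \<Longrightarrow> f k = g k) \<Longrightarrow> lfun f p = lfun g p"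
  by (simp add: lfun_def)

lemma lookup_lext: "Poly_Mapping.lookup (lext f p) k = lfun (\<lambda>b. Poly_Mapping.lookup (f b) k) p"
  by (simp add: lext_def lfun_def lookup_sum)

lemma lext_0 [simp]: "lext f 0 = 0"
  by (simp add: lext_def)

lemma lext_single [simp]: "lext f (Poly_Mapping.single k c) = scal c * f k"
  by (simp add: lext_def)

lemma lext_add: "lext f (p + q) = lext f p + lext f q"
  by (rule poly_mapping_eqI) (simp add: lookup_lext lookup_add lfun_add)

lemma lext_diff: "lext f (p - q) = lext f p - lext f q"
  by (rule poly_mapping_eqI) (simp add: lookup_lext lookup_minus lfun_diff)

lemma lext_sum: "lext f (sum g A) = (\<Sum>x\<in>A. lext f (g x))"
  by (induction A rule: infinite_finite_induct) (simp_all add: lext_add)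

lemma lext_scal: "lext f (scal c * p) = scal c * lext f p"
  by (rule poly_mapping_eqI) (simp add: lookup_lext lfun_scal)

lemma lext_const: "f 0 = 1 \<Longrightarrow> lext f (scal c) = scal c"
  by (simp add: scal_def)

lemma lext_one:
  fixes f :: "'b::monoid_add \<Rightarrow> 'c::monoid_add \<Rightarrow>\<^sub>0 complex"
  shows "f 0 = 1 \<Longrightarrow> lext f 1 = 1"
  using lext_const[of f 1] by simp

lemma lext_mult:
  assumes "\<And>a b. f (a + b) = f a * f b"
  shows "lext f (p * q) = lext f p * lext f q"
proof (induction p rule: poly_mapping_induct)
  case (single k c)
  show ?case
  proof (induction q rule: poly_mapping_induct)
    case (single l d)
    have "scal c * f k * (scal d * f l) = scal c * (f k * scal d) * f l"
      by (simp only: mult.assoc)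
    also have "\<dots> = scal (c * d) * (f k * f l)"
      by (simp only: scal_comm mult.assoc scal_mult_assoc)
    finally show ?case by (simp add: mult_single assms)
  next
    case (add p q)
    then show ?case by (simp add: distrib_left lext_add)
  qed
next
  case (add p q)
  then show ?case by (simp add: distrib_right lext_add)
qed

lemma lext_comp: "lext f (lext g p) = lext (\<lambda>b. lext f (g b)) p"
  by (induction p rule: poly_mapping_induct) (simp_all add: lext_add lext_scal)

lemma lext_ident: "lext (\<lambda>w. Poly_Mapping.single w 1) p = p"
  by (induction p rule: poly_mapping_induct) (simp_all add: lext_add scal_single)

section \<open>Homomorphisms between the tensor and the symmetric algebra\<close>

definition tens_prod :: "complex ^ 'n ^ 'n \<Rightarrow> 'n list \<Rightarrow> 'n::finite tens" where
  "tens_prod M w = prod_list (map (\<lambda>i. tens_vec (column i M)) w)"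

text \<open>The abelianization of the free monoid: the exponent vector of the commutative monomial
  that a word becomes.\<close>

definition letter_exp :: "'n list \<Rightarrow> 'n \<Rightarrow>\<^sub>0 nat" where
  "letter_exp w = sum_list (map (\<lambda>i. Poly_Mapping.single i 1) w)"

text \<open>The canonical projection from T(V) onto S(V).\<close>

definition sym_proj :: "'n tens \<Rightarrow> 'n spoly" where
  "sym_proj = lext (\<lambda>w. Poly_Mapping.single (letter_exp w) 1)"

definition deg_part :: "nat \<Rightarrow> 'n tens \<Rightarrow> 'n tens" where
  "deg_part k = lext (\<lambda>w. if length w = k then Poly_Mapping.single w 1 else 0)"

abbreviation word :: "'n list \<Rightarrow> 'n tens" where
  "word w \<equiv> Poly_Mapping.single w 1"

lemma tens_act_lext: "tens_act M = lext (tens_prod M)"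
  by (simp add: tens_act_def lext_def tens_prod_def fun_eq_iff)

lemma sym_act_lext:
  "sym_act M = lext (\<lambda>e. \<Prod>i\<in>UNIV. sym_vec (column i M) ^ Poly_Mapping.lookup e i)"
  by (simp add: sym_act_def lext_def fun_eq_iff)

lemma tens_prod_Nil [simp]: "tens_prod M [] = 1"
  by (simp add: tens_prod_def)

lemma tens_prod_Cons [simp]: "tens_prod M (i # w) = tens_vec (column i M) * tens_prod M w"
  by (simp add: tens_prod_def)

lemma tens_prod_append: "tens_prod M (u @ v) = tens_prod M u * tens_prod M v"
  by (simp add: tens_prod_def)

lemma word_mult: "word u * word v = word (u @ v)"
  by (simp add: mult_single plus_list_def)

lemma word_Nil [simp]: "word [] = 1"
  by (simp flip: zero_list_def)

lemma tens_act_add: "tens_act M (p + q) = tens_act M p + tens_act M q"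
  and tens_act_diff: "tens_act M (p - q) = tens_act M p - tens_act M q"
  and tens_act_0 [simp]: "tens_act M 0 = 0"
  and tens_act_scal: "tens_act M (scal c * p) = scal c * tens_act M p"
  and tens_act_const [simp]: "tens_act M (scal c) = scal c"
  and tens_act_1 [simp]: "tens_act M 1 = 1"
  and tens_act_mult: "tens_act M (p * q) = tens_act M p * tens_act M q"
  by (simp_all add: tens_act_lext lext_add lext_diff lext_scal lext_const lext_one
      lext_mult zero_list_def plus_list_def tens_prod_append)

lemma tens_act_word [simp]: "tens_act M (word w) = tens_prod M w"
  by (simp add: tens_act_lext)

lemma sym_act_add: "sym_act M (p + q) = sym_act M p + sym_act M q"
  and sym_act_0 [simp]: "sym_act M 0 = 0"
  and sym_act_scal: "sym_act M (scal c * p) = scal c * sym_act M p"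
  and sym_act_const [simp]: "sym_act M (scal c) = scal c"
  and sym_act_1 [simp]: "sym_act M 1 = 1"
  and sym_act_mult: "sym_act M (p * q) = sym_act M p * sym_act M q"
  by (simp_all add: sym_act_lext lext_add lext_scal lext_const lext_one lext_mult lookup_add
      power_add prod.distrib)

lemma letter_exp_Nil [simp]: "letter_exp [] = 0"
  by (simp add: letter_exp_def)

lemma letter_exp_Cons [simp]: "letter_exp (i # w) = Poly_Mapping.single i 1 + letter_exp w"
  by (simp add: letter_exp_def)

lemma letter_exp_append: "letter_exp (u @ v) = letter_exp u + letter_exp v"
  by (simp add: letter_exp_def)

lemma lookup_letter_exp: "Poly_Mapping.lookup (letter_exp w) i = count_list w i"
  by (induction w) (auto simp: lookup_add lookup_single when_def)

lemma letter_exp_eq_iff: "letter_exp u = letter_exp v \<longleftrightarrow> mset u = mset v"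
  by (auto simp: poly_mapping_eq_iff fun_eq_iff lookup_letter_exp multiset_eq_iff count_mset
      count_list_eq_length_filter)

lemma mono_deg_letter_exp: "mono_deg (letter_exp w) = length w"
  by (induction w) (simp_all add: mono_deg_def lookup_add sum.distrib lookup_single when_def)

lemma ex_letter_exp: "\<exists>w. letter_exp w = (e :: 'n::finite \<Rightarrow>\<^sub>0 nat)"
proof -
  obtain w where "mset w = (\<Sum>i\<in>UNIV. replicate_mset (Poly_Mapping.lookup e i) i)"
    using ex_mset by blast
  then have "count (mset w) k = Poly_Mapping.lookup e k" for k
    by (simp add: count_sum)
  then have "letter_exp w = e"
    by (intro poly_mapping_eqI) (simp add: lookup_letter_exp count_list_eq_length_filter count_mset)
  then show ?thesis ..
qed

lemma sym_proj_add: "sym_proj (p + q) = sym_proj p + sym_proj q"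
  and sym_proj_diff: "sym_proj (p - q) = sym_proj p - sym_proj q"
  and sym_proj_0 [simp]: "sym_proj 0 = 0"
  and sym_proj_scal: "sym_proj (scal c * p) = scal c * sym_proj p"
  and sym_proj_1 [simp]: "sym_proj 1 = 1"
  and sym_proj_sum: "sym_proj (sum f A) = (\<Sum>x\<in>A. sym_proj (f x))"
  and sym_proj_mult: "sym_proj (p * q) = sym_proj p * sym_proj q"
  by (simp_all add: sym_proj_def lext_add lext_diff lext_scal lext_const lext_one
      lext_mult lext_sum zero_list_def plus_list_def letter_exp_append mult_single)

lemma sym_proj_word: "sym_proj (word w) = Poly_Mapping.single (letter_exp w) 1"
  by (simp add: sym_proj_def)

lemma sym_proj_tens_vec: "sym_proj (tens_vec v) = sym_vec v"
  by (simp add: tens_vec_def sym_vec_def sym_proj_sum)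
    (simp add: sym_proj_def scal_single)

text \<open>Both composites are algebra homomorphisms, so it suffices to compare them on letters
  (\<open>gen\<close>). The equivariance makes \<open>proj\<close> multiplicative and carries the
  laws of the action over from T(V) to S(V).\<close>

lemma sym_proj_act: "sym_proj (tens_act M p) = sym_act M (sym_proj p)"
proof -
  have gen: "sym_act M (Poly_Mapping.single (Poly_Mapping.single i (Suc 0)) 1) = sym_vec (column i M)" for i
  proof -
    have "(\<Prod>j\<in>UNIV. sym_vec (column j M) ^ (if i = j then Suc 0 else 0)) = sym_vec (column i M)"
      by (subst prod.mono_neutral_right[of UNIV "{i}"]) auto
    then show ?thesis by (simp add: sym_act_lext lookup_single when_def)
  qed
  have word: "sym_proj (tens_prod M w) = sym_act M (sym_proj (word w))" for w
  proof (induction w)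
    case (Cons i w)
    have "sym_proj (word (i # w)) = sym_proj (word [i]) * sym_proj (word w)"
      by (simp add: word_mult flip: sym_proj_mult)
    then show ?case
      using Cons by (simp add: sym_proj_mult sym_act_mult sym_proj_tens_vec gen sym_proj_word)
  qed simp
  show ?thesis
  proof (induction p rule: poly_mapping_induct)
    case (single k c)
    have "Poly_Mapping.single k c = scal c * word k" by (simp add: scal_single)
    then show ?case by (simp only: tens_act_scal sym_proj_scal sym_act_scal tens_act_word word)
  qed (simp add: tens_act_add sym_proj_add sym_act_add)
qed

lemma surj_sym_proj: "\<exists>p. sym_proj p = (q :: 'n::finite spoly)"
proof (induction q rule: poly_mapping_induct)
  case (single e c)
  obtain w where "letter_exp w = e" using ex_letter_exp by blast
  then have "sym_proj (Poly_Mapping.single w c) = Poly_Mapping.single e c"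
    by (simp add: sym_proj_def scal_single)
  then show ?case ..
next
  case (add p q)
  then show ?case by (metis sym_proj_add)
qed

lemma tens_vec_add: "tens_vec (v + w) = tens_vec v + tens_vec w"
  by (simp add: tens_vec_def single_add sum.distrib)

lemma tens_vec_scale: "tens_vec (c *s v) = scal c * tens_vec v"
  by (simp add: tens_vec_def sum_distrib_left scal_single)

lemma tens_vec_0 [simp]: "tens_vec 0 = 0"
  by (simp add: tens_vec_def)

lemma tens_vec_sum: "tens_vec (sum f A) = (\<Sum>x\<in>A. tens_vec (f x))"
  by (induction A rule: infinite_finite_induct) (simp_all add: tens_vec_add)

lemma tens_vec_axis [simp]: "tens_vec (axis i 1) = word [i]"
proof -
  have "tens_vec (axis i (1::complex)) = (\<Sum>j\<in>UNIV. if i = j then word [i] else 0)"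
    unfolding tens_vec_def axis_def by (intro sum.cong) auto
  then show ?thesis by simp
qed

lemma tens_vec_expand: "tens_vec v = (\<Sum>i\<in>UNIV. scal (v $ i) * word [i])"
  by (simp add: tens_vec_def scal_single)

lemma tens_act_sum: "tens_act M (sum f A) = (\<Sum>x\<in>A. tens_act M (f x))"
  by (simp add: tens_act_lext lext_sum)

lemma tens_act_tens_vec: "tens_act M (tens_vec v) = tens_vec (M *v v)"
proof -
  have "M *v v = (\<Sum>i\<in>UNIV. (v $ i) *s column i M)"
    by (simp add: matrix_mult_sum)
  then show ?thesis
    by (simp add: tens_vec_expand[of v] tens_act_sum tens_act_scal tens_vec_sum tens_vec_scale)
qed

lemma tens_act_comp: "tens_act (M ** N) p = tens_act M (tens_act N p)"
proof -
  have "tens_prod (M ** N) w = tens_act M (tens_prod N w)" for w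
  proof (induction w)
    case (Cons i w)
    have "column i (M ** N) = M *v column i N"
      by (simp add: vec_eq_iff column_def matrix_matrix_mult_def matrix_vector_mult_def)
    then show ?case using Cons by (simp add: tens_act_mult tens_act_tens_vec)
  qed simp
  then have "tens_prod (M ** N) = (\<lambda>w. lext (tens_prod M) (tens_prod N w))"
    by (simp add: fun_eq_iff tens_act_lext)
  then show ?thesis by (simp only: tens_act_lext lext_comp)
qed

lemma tens_act_mat_1 [simp]:
  fixes p :: "'n::finite tens"
  shows "tens_act (mat 1) p = p"
proof -
  have "tens_prod (mat 1) w = word w" for w :: "'n list"
  proof (induction w)
    case (Cons i w)
    have "column i (mat 1) = axis i (1::complex)"
      by (simp add: vec_eq_iff column_def mat_def axis_def)
    then show ?case using Cons by (simp add: word_mult)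
  qed simp
  then have "tens_prod (mat 1) = (\<lambda>w :: 'n list. word w)" by (simp add: fun_eq_iff)
  then show ?thesis by (simp only: tens_act_lext lext_ident)
qed

lemma tens_prod_mat_1 [simp]: "tens_prod (mat 1) w = word w"
  by (metis tens_act_mat_1 tens_act_word)

lemma deg_part_add: "deg_part k (p + q) = deg_part k p + deg_part k q"
  and deg_part_diff: "deg_part k (p - q) = deg_part k p - deg_part k q"
  and deg_part_0 [simp]: "deg_part k 0 = 0"
  and deg_part_scal: "deg_part k (scal c * p) = scal c * deg_part k p"
  and deg_part_sum: "deg_part k (sum f A) = (\<Sum>x\<in>A. deg_part k (f x))"
  by (simp_all add: deg_part_def lext_add lext_diff lext_scal lext_sum)

lemma lookup_deg_part:
  "Poly_Mapping.lookup (deg_part k p) w = (if length w = k then Poly_Mapping.lookup p w else 0)"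
  by (induction p rule: poly_mapping_induct)
    (simp_all add: deg_part_add lookup_add, simp add: deg_part_def scal_single lookup_single when_def)

lemma keys_deg_part: "Poly_Mapping.keys (deg_part k p) = {w \<in> Poly_Mapping.keys p. length w = k}"
  by (auto simp: in_keys_iff lookup_deg_part split: if_splits)

lemma deg_part_single: "deg_part k (Poly_Mapping.single w c) =
    (if length w = k then Poly_Mapping.single w c else 0)"
  by (simp add: deg_part_def scal_single)

lemma deg_part_mult: "deg_part k (p * q) = (\<Sum>i\<le>k. deg_part i p * deg_part (k - i) q)"
proof (induction p rule: poly_mapping_induct)
  case (single u c)
  show ?case
  proof (induction q rule: poly_mapping_induct)
    case (single v d)
    have "(\<Sum>i\<le>k. deg_part i (Poly_Mapping.single u c) * deg_part (k - i) (Poly_Mapping.single v d))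
      = (\<Sum>i\<le>k. if i = length u then
           (if length v = k - length u then Poly_Mapping.single (u + v) (c * d) else 0) else 0)"
      by (intro sum.cong) (auto simp: deg_part_single mult_single)
    also have "\<dots> = deg_part k (Poly_Mapping.single u c * Poly_Mapping.single v d)"
      by (auto simp: mult_single deg_part_single plus_list_def)
    finally show ?case ..
  qed (simp add: distrib_left deg_part_add sum.distrib)
qed (simp add: distrib_right deg_part_add sum.distrib)

text \<open>The action substitutes a linear form for each letter, so it respects word length; hence
  it commutes with \<open>deg_part\<close>.\<close>

lemma keys_tens_prod: "u \<in> Poly_Mapping.keys (tens_prod M w) \<Longrightarrow> length u = length w"
proof (induction w arbitrary: u)
  case (Cons i w)
  have "Poly_Mapping.keys (tens_vec (column i M)) \<subseteq> (\<Union>j. Poly_Mapping.keys (Poly_Mapping.single [j] (column i M $ j)))"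
    unfolding tens_vec_def by (rule keys_sum)
  then have "length x = 1" if "x \<in> Poly_Mapping.keys (tens_vec (column i M))" for x
    using that by (auto split: if_splits)
  then show ?case
    using Cons keys_mult[of "tens_vec (column i M)" "tens_prod M w"] by (fastforce simp: plus_list_def)
qed (simp add: zero_list_def)

lemma deg_part_act: "deg_part k (tens_act M p) = tens_act M (deg_part k p)"
proof (induction p rule: poly_mapping_induct)
  case (single w c)
  have "Poly_Mapping.lookup (tens_prod M w) u = 0" if "length u \<noteq> length w" for u
    using keys_tens_prod[of u M w] that by (auto simp: in_keys_iff)
  then have "deg_part k (tens_prod M w) = (if length w = k then tens_prod M w else 0)"
    by (intro poly_mapping_eqI) (auto simp: lookup_deg_part)
  then show ?case
    by (simp add: tens_act_lext deg_part_single deg_part_scal)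
qed (simp add: tens_act_add deg_part_add)

lemma lookup_sym_proj_deg_part:
  "Poly_Mapping.lookup (sym_proj (deg_part k p)) e =
    (if mono_deg e = k then Poly_Mapping.lookup (sym_proj p) e else 0)"
proof (induction p rule: poly_mapping_induct)
  case (single w c)
  show ?case
    by (auto simp: deg_part_single sym_proj_def scal_single lookup_single when_def
        mono_deg_letter_exp)
qed (simp add: deg_part_add sym_proj_add lookup_add)

section \<open>Sums along sorting paths\<close>

text \<open>The termination measure for sorting: exchanging an adjacent descent removes exactly one
  inversion.\<close>

fun inversions :: "('n \<Rightarrow> nat) \<Rightarrow> 'n list \<Rightarrow> nat" where
  "inversions r [] = 0"
| "inversions r (x # w) = length (filter (\<lambda>y. r y < r x) w) + inversions r w"

lemma inversions_swap:
  "r y < r x \<Longrightarrow> inversions r (u @ x # y # v) = Suc (inversions r (u @ y # x # v))"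
  by (induction u) auto

definition descent :: "('n \<Rightarrow> nat) \<Rightarrow> 'n list \<Rightarrow> 'n list \<times> 'n \<times> 'n \<times> 'n list \<Rightarrow> bool" where
  "descent r w t = (case t of (u, x, y, v) \<Rightarrow> w = u @ x # y # v \<and> r y < r x)"

text \<open>The sum of \<open>\<psi>\<close> along one sorting path, with an arbitrary choice of the
  descent at each step. Sorted words get the value 0, which fixes the freedom of one constant for
  each multiset of letters. That the choice does not matter is the content of
  \<open>ex_exchange_potential\<close>.\<close>

function path_sum :: "('n \<Rightarrow> nat) \<Rightarrow> ('n list \<Rightarrow> 'n \<Rightarrow> 'n \<Rightarrow> 'n list \<Rightarrow> 'v::ab_group_add)
    \<Rightarrow> 'n list \<Rightarrow> 'v" where
  "path_sum r \<psi> w = (if \<exists>t. descent r w t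
     then (case SOME t. descent r w t of (u, x, y, v) \<Rightarrow> path_sum r \<psi> (u @ y # x # v) + \<psi> u x y v)
     else 0)"
  by auto
termination
  apply (relation "Wellfounded.measure (\<lambda>(r, \<psi>, w). inversions r w)")
  apply simp
  subgoal premises prems for r \<psi> w
    using someI_ex[OF prems(1)] prems(2-)
    by (cases "SOME t. descent r w t") (simp add: descent_def inversions_swap)
  done

declare path_sum.simps [simp del]

text \<open>A function \<open>\<psi>\<close> of adjacent exchanges is a coboundary if it respects the Coxeter relations of the
  symmetric group: \<open>refl\<close> and \<open>skew\<close> (involutions), \<open>far\<close> (distant transpositions commute) and
  \<open>braid\<close>.\<close>

lemma ex_exchange_potential:
  fixes \<psi> :: "'n list \<Rightarrow> 'n \<Rightarrow> 'n \<Rightarrow> 'n list \<Rightarrow> 'v::ab_group_add" and r :: "'n \<Rightarrow> nat"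
  assumes inj: "inj r"
    and refl: "\<And>u x w. \<psi> u x x w = 0"
    and skew: "\<And>u x y w. \<psi> u x y w = - \<psi> u y x w"
    and far: "\<And>u x y m k l w. \<psi> u x y (m @ k # l # w) - \<psi> u x y (m @ l # k # w) =
       \<psi> (u @ x # y # m) k l w - \<psi> (u @ y # x # m) k l w"
    and braid: "\<And>u x y z w. \<psi> u z y (x # w) + \<psi> (u @ [y]) z x w + \<psi> u y x (z # w) =
       \<psi> (u @ [z]) y x w + \<psi> u z x (y # w) + \<psi> (u @ [x]) z y w"
  shows "\<exists>L. \<forall>u x y w. L (u @ x # y # w) - L (u @ y # x # w) = \<psi> u x y w"
proof -
  define L where "L = path_sum r \<psi>"
  \<comment> \<open>Local confluence: two descents of the same word, the first one not to the right
    of the second, lead to the same value if the claim is known for words with fewer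
    inversions.\<close>
  have compat: "L (u @ y # x # v) + \<psi> u x y v = L (u' @ y' # x' # v') + \<psi> u' x' y' v'"
    if w: "w = u @ x # y # v" "r y < r x" "w = u' @ x' # y' # v'" "r y' < r x'"
      and le: "length u \<le> length u'"
      and IH: "\<And>u x y v. inversions r (u @ x # y # v) < inversions r w \<Longrightarrow> r y < r x \<Longrightarrow>
        L (u @ x # y # v) = L (u @ y # x # v) + \<psi> u x y v"
    for w u x y v u' x' y' v'
  proof -
    obtain m where m: "u' = u @ m" "x # y # v = m @ x' # y' # v'"
      using w(1,3) le by (auto simp: append_eq_append_conv2)
    \<comment> \<open>The two descents coincide, share one letter, or are disjoint.\<close>
    consider "m = []" | "m = [x]" | m' where "m = x # y # m'"
      using m(2) by (cases m; cases "tl m") auto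
    then show ?thesis
    proof cases
      case 1
      then show ?thesis using m by simp
    next
      case 2
      then have eq: "y = x'" "v = y' # v'" "u' = u @ [x]" using m by auto
      \<comment> \<open>The overlapping descents involve three letters of decreasing rank,
        \<open>?z\<close>, \<open>y\<close>, \<open>?x\<close>. Both exchanges can be continued to
        the word in which the three are reversed. The induction hypothesis covers the four further
        exchanges, and \<open>braid\<close> compares the two routes.\<close>
      let ?z = x and ?x = y'
      have i1: "inversions r w = Suc (inversions r (u @ y # ?z # ?x # v'))"
        using w(1,2) eq inversions_swap[of r y x u "?x # v'"] by simp
      have i2: "inversions r w = Suc (inversions r (u @ ?z # ?x # y # v'))"
        using w(3,4) eq inversions_swap[of r "?x" y "u @ [x]" v'] by simp
      have lt: "r ?x < r ?z" using w eq by simp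
      have i3: "inversions r (u @ y # ?z # ?x # v') = Suc (inversions r (u @ y # ?x # ?z # v'))"
        using lt inversions_swap[of r "?x" "?z" "u @ [y]" v'] by simp
      have i4: "inversions r (u @ ?z # ?x # y # v') = Suc (inversions r (u @ ?x # ?z # y # v'))"
        using lt inversions_swap[of r "?x" "?z" "u" "y # v'"] by simp
      have "L (u @ y # ?z # ?x # v') = L (u @ y # ?x # ?z # v') + \<psi> (u @ [y]) ?z ?x v'"
        using IH[of "u @ [y]" ?z ?x v'] i1 lt by simp
      moreover have "L (u @ y # ?x # ?z # v') = L (u @ ?x # y # ?z # v') + \<psi> u y ?x (?z # v')"
        using IH[of u y ?x "?z # v'"] i1 i3 w eq by simp
      moreover have "L (u @ ?z # ?x # y # v') = L (u @ ?x # ?z # y # v') + \<psi> u ?z ?x (y # v')"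
        using IH[of u ?z ?x "y # v'"] i2 lt by simp
      moreover have "L (u @ ?x # ?z # y # v') = L (u @ ?x # y # ?z # v') + \<psi> (u @ [?x]) ?z y v'"
        using IH[of "u @ [?x]" ?z y v'] i2 i4 w eq by simp
      ultimately show ?thesis
        using braid[of u ?z y ?x v'] eq by (simp add: algebra_simps)
    next
      case 3
      \<comment> \<open>Disjoint descents: each exchange is followed by the other one, and
        \<open>far\<close> compares the two orders.\<close>
      then have eq: "v = m' @ x' # y' # v'" "u' = u @ x # y # m'" using m by auto
      have i1: "inversions r w = Suc (inversions r (u @ y # x # v))"
        using w(1,2) inversions_swap by metis
      have i2: "inversions r w = Suc (inversions r (u' @ y' # x' # v'))"
        using w(3,4) inversions_swap by metis
      have "L (u @ y # x # v) = L (u @ y # x # m' @ y' # x' # v') + \<psi> (u @ y # x # m') x' y' v'"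
        using IH[of "u @ y # x # m'" x' y' v'] i1 w eq by simp
      moreover have "L (u' @ y' # x' # v') = L (u @ y # x # m' @ y' # x' # v') + \<psi> u x y (m' @ y' # x' # v')"
        using IH[of u x y "m' @ y' # x' # v'"] i2 w eq by simp
      ultimately show ?thesis
        using far[of u x y m' x' y' v'] eq by (simp add: algebra_simps)
    qed
  qed
  \<comment> \<open>Induction on the number of inversions: the recursion follows the chosen descent,
    and \<open>compat\<close> replaces it by the given one.\<close>
  have main: "r y < r x \<Longrightarrow> L (u @ x # y # v) = L (u @ y # x # v) + \<psi> u x y v" for u x y v
  proof (induction "inversions r (u @ x # y # v)" arbitrary: u x y v rule: less_induct)
    case less
    let ?w = "u @ x # y # v"
    have d: "descent r ?w (u, x, y, v)" using less.prems by (simp add: descent_def)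
    obtain u' x' y' v' where t: "(SOME t. descent r ?w t) = (u', x', y', v')"
      by (metis prod.exhaust)
    then have d': "descent r ?w (u', x', y', v')" using d by (metis someI)
    have "L ?w = L (u' @ y' # x' # v') + \<psi> u' x' y' v'"
      unfolding L_def using d t by (subst path_sum.simps) (auto simp: L_def)
    also have "\<dots> = L (u @ y # x # v) + \<psi> u x y v"
    proof (cases "length u \<le> length u'")
      case True
      then show ?thesis
        using compat[of ?w u x y v u' x' y' v'] less d' by (simp add: descent_def)
    next
      case False
      then show ?thesis
        using compat[of ?w u' x' y' v' u x y v] less d' by (simp add: descent_def)
    qed
    finally show ?case .
  qed
  have "L (u @ x # y # w) - L (u @ y # x # w) = \<psi> u x y w" for u x y w
  proof (cases "r x" "r y" rule: linorder_cases)
    case less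
    then show ?thesis using main[of x y u w] skew[of u x y w] by simp
  next
    case equal
    then have "x = y" using inj by (simp add: injD)
    then show ?thesis by (simp add: refl)
  next
    case greater
    then show ?thesis using main[of y x u w] by simp
  qed
  then show ?thesis by blast
qed

section \<open>Functionals on the skew group algebra of the tensor algebra\<close>

lemma keys_word_act:
  "v \<in> Poly_Mapping.keys (word u * tens_act M (word w)) \<Longrightarrow> length v = length u + length w"
  using keys_mult[of "word u" "tens_act M (word w)"] by (auto simp: plus_list_def dest!: keys_tens_prod)

lemma word_Cons: "word (x # w) = word [x] * word w"
  by (simp add: word_mult)

lemma word_append: "word (u @ w) = word u * word w"
  by (simp add: word_mult)

locale finite_rep = group G for G (structure) +
  fixes \<rho> :: "'a \<Rightarrow> complex ^ 'n ^ 'n::finite"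
  assumes finite_carrier: "finite (carrier G)" and rep: "is_representation G \<rho>"
begin

lemma rho_one [simp]: "\<rho> \<one> = mat 1"
  using rep by (simp add: is_representation_def)

lemma rho_mult: "g \<in> carrier G \<Longrightarrow> h \<in> carrier G \<Longrightarrow> \<rho> (g \<otimes> h) = \<rho> g ** \<rho> h"
  using rep by (simp add: is_representation_def)

lemma rho_inv: "g \<in> carrier G \<Longrightarrow> \<rho> (inv g) ** \<rho> g = mat 1" "g \<in> carrier G \<Longrightarrow> \<rho> g ** \<rho> (inv g) = mat 1"
  by (simp_all flip: rho_mult)

lemma inv_cancel [simp]:
  assumes "g \<in> carrier G" "k \<in> carrier G"
  shows "inv g \<otimes> (g \<otimes> k) = k" "g \<otimes> (inv g \<otimes> k) = k"
  using assms by (simp_all flip: m_assoc)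

lemma bij_betw_conj:
  assumes "g \<in> carrier G"
  shows "bij_betw (\<lambda>j. g \<otimes> j \<otimes> inv g) (carrier G) (carrier G)"
  using assms by (intro bij_betwI[where g = "\<lambda>j. inv g \<otimes> j \<otimes> g"]) (auto simp: m_assoc)

lemma rho_inv_vec: "g \<in> carrier G \<Longrightarrow> \<rho> (inv g) *v (\<rho> g *v v) = v"
  "g \<in> carrier G \<Longrightarrow> \<rho> g *v (\<rho> (inv g) *v v) = v"
  by (simp_all add: matrix_vector_mul_assoc rho_inv)

end

section \<open>The two conditions on the forms\<close>

definition equivariant_forms ::
  "('g, 'm) monoid_scheme \<Rightarrow> ('g \<Rightarrow> complex ^ 'n ^ 'n) \<Rightarrow>
   ('g \<Rightarrow> complex ^ 'n \<Rightarrow> complex ^ 'n::finite \<Rightarrow> complex) \<Rightarrow> bool" where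
  "equivariant_forms G \<rho> a \<longleftrightarrow> (\<forall>g\<in>carrier G. \<forall>h\<in>carrier G. \<forall>v w.
     a (inv\<^bsub>G\<^esub> h \<otimes>\<^bsub>G\<^esub> g \<otimes>\<^bsub>G\<^esub> h) v w = a g (\<rho> h *v v) (\<rho> h *v w))"

text \<open>The component at one group element of the Jacobi identity for commutators. In A the
  commutator of \<open>v\<close> and \<open>w\<close> is the sum of the terms \<open>a g v w\<close>
  times g, and moving g past \<open>u\<close> turns \<open>u\<close> into g(u); so bracketing with
  \<open>u\<close> leaves a multiple of g(u) - u.\<close>

definition jacobi_form ::
  "complex ^ 'n ^ 'n \<Rightarrow> (complex ^ 'n \<Rightarrow> complex ^ 'n::finite \<Rightarrow> complex) \<Rightarrow> bool" where
  "jacobi_form M b \<longleftrightarrow> (\<forall>u v w.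
     b u v *s (M *v w - w) + b v w *s (M *v u - u) + b w u *s (M *v v - v) = 0)"

lemma skew_formD:
  assumes "skew_form b"
  shows skew_form_add_left: "b (u + v) w = b u w + b v w"
    and skew_form_scale_left: "b (c *s u) w = c * b u w"
    and skew_form_add_right: "b w (u + v) = b w u + b w v"
    and skew_form_scale_right: "b w (c *s u) = c * b w u"
    and skew_form_swap: "b v w = - b w v"
    and skew_form_same: "b v v = 0"
    and skew_form_0_left: "b 0 v = 0"
    and skew_form_0_right: "b v 0 = 0"
proof -
  have lin: "b (c *s u + v) w = c * b u w + b v w" and sw: "b v w = - b w v" for c u v w
    using assms unfolding skew_form_def by blast+
  have l: "b (u + v) w = b u w + b v w" for u v w using lin[of 1 u v w] by simp
  have z: "b 0 v = 0" for v using l[of 0 0 v] by simp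
  have s: "b (c *s u) w = c * b u w" for c u w using lin[of c u 0 w] z by simp
  show "b (u + v) w = b u w + b v w" "b (c *s u) w = c * b u w" "b v w = - b w v" "b 0 v = 0"
    by (fact l s sw z)+
  show "b w (u + v) = b w u + b w v" using sw[of w "u + v"] sw[of w u] sw[of w v] l[of u v w] by simp
  show "b w (c *s u) = c * b w u" using sw[of w "c *s u"] sw[of w u] s[of c u w] by simp
  have "b v v + b v v = 0" using sw[of v v] by (rule eq_neg_iff_add_eq_0[THEN iffD1])
  then have "2 * b v v = 0" by (simp only: mult_2)
  then show "b v v = 0" by simp
  show "b v 0 = 0" using sw[of v 0] z[of v] by simp
qed

lemma skew_form_sum_left: "skew_form b \<Longrightarrow> b (sum f A) w = (\<Sum>x\<in>A. b (f x) w)"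
  by (induction A rule: infinite_finite_induct)
    (simp_all add: skew_form_add_left[of b] skew_form_0_left[of b])

lemma skew_form_sum_right: "skew_form b \<Longrightarrow> b w (sum f A) = (\<Sum>x\<in>A. b w (f x))"
  by (induction A rule: infinite_finite_induct)
    (simp_all add: skew_form_add_right[of b] skew_form_0_right[of b])

section \<open>Continuation of functionals degree by degree\<close>

locale pbw_forms = finite_rep +
  fixes a :: "'a \<Rightarrow> complex ^ 'b \<Rightarrow> complex ^ 'b::finite \<Rightarrow> complex"
  assumes skew: "g \<in> carrier G \<Longrightarrow> skew_form (a g)"
    and equiv: "equivariant_forms G \<rho> a"
    and jacobi: "g \<in> carrier G \<Longrightarrow> jacobi_form (\<rho> g) (a g)"
begin

lemma a_conj:
  assumes "g \<in> carrier G" "k \<in> carrier G"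
  shows "a (g \<otimes> k \<otimes> inv g) (\<rho> g *v v) (\<rho> g *v w) = a k v w"
proof -
  have "inv g \<otimes> (g \<otimes> k \<otimes> inv g) \<otimes> g = k"
    using assms by (simp add: m_assoc inv_cancel)
  then show ?thesis
    using equiv assms unfolding equivariant_forms_def by (metis inv_closed m_closed)
qed

text \<open>The functional \<open>u \<otimes> h \<mapsto> \<Lambda> u h\<close> vanishes on the multiples of the relations by words in degree at
  most \<open>N\<close>, the group elements being moved to the right.\<close>

definition kills_relations :: "nat \<Rightarrow> ('b list \<Rightarrow> 'a \<Rightarrow> complex) \<Rightarrow> bool" where
  "kills_relations N \<Lambda> \<longleftrightarrow> (\<forall>u x y w. length u + 2 + length w \<le> N \<longrightarrow> (\<forall>h\<in>carrier G.
     \<Lambda> (u @ x # y # w) h - \<Lambda> (u @ y # x # w) h =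
     (\<Sum>g\<in>carrier G. a g (axis x 1) (axis y 1) *
        lfun (\<lambda>v. \<Lambda> v (g \<otimes> h)) (word u * tens_act (\<rho> g) (word w)))))"

text \<open>Both sides are bilinear in \<open>p\<close>, \<open>q\<close> and in the two vectors, so
  the statement extends from words and letters. The extension is needed because group elements turn
  a letter into a general vector and a word into a sum of words.\<close>

lemma kills_relations_tens:
  assumes kill: "kills_relations N \<Lambda>" and h: "h \<in> carrier G"
    and len: "\<And>u w. u \<in> Poly_Mapping.keys p \<Longrightarrow> w \<in> Poly_Mapping.keys q \<Longrightarrow> length u + 2 + length w \<le> N"
  shows "lfun (\<lambda>v. \<Lambda> v h) (p * (tens_vec v * tens_vec v' - tens_vec v' * tens_vec v) * q) =
    (\<Sum>g\<in>carrier G. a g v v' * lfun (\<lambda>v. \<Lambda> v (g \<otimes> h)) (p * tens_act (\<rho> g) q))"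
    (is "?L p q = ?R p q")
proof -
  have word: "?L (word u) (word w) = ?R (word u) (word w)"
    if "u \<in> Poly_Mapping.keys p" "w \<in> Poly_Mapping.keys q" for u w
  proof -
    let ?c = "\<lambda>x y. v $ x * v' $ y"
    have prod: "tens_vec v * tens_vec v' = (\<Sum>x\<in>UNIV. \<Sum>y\<in>UNIV. scal (?c x y) * word [x, y])"
      by (simp add: tens_vec_def sum_product mult_single plus_list_def scal_single)
    have prod': "tens_vec v' * tens_vec v = (\<Sum>x\<in>UNIV. \<Sum>y\<in>UNIV. scal (?c x y) * word [y, x])"
      by (subst sum.swap) (simp add: tens_vec_def sum_product mult_single plus_list_def scal_single mult.commute)
    have "word u * (tens_vec v * tens_vec v' - tens_vec v' * tens_vec v) * word w =
      (\<Sum>x\<in>UNIV. \<Sum>y\<in>UNIV. scal (?c x y) * (word (u @ x # y # w) - word (u @ y # x # w)))"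
      unfolding prod prod'
      by (simp add: sum_distrib_left sum_distrib_right scal_single mult_single plus_list_def
          right_diff_distrib left_diff_distrib sum_subtractf)
    then have "?L (word u) (word w) = (\<Sum>x\<in>UNIV. \<Sum>y\<in>UNIV. ?c x y *
        (\<Lambda> (u @ x # y # w) h - \<Lambda> (u @ y # x # w) h))"
      by (simp add: lfun_sum lfun_scal lfun_diff)
    also have "\<dots> = (\<Sum>x\<in>UNIV. \<Sum>y\<in>UNIV. \<Sum>g\<in>carrier G. ?c x y * a g (axis x 1) (axis y 1) *
        lfun (\<lambda>v. \<Lambda> v (g \<otimes> h)) (word u * tens_act (\<rho> g) (word w)))"
      using kill h len[OF that] by (simp add: kills_relations_def sum_distrib_left mult.assoc)
    also have "\<dots> = (\<Sum>x\<in>UNIV. \<Sum>g\<in>carrier G. \<Sum>y\<in>UNIV. ?c x y * a g (axis x 1) (axis y 1) *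
        lfun (\<lambda>v. \<Lambda> v (g \<otimes> h)) (word u * tens_act (\<rho> g) (word w)))"
      by (intro sum.cong refl) (rule sum.swap)
    also have "\<dots> = (\<Sum>g\<in>carrier G. \<Sum>x\<in>UNIV. \<Sum>y\<in>UNIV. ?c x y * a g (axis x 1) (axis y 1) *
        lfun (\<lambda>v. \<Lambda> v (g \<otimes> h)) (word u * tens_act (\<rho> g) (word w)))"
      by (rule sum.swap)
    also have "\<dots> = ?R (word u) (word w)"
    proof (intro sum.cong refl)
      fix g assume g: "g \<in> carrier G"
      have "a g v v' = a g (\<Sum>x\<in>UNIV. v $ x *s axis x 1) (\<Sum>y\<in>UNIV. v' $ y *s axis y 1)"
        by (simp add: basis_expansion)
      also have "\<dots> = (\<Sum>x\<in>UNIV. \<Sum>y\<in>UNIV. ?c x y * a g (axis x 1) (axis y 1))"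
        by (subst sum.swap) (simp add: skew_form_sum_left[OF skew[OF g]] skew_form_sum_right[OF skew[OF g]]
            skew_form_scale_left[OF skew[OF g]] skew_form_scale_right[OF skew[OF g]]
            sum_distrib_left mult.assoc mult.left_commute)
      finally show "(\<Sum>x\<in>UNIV. \<Sum>y\<in>UNIV. ?c x y * a g (axis x 1) (axis y 1) *
          lfun (\<lambda>v. \<Lambda> v (g \<otimes> h)) (word u * tens_act (\<rho> g) (word w))) =
        a g v v' * lfun (\<lambda>v. \<Lambda> v (g \<otimes> h)) (word u * tens_act (\<rho> g) (word w))"
        by (simp add: sum_distrib_right)
    qed
    finally show ?thesis .
  qed
  have exp: "s = (\<Sum>u\<in>Poly_Mapping.keys s. scal (Poly_Mapping.lookup s u) * word u)" for s :: "'b tens"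
    using lext_ident[of s] by (simp add: lext_def)
  have L1: "?L (sum f A) t = (\<Sum>x\<in>A. ?L (f x) t)" "?L t (sum f A) = (\<Sum>x\<in>A. ?L t (f x))"
    for f t and A :: "'b list set"
    by (simp_all add: sum_distrib_left sum_distrib_right lfun_sum)
  have R1: "?R (sum f A) t = (\<Sum>x\<in>A. ?R (f x) t)" "?R t (sum f A) = (\<Sum>x\<in>A. ?R t (f x))"
    for f t and A :: "'b list set"
    by (simp_all add: sum_distrib_left sum_distrib_right lfun_sum tens_act_sum, (rule sum.swap)+)
  have L2: "?L (scal c * s) t = c * ?L s t" "?L s (scal c * t) = c * ?L s t" for c s t
  proof -
    have "s * m * (scal c * t) = scal c * (s * m * t)" for m
      by (metis mult.assoc scal_comm)
    then show "?L (scal c * s) t = c * ?L s t" "?L s (scal c * t) = c * ?L s t"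
      by (simp_all add: mult.assoc lfun_scal)
  qed
  have R2: "?R (scal c * s) t = c * ?R s t" "?R s (scal c * t) = c * ?R s t" for c s t
  proof -
    have "s * (scal c * m) = scal c * (s * m)" for m
      by (metis mult.assoc scal_comm)
    then show "?R (scal c * s) t = c * ?R s t" "?R s (scal c * t) = c * ?R s t"
      by (simp_all add: mult.assoc lfun_scal tens_act_scal sum_distrib_left mult.left_commute)
  qed
  have "?L p q = (\<Sum>u\<in>Poly_Mapping.keys p. \<Sum>w\<in>Poly_Mapping.keys q.
      Poly_Mapping.lookup p u * (Poly_Mapping.lookup q w * ?L (word u) (word w)))"
    by (subst exp[of p], subst exp[of q], simp only: L1(1) L2(1), simp only: L1(2) L2(2), simp only: sum_distrib_left)
  also have "\<dots> = (\<Sum>u\<in>Poly_Mapping.keys p. \<Sum>w\<in>Poly_Mapping.keys q.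
      Poly_Mapping.lookup p u * (Poly_Mapping.lookup q w * ?R (word u) (word w)))"
    by (intro sum.cong refl) (simp only: word)
  also have "\<dots> = ?R p q"
    by (subst (3) exp[of p], subst (3) exp[of q], simp only: R1(1) R2(1), simp only: R1(2) R2(2), simp only: sum_distrib_left)
  finally show ?thesis .
qed

text \<open>In length \<open>Suc N\<close> the relations prescribe how the functional changes under
  an adjacent exchange. The prescribed difference involves only words that are shorter by two
  letters, where the functional is already given. So the continuation is a potential in the sense of
  \<open>ex_exchange_potential\<close>.\<close>

lemma kills_relations_Suc:
  assumes kill: "kills_relations N \<Lambda>"
  shows "\<exists>\<Lambda>'. kills_relations (Suc N) \<Lambda>' \<and> (\<forall>w h. length w \<le> N \<longrightarrow> \<Lambda>' w h = \<Lambda> w h)"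
proof -
  obtain r :: "'b \<Rightarrow> nat" where r: "inj r"
    using finite_imp_inj_to_nat_seg[of "UNIV :: 'b set"] by auto
  define T where "T h p = lfun (\<lambda>v. \<Lambda> v h) p" for h p
  \<comment> \<open>The value 0 in all other lengths makes the conditions on an exchange function
    trivial there.\<close>
  define \<psi> where "\<psi> h u x y w = (if length u + 2 + length w = Suc N then
      (\<Sum>g\<in>carrier G. a g (axis x 1) (axis y 1) * T (g \<otimes> h) (word u * tens_act (\<rho> g) (word w)))
    else 0)" for h u x y w
  have T_add: "T h (p + q) = T h p + T h q" and T_diff: "T h (p - q) = T h p - T h q"
    and T_scal: "T h (scal c * p) = c * T h p" for h p q c
    by (simp_all add: T_def lfun_add lfun_diff lfun_scal)
  have T_kill: "T h (p * (tens_vec v * tens_vec v' - tens_vec v' * tens_vec v) * q) =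
      (\<Sum>g\<in>carrier G. a g v v' * T (g \<otimes> h) (p * tens_act (\<rho> g) q))"
    if "h \<in> carrier G"
      "\<And>u w. u \<in> Poly_Mapping.keys p \<Longrightarrow> w \<in> Poly_Mapping.keys q \<Longrightarrow> length u + 2 + length w \<le> N"
    for h p q v v'
    unfolding T_def using kill that by (rule kills_relations_tens)
  have "\<exists>L. \<forall>u x y w. L (u @ x # y # w) - L (u @ y # x # w) = \<psi> h u x y w" if h: "h \<in> carrier G" for h
  proof (rule ex_exchange_potential[OF r])
    show "\<psi> h u x x w = 0" for u x w
      by (simp add: \<psi>_def skew_form_same[OF skew])
    show "\<psi> h u x y w = - \<psi> h u y x w" for u x y w
      using skew_form_swap[OF skew, of _ "axis x 1" "axis y 1"] by (simp add: \<psi>_def sum_negf)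
    \<comment> \<open>Applying the two relations in either order gives the same double sum. In one
      order the pair \<open>k\<close>, \<open>l\<close> is first moved through \<open>g\<close>;
      reindexing the group by conjugation together with \<open>a_conj\<close> undoes this. Here
      equivariance enters.\<close>
    show "\<psi> h u x y (m @ k # l # w) - \<psi> h u x y (m @ l # k # w) =
        \<psi> h (u @ x # y # m) k l w - \<psi> h (u @ y # x # m) k l w" for u x y m k l w
    proof (cases "length u + length m + length w + 4 = Suc N")
      case True
      let ?a = "\<lambda>g x y. a g (axis x 1) (axis y 1)"
      let ?F = "\<lambda>g j. T (g \<otimes> (j \<otimes> h)) (word u * tens_act (\<rho> g) (word m * tens_act (\<rho> j) (word w)))"
      have "\<psi> h u x y (m @ k # l # w) - \<psi> h u x y (m @ l # k # w) =
        (\<Sum>g\<in>carrier G. ?a g x y * T (g \<otimes> h) (word u * tens_act (\<rho> g)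
          (word m * (word [k] * word [l] - word [l] * word [k]) * word w)))"
      proof -
        have c: "length u + 2 + length (m @ k # l # w) = Suc N" "length u + 2 + length (m @ l # k # w) = Suc N"
          using True by simp_all
        have eq: "word (m @ k # l # w) - word (m @ l # k # w) =
            word m * (word [k] * word [l] - word [l] * word [k]) * word w"
          by (simp add: word_mult left_diff_distrib right_diff_distrib)
        show ?thesis
          by (simp only: \<psi>_def c if_True simp_thms sum_subtractf[symmetric] right_diff_distrib[symmetric]
              T_diff[symmetric] tens_act_diff[symmetric] eq)
      qed
      also have "\<dots> = (\<Sum>g\<in>carrier G. \<Sum>j\<in>carrier G. ?a g x y * (?a j k l * ?F g j))"
      proof (intro sum.cong refl)
        fix g assume g: "g \<in> carrier G"
        let ?k = "\<rho> g *v axis k 1" and ?l = "\<rho> g *v axis l 1"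
        have "T (g \<otimes> h) (word u * tens_act (\<rho> g)
            (word m * (word [k] * word [l] - word [l] * word [k]) * word w)) =
          T (g \<otimes> h) (word u * tens_act (\<rho> g) (word m) *
            (tens_vec ?k * tens_vec ?l - tens_vec ?l * tens_vec ?k) * tens_act (\<rho> g) (word w))"
          by (simp only: tens_act_mult tens_act_diff mult.assoc flip: tens_vec_axis tens_act_tens_vec)
        also have "\<dots> = (\<Sum>j\<in>carrier G. a j ?k ?l * T (j \<otimes> (g \<otimes> h))
            (word u * tens_act (\<rho> g) (word m) * tens_act (\<rho> j) (tens_act (\<rho> g) (word w))))"
        proof (rule T_kill)
          show "g \<otimes> h \<in> carrier G" using g h by simp
          show "length u' + 2 + length w' \<le> N"
            if "u' \<in> Poly_Mapping.keys (word u * tens_act (\<rho> g) (word m))"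
              "w' \<in> Poly_Mapping.keys (tens_act (\<rho> g) (word w))" for u' w'
            using keys_word_act[OF that(1)] keys_word_act[of w' "[]" "\<rho> g" w] that(2) True by simp
        qed
        also have "\<dots> = (\<Sum>j\<in>carrier G. a (g \<otimes> j \<otimes> inv g) ?k ?l * T (g \<otimes> j \<otimes> inv g \<otimes> (g \<otimes> h))
            (word u * tens_act (\<rho> g) (word m) * tens_act (\<rho> (g \<otimes> j \<otimes> inv g)) (tens_act (\<rho> g) (word w))))"
          by (rule sum.reindex_bij_betw[OF bij_betw_conj[OF g], symmetric])
        also have "\<dots> = (\<Sum>j\<in>carrier G. ?a j k l * ?F g j)"
        proof (intro sum.cong refl)
          fix j assume j: "j \<in> carrier G"
          have "\<rho> (g \<otimes> j \<otimes> inv g) ** \<rho> g = \<rho> g ** \<rho> j"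
            using g j by (simp add: m_assoc flip: rho_mult)
          then have "tens_act (\<rho> (g \<otimes> j \<otimes> inv g)) (tens_act (\<rho> g) (word w)) =
              tens_act (\<rho> g) (tens_act (\<rho> j) (word w))"
            by (metis tens_act_comp)
          moreover have "g \<otimes> j \<otimes> inv g \<otimes> (g \<otimes> h) = g \<otimes> (j \<otimes> h)"
            using g j h by (simp add: m_assoc)
          ultimately show "a (g \<otimes> j \<otimes> inv g) ?k ?l * T (g \<otimes> j \<otimes> inv g \<otimes> (g \<otimes> h))
            (word u * tens_act (\<rho> g) (word m) * tens_act (\<rho> (g \<otimes> j \<otimes> inv g)) (tens_act (\<rho> g) (word w)))
            = ?a j k l * ?F g j"
            using a_conj[OF g j] by (simp only: tens_act_mult mult.assoc)
        qed
        finally show "?a g x y * T (g \<otimes> h) (word u * tens_act (\<rho> g)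
            (word m * (word [k] * word [l] - word [l] * word [k]) * word w)) =
          (\<Sum>j\<in>carrier G. ?a g x y * (?a j k l * ?F g j))"
          by (simp only: sum_distrib_left)
      qed
      also have "\<dots> = (\<Sum>j\<in>carrier G. \<Sum>g\<in>carrier G. ?a j k l * (?a g x y * ?F g j))"
        by (subst sum.swap) (simp only: mult.left_commute)
      also have "\<dots> = (\<Sum>j\<in>carrier G. ?a j k l * T (j \<otimes> h) (word u *
          (tens_vec (axis x 1) * tens_vec (axis y 1) - tens_vec (axis y 1) * tens_vec (axis x 1)) *
          (word m * tens_act (\<rho> j) (word w))))"
      proof (intro sum.cong refl)
        fix j assume j: "j \<in> carrier G"
        have "T (j \<otimes> h) (word u *
          (tens_vec (axis x 1) * tens_vec (axis y 1) - tens_vec (axis y 1) * tens_vec (axis x 1)) *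
          (word m * tens_act (\<rho> j) (word w))) = (\<Sum>g\<in>carrier G. ?a g x y * ?F g j)"
        proof (rule T_kill)
          show "j \<otimes> h \<in> carrier G" using j h by simp
          show "length u' + 2 + length w' \<le> N"
            if "u' \<in> Poly_Mapping.keys (word u)"
              "w' \<in> Poly_Mapping.keys (word m * tens_act (\<rho> j) (word w))" for u' w'
            using keys_word_act[OF that(2)] that(1) True by simp
        qed
        then show "(\<Sum>g\<in>carrier G. ?a j k l * (?a g x y * ?F g j)) = ?a j k l * T (j \<otimes> h) (word u *
          (tens_vec (axis x 1) * tens_vec (axis y 1) - tens_vec (axis y 1) * tens_vec (axis x 1)) *
          (word m * tens_act (\<rho> j) (word w)))"
          by (simp only: sum_distrib_left)
      qed
      also have "\<dots> = \<psi> h (u @ x # y # m) k l w - \<psi> h (u @ y # x # m) k l w"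
      proof -
        have "word (u @ x # y # m) * p - word (u @ y # x # m) * p = word u *
          (tens_vec (axis x 1) * tens_vec (axis y 1) - tens_vec (axis y 1) * tens_vec (axis x 1)) *
          (word m * p)" for p
          by (simp add: word_append[of u] word_Cons[of x "y # m"] word_Cons[of y "x # m"]
              word_Cons[of y m] word_Cons[of x m] algebra_simps)
        moreover have "length (u @ x # y # m) + 2 + length w = Suc N"
          "length (u @ y # x # m) + 2 + length w = Suc N"
          using True by simp_all
        ultimately show ?thesis
          by (simp only: \<psi>_def if_True simp_thms sum_subtractf[symmetric] right_diff_distrib[symmetric]
              T_diff[symmetric])
      qed
      finally show ?thesis .
    next
      case False
      then show ?thesis by (simp add: \<psi>_def)
    qed
    \<comment> \<open>Grouped in pairs, the six terms compare a letter on the right of an exchanged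
      pair, where it is transformed by \<open>g\<close>, with the same letter on the left, where it
      is not. The summand at \<open>g\<close> is therefore \<open>?T g\<close> of the expression in
      \<open>jacobi_form\<close>.\<close>
    show "\<psi> h u z y (x # w) + \<psi> h (u @ [y]) z x w + \<psi> h u y x (z # w) =
        \<psi> h (u @ [z]) y x w + \<psi> h u z x (y # w) + \<psi> h (u @ [x]) z y w" for u x y z w
    proof (cases "length u + length w + 3 = Suc N")
      case True
      let ?a = "\<lambda>g x y. a g (axis x 1) (axis y 1)"
      let ?T = "\<lambda>g v. T (g \<otimes> h) (word u * tens_vec v * tens_act (\<rho> g) (word w))"
      have \<psi>1: "\<psi> h u y z (x # w) = (\<Sum>g\<in>carrier G. ?a g y z * ?T g (\<rho> g *v axis x 1))" for x y z
        using True by (simp add: \<psi>_def word_Cons[of x w] tens_act_mult mult.assoc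
            flip: tens_vec_axis tens_act_tens_vec tens_act_word)
      have \<psi>2: "\<psi> h (u @ [x]) y z w = (\<Sum>g\<in>carrier G. ?a g y z * ?T g (axis x 1))" for x y z
        using True by (simp add: \<psi>_def word_append mult.assoc)
      have T_lin: "?T g (c *s v + c' *s v' + c'' *s v'') = c * ?T g v + c' * ?T g v' + c'' * ?T g v''"
        for g c v c' v' c'' v''
      proof -
        have "word u * (scal c * p) * q = scal c * (word u * p * q)" for c p q
          by (metis mult.assoc scal_comm)
        then show ?thesis
          by (simp add: tens_vec_add tens_vec_scale distrib_left distrib_right T_add T_scal)
      qed
      have T_sub: "?T g (v - v') = ?T g v - ?T g v'" for g v v'
        using T_lin[of g 1 v "-1" v' 0 0] by simp
      have "\<psi> h u z y (x # w) - \<psi> h (u @ [x]) z y w + (\<psi> h u y x (z # w) - \<psi> h (u @ [z]) y x w)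
          + (\<psi> h (u @ [y]) z x w - \<psi> h u z x (y # w))
        = (\<Sum>g\<in>carrier G. ?T g (?a g z y *s (\<rho> g *v axis x 1 - axis x 1)
           + ?a g y x *s (\<rho> g *v axis z 1 - axis z 1) + ?a g x z *s (\<rho> g *v axis y 1 - axis y 1)))"
        unfolding \<psi>1 \<psi>2 T_lin T_sub sum_subtractf[symmetric] sum.distrib[symmetric]
        by (intro sum.cong refl) (simp add: skew_form_swap[OF skew, of _ "axis z 1" "axis x 1"] algebra_simps)
      also have "\<dots> = (\<Sum>g\<in>carrier G. ?T g 0)"
        using jacobi by (intro sum.cong refl) (simp only: jacobi_form_def)
      also have "\<dots> = 0" by (simp add: T_def)
      finally show ?thesis by (simp add: algebra_simps)
    next
      case False
      then show ?thesis by (simp add: \<psi>_def)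
    qed
  qed
  then obtain L where L: "\<And>h u x y w. h \<in> carrier G \<Longrightarrow>
      L h (u @ x # y # w) - L h (u @ y # x # w) = \<psi> h u x y w"
    by metis
  \<comment> \<open>Only the values in length \<open>Suc N\<close> are replaced, so the relations
    that hold up to length \<open>N\<close> are undisturbed.\<close>
  define \<Lambda>' where "\<Lambda>' w h = (if length w = Suc N then L h w else \<Lambda> w h)" for w h
  have same: "lfun (\<lambda>v. \<Lambda>' v h) (word u * tens_act (\<rho> g) (word w)) = T h (word u * tens_act (\<rho> g) (word w))"
    if "length u + 2 + length w \<le> Suc N" for u w g h
    unfolding T_def using that by (intro lfun_cong) (auto simp: \<Lambda>'_def dest!: keys_word_act[simplified])
  have "kills_relations (Suc N) \<Lambda>'"
    unfolding kills_relations_def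
  proof (intro allI impI ballI)
    fix u w :: "'b list" and x y h assume len: "length u + 2 + length w \<le> Suc N" and h: "h \<in> carrier G"
    show "\<Lambda>' (u @ x # y # w) h - \<Lambda>' (u @ y # x # w) h = (\<Sum>g\<in>carrier G. a g (axis x 1) (axis y 1) *
        lfun (\<lambda>v. \<Lambda>' v (g \<otimes> h)) (word u * tens_act (\<rho> g) (word w)))"
    proof (cases "length u + 2 + length w = Suc N")
      case True
      then show ?thesis
        using L[OF h, of u x y w] by (simp only: same[OF len]) (simp add: \<Lambda>'_def \<psi>_def)
    next
      case False
      then have "length u + 2 + length w \<le> N" using len by simp
      then show ?thesis
        using kill h False unfolding kills_relations_def same[OF len] by (simp add: \<Lambda>'_def T_def)
    qed
  qed
  then show ?thesis by (auto simp: \<Lambda>'_def)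
qed

text \<open>Each continuation leaves the values on words within the previous bound unchanged, so the
  stages stabilize at every word. The limit may take the stage numbered by the length of the word,
  because that stage is late enough (\<open>eq\<close>).\<close>

lemma ex_kills_relations:
  assumes "kills_relations N \<Lambda>"
  shows "\<exists>\<Lambda>'. (\<forall>M. kills_relations M \<Lambda>') \<and> (\<forall>w h. length w \<le> N \<longrightarrow> \<Lambda>' w h = \<Lambda> w h)"
proof -
  have "\<exists>f. \<forall>n. (kills_relations (N + n) (f n) \<and> (n = 0 \<longrightarrow> f n = \<Lambda>)) \<and>
      (\<forall>w h. length w \<le> N + n \<longrightarrow> f (Suc n) w h = f n w h)"
    using assms kills_relations_Suc by (intro dependent_nat_choice) auto
  then obtain f where f: "\<And>n. kills_relations (N + n) (f n)" "f 0 = \<Lambda>"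
    "\<And>n w h. length w \<le> N + n \<Longrightarrow> f (Suc n) w h = f n w h"
    by metis
  have stable: "f (n + m) w h = f n w h" if "length w \<le> N + n" for n m w h
    using that by (induction m) (simp_all add: f(3))
  define \<Lambda>' where "\<Lambda>' w h = f (length w) w h" for w h
  have eq: "\<Lambda>' w h = f n w h" if "length w \<le> N + n" for n w h
  proof (cases "n \<le> length w")
    case True
    then show ?thesis using stable[OF that, of "length w - n" h] by (simp add: \<Lambda>'_def)
  next
    case False
    then show ?thesis using stable[of w "length w" "n - length w" h] by (simp add: \<Lambda>'_def)
  qed
  have "kills_relations M \<Lambda>'" for M
    unfolding kills_relations_def
  proof (intro allI impI ballI)
    fix u w :: "'b list" and x y h assume len: "length u + 2 + length w \<le> M" and h: "h \<in> carrier G"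
    have "lfun (\<lambda>v. \<Lambda>' v k) (word u * tens_act (\<rho> g) (word w)) =
        lfun (\<lambda>v. f M v k) (word u * tens_act (\<rho> g) (word w))" for g k
      using len by (intro lfun_cong eq) (auto dest!: keys_word_act[simplified])
    moreover have "\<Lambda>' (u @ x # y # w) h = f M (u @ x # y # w) h"
      "\<Lambda>' (u @ y # x # w) h = f M (u @ y # x # w) h"
      using len by (intro eq; simp)+
    ultimately show "\<Lambda>' (u @ x # y # w) h - \<Lambda>' (u @ y # x # w) h =
       (\<Sum>g\<in>carrier G. a g (axis x 1) (axis y 1) *
        lfun (\<lambda>v. \<Lambda>' v (g \<otimes> h)) (word u * tens_act (\<rho> g) (word w)))"
      using f(1)[of M] len h by (simp add: kills_relations_def)
  qed
  then show ?thesis using eq[of _ 0] f(2) by auto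
qed

text \<open>The functional dual to the monomial \<open>e\<close> at \<open>h0\<close>. Up to degree
  \<open>mono_deg e\<close> the indicator function already kills the relations: exchanging letters
  preserves \<open>letter_exp\<close>, and the right-hand side involves words that are too short to
  have exponent \<open>e\<close>.\<close>

lemma ex_pbw_functional:
  "\<exists>\<Lambda>. (\<forall>N. kills_relations N \<Lambda>) \<and> (\<forall>w h. length w \<le> mono_deg e \<longrightarrow>
     \<Lambda> w h = (if letter_exp w = e \<and> h = h0 then 1 else 0))"
proof (rule ex_kills_relations)
  show "kills_relations (mono_deg e) (\<lambda>w h. if letter_exp w = e \<and> h = h0 then 1 else 0)"
    unfolding kills_relations_def
  proof (intro allI impI ballI)
    fix u w :: "'b list" and x y h assume len: "length u + 2 + length w \<le> mono_deg e"
    have "lfun (\<lambda>v. if letter_exp v = e \<and> g \<otimes> h = h0 then 1 else 0)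
        (word u * tens_act (\<rho> g) (word w)) = lfun (\<lambda>v. 0) (word u * tens_act (\<rho> g) (word w))" for g
      using len by (intro lfun_cong) (auto dest!: keys_word_act[simplified] simp: mono_deg_letter_exp)
    then show "(if letter_exp (u @ x # y # w) = e \<and> h = h0 then 1 else 0) -
        (if letter_exp (u @ y # x # w) = e \<and> h = h0 then 1 else 0) =
       (\<Sum>g\<in>carrier G. a g (axis x 1) (axis y 1) * lfun (\<lambda>v. if letter_exp v = e \<and> g \<otimes> h = h0 then 1 else 0)
        (word u * tens_act (\<rho> g) (word w)))"
      by (simp add: lfun_def letter_exp_append algebra_simps)
  qed
qed

end

section \<open>Skew group algebras\<close>

lemma skew_elem_add: "skew_elem (r + s) g = skew_elem r g + (skew_elem s g :: _ \<Rightarrow> 'r::monoid_add)"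
  by (simp add: skew_elem_def fun_eq_iff)

lemma skew_elem_0 [simp]: "skew_elem 0 g = 0"
  by (simp add: skew_elem_def fun_eq_iff)

lemma skew_elem_diff: "skew_elem (r - s) g = skew_elem r g - (skew_elem s g :: _ \<Rightarrow> 'r::group_add)"
  by (simp add: skew_elem_def fun_eq_iff)

lemma skew_elem_sum: "skew_elem (sum f A) g = (\<Sum>x\<in>A. skew_elem (f x) g)"
  for f :: "_ \<Rightarrow> 'r::comm_monoid_add"
  by (induction A rule: infinite_finite_induct) (simp_all add: skew_elem_add)

lemma sum_fun_apply: "(sum f A) x = (\<Sum>i\<in>A. f i x)" for f :: "_ \<Rightarrow> _ \<Rightarrow> 'r::comm_monoid_add"
  by (induction A rule: infinite_finite_induct) simp_all

text \<open>The ring laws are proved once for T(V)#G and S(V)#G together.\<close>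

locale skew_action = group G for G (structure) +
  fixes act :: "'a \<Rightarrow> ('c::monoid_add \<Rightarrow>\<^sub>0 complex) \<Rightarrow> 'c \<Rightarrow>\<^sub>0 complex"
  assumes finite_carrier: "finite (carrier G)"
    and act_add: "act g (p + q) = act g p + act g q"
    and act_mult: "act g (p * q) = act g p * act g q"
    and act_const: "act g (scal c) = scal c"
    and act_one: "act \<one> p = p"
    and act_comp: "g \<in> carrier G \<Longrightarrow> h \<in> carrier G \<Longrightarrow> act (g \<otimes> h) p = act g (act h p)"
begin

abbreviation S where "S \<equiv> skew_group_algebra G act"

lemma act_0 [simp]: "act g 0 = 0"
  using act_const[of g 0] by simp

lemma act_1 [simp]: "act g 1 = 1"
  using act_const[of g 1] by simp

lemma carrier_S: "carrier S = {\<phi>. \<forall>g. g \<notin> carrier G \<longrightarrow> \<phi> g = 0}"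
  and add_S [simp]: "\<phi> \<oplus>\<^bsub>S\<^esub> \<psi> = \<phi> + \<psi>"
  and zero_S [simp]: "\<zero>\<^bsub>S\<^esub> = 0"
  and one_S: "\<one>\<^bsub>S\<^esub> = skew_elem 1 \<one>"
  and smult_S: "c \<odot>\<^bsub>S\<^esub> \<phi> = (\<lambda>k. scal c * \<phi> k)"
  by (simp_all add: skew_group_algebra_def fun_eq_iff)

lemma mult_S: "(\<phi> \<otimes>\<^bsub>S\<^esub> \<psi>) k = (\<Sum>(g, h) | g \<in> carrier G \<and> h \<in> carrier G \<and> g \<otimes> h = k. \<phi> g * act g (\<psi> h))"
  by (simp add: skew_group_algebra_def)

lemma finite_pairs [simp]: "finite {(g, h). g \<in> carrier G \<and> h \<in> carrier G \<and> g \<otimes> h = k}"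
  by (rule finite_subset[of _ "carrier G \<times> carrier G"]) (auto simp: finite_carrier)

lemma mult_add_left: "(\<phi> + \<phi>') \<otimes>\<^bsub>S\<^esub> \<psi> = \<phi> \<otimes>\<^bsub>S\<^esub> \<psi> + \<phi>' \<otimes>\<^bsub>S\<^esub> \<psi>"
  by (simp add: fun_eq_iff mult_S distrib_right split_def sum.distrib)

lemma mult_add_right: "\<psi> \<otimes>\<^bsub>S\<^esub> (\<phi> + \<phi>') = \<psi> \<otimes>\<^bsub>S\<^esub> \<phi> + \<psi> \<otimes>\<^bsub>S\<^esub> \<phi>'"
  by (simp add: fun_eq_iff mult_S act_add distrib_left split_def sum.distrib)

lemma mult_zero_left [simp]: "0 \<otimes>\<^bsub>S\<^esub> \<psi> = 0"
  by (simp add: fun_eq_iff mult_S split_def)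

lemma mult_zero_right [simp]: "\<psi> \<otimes>\<^bsub>S\<^esub> 0 = 0"
  by (simp add: fun_eq_iff mult_S split_def)

lemma mult_diff_left: "(\<phi> - \<phi>') \<otimes>\<^bsub>S\<^esub> \<psi> = \<phi> \<otimes>\<^bsub>S\<^esub> \<psi> - \<phi>' \<otimes>\<^bsub>S\<^esub> \<psi>"
  using mult_add_left[of "\<phi> - \<phi>'" \<phi>' \<psi>] by simp

lemma mult_diff_right: "\<psi> \<otimes>\<^bsub>S\<^esub> (\<phi> - \<phi>') = \<psi> \<otimes>\<^bsub>S\<^esub> \<phi> - \<psi> \<otimes>\<^bsub>S\<^esub> \<phi>'"
  using mult_add_right[of \<psi> "\<phi> - \<phi>'" \<phi>'] by simp

lemma mult_sum_left: "sum f A \<otimes>\<^bsub>S\<^esub> \<psi> = (\<Sum>x\<in>A. f x \<otimes>\<^bsub>S\<^esub> \<psi>)"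
  using sum_comp_morphism[of "\<lambda>\<phi>. \<phi> \<otimes>\<^bsub>S\<^esub> \<psi>" f A] by (simp add: mult_add_left o_def)

lemma mult_sum_right: "\<psi> \<otimes>\<^bsub>S\<^esub> sum f A = (\<Sum>x\<in>A. \<psi> \<otimes>\<^bsub>S\<^esub> f x)"
  using sum_comp_morphism[of "\<lambda>\<phi>. \<psi> \<otimes>\<^bsub>S\<^esub> \<phi>" f A] by (simp add: mult_add_right o_def)

lemma skew_elem_mult:
  assumes "g \<in> carrier G" "h \<in> carrier G"
  shows "skew_elem r g \<otimes>\<^bsub>S\<^esub> skew_elem s h = skew_elem (r * act g s) (g \<otimes> h)"
proof
  fix k
  have "(skew_elem r g \<otimes>\<^bsub>S\<^esub> skew_elem s h) k =
    (\<Sum>p | fst p \<in> carrier G \<and> snd p \<in> carrier G \<and> fst p \<otimes> snd p = k. if p = (g, h) then r * act g s else 0)"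
    unfolding mult_S by (intro sum.cong) (auto simp: skew_elem_def split: if_splits)
  also have "\<dots> = skew_elem (r * act g s) (g \<otimes> h) k"
    using assms finite_pairs[of k] by (subst sum.delta) (auto simp: skew_elem_def split_def)
  finally show "(skew_elem r g \<otimes>\<^bsub>S\<^esub> skew_elem s h) k = skew_elem (r * act g s) (g \<otimes> h) k" .
qed

lemma skew_elem_closed: "g \<in> carrier G \<Longrightarrow> skew_elem r g \<in> carrier S"
  by (auto simp: carrier_S skew_elem_def)

lemma skew_decomp: "\<phi> \<in> carrier S \<Longrightarrow> \<phi> = (\<Sum>g\<in>carrier G. skew_elem (\<phi> g) g)"
  using finite_carrier by (auto simp: fun_eq_iff carrier_S sum_fun_apply skew_elem_def)

lemma skew_induct [consumes 1, case_names elem zero add]: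
  assumes "\<phi> \<in> carrier S" and "\<And>r g. g \<in> carrier G \<Longrightarrow> P (skew_elem r g)"
    and "P 0" and "\<And>\<phi> \<psi>. P \<phi> \<Longrightarrow> P \<psi> \<Longrightarrow> P (\<phi> + \<psi>)"
  shows "P \<phi>"
proof -
  have "P (\<Sum>g\<in>A. skew_elem (\<phi> g) g)" if "A \<subseteq> carrier G" for A
    using that by (induction A rule: infinite_finite_induct) (use assms(2-) in auto)
  then show ?thesis using skew_decomp[OF assms(1)] by (metis subset_refl)
qed

lemma add_closed: "\<phi> \<in> carrier S \<Longrightarrow> \<psi> \<in> carrier S \<Longrightarrow> \<phi> + \<psi> \<in> carrier S"
  and uminus_closed: "\<phi> \<in> carrier S \<Longrightarrow> - \<phi> \<in> carrier S"
  and diff_closed: "\<phi> \<in> carrier S \<Longrightarrow> \<psi> \<in> carrier S \<Longrightarrow> \<phi> - \<psi> \<in> carrier S"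
  and zero_closed: "0 \<in> carrier S"
  and sum_closed: "(\<And>x. x \<in> A \<Longrightarrow> f x \<in> carrier S) \<Longrightarrow> sum f A \<in> carrier S"
  and smult_closed: "\<phi> \<in> carrier S \<Longrightarrow> c \<odot>\<^bsub>S\<^esub> \<phi> \<in> carrier S"
  by (auto simp: carrier_S smult_S sum_fun_apply)

lemma mult_closed: "\<phi> \<otimes>\<^bsub>S\<^esub> \<psi> \<in> carrier S"
proof -
  have "(\<phi> \<otimes>\<^bsub>S\<^esub> \<psi>) k = 0" if "k \<notin> carrier G" for k
    using that unfolding mult_S by (intro sum.neutral) auto
  then show ?thesis by (simp add: carrier_S)
qed

lemma mult_assoc:
  assumes "\<phi> \<in> carrier S" "\<psi> \<in> carrier S" "\<xi> \<in> carrier S"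
  shows "\<phi> \<otimes>\<^bsub>S\<^esub> \<psi> \<otimes>\<^bsub>S\<^esub> \<xi> = \<phi> \<otimes>\<^bsub>S\<^esub> (\<psi> \<otimes>\<^bsub>S\<^esub> \<xi>)"
proof (rule skew_induct[OF assms(1), where P = "\<lambda>\<phi>. \<phi> \<otimes>\<^bsub>S\<^esub> \<psi> \<otimes>\<^bsub>S\<^esub> \<xi> = \<phi> \<otimes>\<^bsub>S\<^esub> (\<psi> \<otimes>\<^bsub>S\<^esub> \<xi>)"])
  fix r g assume g: "g \<in> carrier G"
  show "skew_elem r g \<otimes>\<^bsub>S\<^esub> \<psi> \<otimes>\<^bsub>S\<^esub> \<xi> = skew_elem r g \<otimes>\<^bsub>S\<^esub> (\<psi> \<otimes>\<^bsub>S\<^esub> \<xi>)"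
  proof (rule skew_induct[OF assms(2), where P = "\<lambda>\<psi>. skew_elem r g \<otimes>\<^bsub>S\<^esub> \<psi> \<otimes>\<^bsub>S\<^esub> \<xi> =
        skew_elem r g \<otimes>\<^bsub>S\<^esub> (\<psi> \<otimes>\<^bsub>S\<^esub> \<xi>)"])
    fix s h assume h: "h \<in> carrier G"
    show "skew_elem r g \<otimes>\<^bsub>S\<^esub> skew_elem s h \<otimes>\<^bsub>S\<^esub> \<xi> = skew_elem r g \<otimes>\<^bsub>S\<^esub> (skew_elem s h \<otimes>\<^bsub>S\<^esub> \<xi>)"
      using g h
      by (intro skew_induct[OF assms(3), where P = "\<lambda>\<xi>. skew_elem r g \<otimes>\<^bsub>S\<^esub> skew_elem s h \<otimes>\<^bsub>S\<^esub> \<xi> =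
          skew_elem r g \<otimes>\<^bsub>S\<^esub> (skew_elem s h \<otimes>\<^bsub>S\<^esub> \<xi>)"])
        (simp_all add: skew_elem_mult m_assoc act_mult act_comp mult.assoc mult_add_right)
  qed (simp_all add: mult_add_right mult_add_left)
qed (simp_all add: mult_add_left)

lemma one_mult: "\<phi> \<in> carrier S \<Longrightarrow> skew_elem 1 \<one> \<otimes>\<^bsub>S\<^esub> \<phi> = \<phi>"
  by (rule skew_induct[where P = "\<lambda>\<phi>. skew_elem 1 \<one> \<otimes>\<^bsub>S\<^esub> \<phi> = \<phi>"])
    (simp_all add: skew_elem_mult mult_add_right act_one)

lemma mult_one: "\<phi> \<in> carrier S \<Longrightarrow> \<phi> \<otimes>\<^bsub>S\<^esub> skew_elem 1 \<one> = \<phi>"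
  by (rule skew_induct[where P = "\<lambda>\<phi>. \<phi> \<otimes>\<^bsub>S\<^esub> skew_elem 1 \<one> = \<phi>"])
    (simp_all add: skew_elem_mult mult_add_left)

lemma ring_S: "ring S"
proof (rule ringI)
  show "abelian_group S"
  proof (rule abelian_groupI, goal_cases)
    case (6 x)
    then show ?case by (intro bexI[of _ "- x"]) (simp_all add: uminus_closed)
  qed (simp_all add: add_closed zero_closed add.commute add.assoc)
  show "Group.monoid S"
    by unfold_locales (simp_all add: mult_closed mult_assoc one_S one_mult mult_one skew_elem_closed)
qed (simp_all add: mult_add_left mult_add_right)

lemma uminus_S: "\<phi> \<in> carrier S \<Longrightarrow> \<ominus>\<^bsub>S\<^esub> \<phi> = - \<phi>"
proof -
  interpret ring S by (rule ring_S)
  assume "\<phi> \<in> carrier S"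
  then show ?thesis using minus_equality[of "- \<phi>" \<phi>] by (simp add: uminus_closed)
qed

lemma smult_mult_left: "(c \<odot>\<^bsub>S\<^esub> \<phi>) \<otimes>\<^bsub>S\<^esub> \<psi> = c \<odot>\<^bsub>S\<^esub> (\<phi> \<otimes>\<^bsub>S\<^esub> \<psi>)"
  by (simp add: fun_eq_iff mult_S smult_S sum_distrib_left split_def mult.assoc)

text \<open>Scalars act through elements of the algebra itself, so that a ring ideal is
  automatically a linear subspace (\<open>I_smult\<close>).\<close>

lemma smult_eq_mult: "\<phi> \<in> carrier S \<Longrightarrow> c \<odot>\<^bsub>S\<^esub> \<phi> = skew_elem (scal c) \<one> \<otimes>\<^bsub>S\<^esub> \<phi>"
proof -
  assume \<phi>: "\<phi> \<in> carrier S"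
  have "skew_elem (scal c) \<one> = c \<odot>\<^bsub>S\<^esub> skew_elem 1 \<one>"
    by (auto simp: fun_eq_iff smult_S skew_elem_def)
  then show ?thesis using \<phi> by (simp add: smult_mult_left one_mult)
qed

end

section \<open>The filtered quotient and its associated graded algebra\<close>

lemma sym_act_mat_1 [simp]: "sym_act (mat 1) p = p"
proof -
  obtain q where "p = sym_proj q" using surj_sym_proj by metis
  then show ?thesis by (simp flip: sym_proj_act)
qed

lemma sym_act_comp: "sym_act (M ** N) p = sym_act M (sym_act N p)"
proof -
  obtain q where "p = sym_proj q" using surj_sym_proj by metis
  then show ?thesis by (simp add: tens_act_comp flip: sym_proj_act)
qed

sublocale finite_rep \<subseteq> T: skew_action G "\<lambda>g. tens_act (\<rho> g)"
  by unfold_locales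
    (simp_all add: finite_carrier tens_act_add tens_act_mult rho_mult tens_act_comp)

sublocale finite_rep \<subseteq> Y: skew_action G "\<lambda>g. sym_act (\<rho> g)"
  by unfold_locales
    (simp_all add: finite_carrier sym_act_add sym_act_mult rho_mult sym_act_comp)

abbreviation (in finite_rep) skew_mult :: "('a \<Rightarrow> 'n tens) \<Rightarrow> ('a \<Rightarrow> 'n tens) \<Rightarrow> 'a \<Rightarrow> 'n tens"
    (infixl "\<star>" 70) where
  "\<phi> \<star> \<psi> \<equiv> \<phi> \<otimes>\<^bsub>T.S\<^esub> \<psi>"

text \<open>The forms are arbitrary here: necessity and sufficiency both work with the same
  description of gr A.\<close>

locale hecke_forms = finite_rep G \<rho>
  for G :: "('a, 'm) monoid_scheme" (structure) and \<rho> :: "'a \<Rightarrow> complex ^ 'n ^ 'n::finite" +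
  fixes a :: "'a \<Rightarrow> complex ^ 'n \<Rightarrow> complex ^ 'n \<Rightarrow> complex"
begin

section \<open>The ideal of relations and arithmetic with its cosets\<close>

definition I where "I = hecke_ideal G \<rho> a"

definition q where "q x = I +>\<^bsub>T.S\<^esub> x"

abbreviation A where "A \<equiv> hecke_algebra G \<rho> a"

definition rel where
  "rel v w = skew_elem (tens_vec v * tens_vec w - tens_vec w * tens_vec v) \<one>
     - (\<Sum>g\<in>carrier G. skew_elem (scal (a g v w)) g)"

lemma hecke_relations_eq: "hecke_relations G a = {rel v w | v w. True}"
  by (simp add: hecke_relations_def rel_def fun_diff_def sum_fun_apply)

lemma rel_closed: "rel v w \<in> carrier T.S"
  unfolding rel_def by (intro T.diff_closed T.sum_closed T.skew_elem_closed) auto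

lemma I_eq: "I = genideal T.S {rel v w | v w. True}"
  by (simp add: I_def hecke_ideal_def tens_skew_def hecke_relations_eq)

lemma ideal_I: "ideal I T.S"
proof -
  interpret ring T.S by (rule T.ring_S)
  show ?thesis unfolding I_eq using rel_closed by (intro genideal_ideal) auto
qed

lemma rel_in_I: "rel v w \<in> I"
proof -
  interpret ring T.S by (rule T.ring_S)
  show ?thesis unfolding I_eq using genideal_self[of "{rel v w | v w. True}"] rel_closed by blast
qed

lemma I_closed: "x \<in> I \<Longrightarrow> x \<in> carrier T.S"
  using ideal_I by (meson additive_subgroup.a_Hcarr ideal.axioms(1))

lemma I_add: "x \<in> I \<Longrightarrow> y \<in> I \<Longrightarrow> x + y \<in> I"
  using additive_subgroup.a_closed[OF ideal.axioms(1)[OF ideal_I], of x y] by simp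

lemma I_zero: "0 \<in> I"
  using additive_subgroup.zero_closed[OF ideal.axioms(1)[OF ideal_I]] by simp

lemma I_mult_left: "x \<in> I \<Longrightarrow> r \<in> carrier T.S \<Longrightarrow> r \<star> x \<in> I"
  and I_mult_right: "x \<in> I \<Longrightarrow> r \<in> carrier T.S \<Longrightarrow> x \<star> r \<in> I"
  using ideal.I_l_closed[OF ideal_I] ideal.I_r_closed[OF ideal_I] by blast+

lemma I_smult: "x \<in> I \<Longrightarrow> c \<odot>\<^bsub>T.S\<^esub> x \<in> I"
  using I_mult_left[of x "skew_elem (scal c) \<one>"] I_closed[of x]
  by (simp add: T.smult_eq_mult T.skew_elem_closed)

lemma I_uminus: "x \<in> I \<Longrightarrow> - x \<in> I"
proof -
  assume "x \<in> I"
  moreover have "(- 1) \<odot>\<^bsub>T.S\<^esub> x = - x"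
    by (simp add: T.smult_S fun_eq_iff scal_minus)
  ultimately show ?thesis using I_smult by metis
qed

lemma I_diff: "x \<in> I \<Longrightarrow> y \<in> I \<Longrightarrow> x - y \<in> I"
  using I_add[of x "- y"] I_uminus[of y] by simp

lemma q_eq_iff:
  assumes "x \<in> carrier T.S" "y \<in> carrier T.S"
  shows "q x = q y \<longleftrightarrow> x - y \<in> I"
proof -
  interpret ring T.S by (rule T.ring_S)
  have "x \<ominus>\<^bsub>T.S\<^esub> y = x - y" using assms by (simp add: a_minus_def T.uminus_S)
  then show ?thesis using quotient_eq_iff_same_a_r_cos[OF ideal_I assms] by (simp add: q_def)
qed

lemma q_add: assumes "x \<in> carrier T.S" "y \<in> carrier T.S" shows "q x \<oplus>\<^bsub>A\<^esub> q y = q (x + y)"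
proof -
  interpret ring T.S by (rule T.ring_S)
  interpret ideal I T.S by (rule ideal_I)
  show ?thesis using a_rcos_sum[OF assms]
    by (simp add: hecke_algebra_def quot_algebra_def ring.defs module.defs FactRing_def q_def tens_skew_def I_def)
qed

lemma q_mult: assumes "x \<in> carrier T.S" "y \<in> carrier T.S" shows "q x \<otimes>\<^bsub>A\<^esub> q y = q (x \<star> y)"
proof -
  interpret ring T.S by (rule T.ring_S)
  interpret ideal I T.S by (rule ideal_I)
  show ?thesis using rcoset_mult_add[OF assms]
    by (simp add: hecke_algebra_def quot_algebra_def ring.defs module.defs FactRing_def q_def tens_skew_def I_def)
qed

lemma q_one: "\<one>\<^bsub>A\<^esub> = q (skew_elem 1 \<one>)"
  by (simp add: hecke_algebra_def quot_algebra_def ring.defs module.defs FactRing_def q_def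
      tens_skew_def I_def T.one_S)

lemma q_zero: "\<zero>\<^bsub>A\<^esub> = q 0"
proof -
  have "q 0 = I" by (simp add: q_def a_r_coset_def')
  then show ?thesis
    by (simp add: hecke_algebra_def quot_algebra_def ring.defs module.defs FactRing_def q_def tens_skew_def I_def)
qed

lemma carrier_A: "carrier A = q ` carrier T.S"
  by (auto simp add: hecke_algebra_def quot_algebra_def ring.defs module.defs FactRing_def q_def
      tens_skew_def I_def A_RCOSETS_def')

text \<open>Scalar multiplication in the quotient is a union over a coset; it collapses because
  \<open>I\<close> is a linear subspace.\<close>

lemma q_smult: assumes x: "x \<in> carrier T.S" shows "c \<odot>\<^bsub>A\<^esub> q x = q (c \<odot>\<^bsub>T.S\<^esub> x)"
proof -
  interpret ring T.S by (rule T.ring_S)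
  interpret ideal I T.S by (rule ideal_I)
  have "c \<odot>\<^bsub>A\<^esub> q x = (\<Union>y\<in>q x. q (c \<odot>\<^bsub>T.S\<^esub> y))"
    by (simp add: hecke_algebra_def quot_algebra_def ring.defs module.defs FactRing_def q_def tens_skew_def I_def)
  moreover have "q (c \<odot>\<^bsub>T.S\<^esub> y) = q (c \<odot>\<^bsub>T.S\<^esub> x)" if y: "y \<in> q x" for y
  proof -
    obtain i where i: "i \<in> I" "y = i + x"
      using y by (auto simp: q_def a_r_coset_def')
    have "c \<odot>\<^bsub>T.S\<^esub> y - c \<odot>\<^bsub>T.S\<^esub> x = c \<odot>\<^bsub>T.S\<^esub> i"
      using i by (simp add: T.smult_S fun_eq_iff distrib_left)
    then show ?thesis
      using i x I_smult I_closed by (subst q_eq_iff) (simp_all add: T.smult_closed T.add_closed)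
  qed
  moreover have "x \<in> q x" using x I_zero by (force simp: q_def a_r_coset_def')
  ultimately show ?thesis by blast
qed

lemma abelian_monoid_A: "abelian_monoid A"
proof (rule abelian_monoidI)
  fix X Y Z assume "X \<in> carrier A" "Y \<in> carrier A" "Z \<in> carrier A"
  then obtain x y z where "X = q x" "Y = q y" "Z = q z"
    "x \<in> carrier T.S" "y \<in> carrier T.S" "z \<in> carrier T.S"
    by (auto simp: carrier_A)
  then show "X \<oplus>\<^bsub>A\<^esub> Y \<oplus>\<^bsub>A\<^esub> Z = X \<oplus>\<^bsub>A\<^esub> (Y \<oplus>\<^bsub>A\<^esub> Z)"
    by (simp add: q_add T.add_closed add.assoc)
qed (auto simp: carrier_A q_add q_zero T.add_closed T.zero_closed add.commute)

lemma q_sum: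
  assumes "\<And>i. i \<le> (k::nat) \<Longrightarrow> x i \<in> carrier T.S"
  shows "(\<Oplus>\<^bsub>A\<^esub>i\<in>{..k}. q (x i)) = q (\<Sum>i\<le>k. x i)"
  using assms
proof (induction k)
  case 0
  interpret abelian_monoid A by (rule abelian_monoid_A)
  have "q (x 0) \<in> carrier A" using 0 by (simp add: carrier_A)
  then show ?case by simp
next
  case (Suc k)
  interpret abelian_monoid A by (rule abelian_monoid_A)
  have c: "q (x i) \<in> carrier A" if "i \<le> Suc k" for i using Suc.prems that by (simp add: carrier_A)
  have "(\<Oplus>\<^bsub>A\<^esub>i\<in>{..Suc k}. q (x i)) = q (x (Suc k)) \<oplus>\<^bsub>A\<^esub> (\<Oplus>\<^bsub>A\<^esub>i\<in>{..k}. q (x i))"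
    unfolding atMost_Suc using c by (intro finsum_insert) auto
  also have "\<dots> = q (x (Suc k) + (\<Sum>i\<le>k. x i))"
    using Suc.prems by (subst Suc.IH) (auto intro!: q_add T.sum_closed)
  also have "x (Suc k) + (\<Sum>i\<le>k. x i) = (\<Sum>i\<le>Suc k. x i)"
    by (simp only: sum.atMost_Suc add.commute)
  finally show ?case .
qed

text \<open>The strict bound is deliberate: \<open>F k\<close> is the image of
  \<open>lower (Suc k)\<close>, and the preceding filtration step is the image of
  \<open>lower k\<close> also for \<open>k = 0\<close>, where it is zero.\<close>

definition lower :: "nat \<Rightarrow> ('a \<Rightarrow> 'n tens) set" where
  "lower k = {\<phi> \<in> carrier T.S. \<forall>g. \<forall>w\<in>Poly_Mapping.keys (\<phi> g). length w < k}"

definition tpart :: "nat \<Rightarrow> ('a \<Rightarrow> 'n tens) \<Rightarrow> 'a \<Rightarrow> 'n tens" where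
  "tpart k \<phi> = (\<lambda>g. deg_part k (\<phi> g))"

text \<open>The coset of \<open>q x\<close> modulo the preceding filtration step, written through
  representatives in T(V)#G (\<open>filt_prev_coset\<close>).\<close>

definition cls :: "nat \<Rightarrow> ('a \<Rightarrow> 'n tens) \<Rightarrow> ('a \<Rightarrow> 'n tens) set set" where
  "cls k x = (\<lambda>t. q (t + x)) ` lower k"

abbreviation F where "F \<equiv> hecke_filtration G \<rho> a"

abbreviation gr where "gr \<equiv> assoc_graded A F"

lemma lower_closed: "x \<in> lower k \<Longrightarrow> x \<in> carrier T.S"
  by (simp add: lower_def)

lemma lower_0 [simp]: "lower 0 = {0}"
  by (auto simp: lower_def fun_eq_iff T.zero_closed)

lemma zero_in_lower [simp]: "0 \<in> lower k"
  by (simp add: lower_def T.zero_closed)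

lemma lower_add: "x \<in> lower k \<Longrightarrow> y \<in> lower k \<Longrightarrow> x + y \<in> lower k"
  using Poly_Mapping.keys_add by (fastforce simp: lower_def T.add_closed)

lemma lower_uminus: "x \<in> lower k \<Longrightarrow> - x \<in> lower k"
  by (simp add: lower_def T.uminus_closed)

lemma lower_diff: "x \<in> lower k \<Longrightarrow> y \<in> lower k \<Longrightarrow> x - y \<in> lower k"
  using lower_add[of x k "- y"] lower_uminus[of y k] by simp

lemma lower_smult: "x \<in> lower k \<Longrightarrow> c \<odot>\<^bsub>T.S\<^esub> x \<in> lower k"
  unfolding lower_def using T.smult_closed
  by (auto simp: in_keys_iff) (auto simp: T.smult_S in_keys_iff)

lemma lower_mono: "j \<le> k \<Longrightarrow> x \<in> lower j \<Longrightarrow> x \<in> lower k"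
  by (fastforce simp: lower_def)

lemma lower_sum: "(\<And>x. x \<in> X \<Longrightarrow> f x \<in> lower k) \<Longrightarrow> sum f X \<in> lower k"
  by (induction X rule: infinite_finite_induct)
    (use lower_add in \<open>simp_all flip: zero_fun_def\<close>)

lemma keys_act_length:
  assumes "v \<in> Poly_Mapping.keys (tens_act M p)"
  shows "\<exists>w\<in>Poly_Mapping.keys p. length v = length w"
proof (rule ccontr)
  assume "\<not> ?thesis"
  then have "Poly_Mapping.lookup p w = 0" if "length w = length v" for w
    using that by (metis in_keys_iff)
  then have "deg_part (length v) p = 0"
    by (intro poly_mapping_eqI) (simp add: lookup_deg_part)
  then have "deg_part (length v) (tens_act M p) = 0" by (simp add: deg_part_act)
  then have "Poly_Mapping.lookup (tens_act M p) v = 0"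
    by (metis lookup_deg_part lookup_zero)
  then show False using assms by (simp add: in_keys_iff)
qed

lemma keys_mult_S:
  assumes "v \<in> Poly_Mapping.keys ((\<phi> \<star> \<psi>) k)"
  obtains g h u w where "u \<in> Poly_Mapping.keys (\<phi> g)" "w \<in> Poly_Mapping.keys (\<psi> h)"
    "length v = length u + length w"
proof -
  from subsetD[OF keys_sum assms[unfolded T.mult_S]]
  obtain x where "v \<in> Poly_Mapping.keys (case x of (g, h) \<Rightarrow> \<phi> g * tens_act (\<rho> g) (\<psi> h))"
    by blast
  then obtain g h where "v \<in> Poly_Mapping.keys (\<phi> g * tens_act (\<rho> g) (\<psi> h))"
    by (cases x) simp
  then obtain u w where uw: "u \<in> Poly_Mapping.keys (\<phi> g)"
    "w \<in> Poly_Mapping.keys (tens_act (\<rho> g) (\<psi> h))" "v = u @ w"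
    using keys_mult[of "\<phi> g" "tens_act (\<rho> g) (\<psi> h)"] by (auto simp: plus_list_def)
  from keys_act_length[OF uw(2)] obtain w' where
    "w' \<in> Poly_Mapping.keys (\<psi> h)" "length w = length w'" by blast
  with uw show ?thesis using that[of u g w' h] by simp
qed

text \<open>The successor turns one strict bound into a weak one: degree below \<open>i\<close>
  times degree at most \<open>j\<close> is below \<open>i + j\<close>.\<close>

lemma lower_mult:
  assumes "\<phi> \<in> lower i" "\<psi> \<in> lower (Suc j)" shows "\<phi> \<star> \<psi> \<in> lower (i + j)"
  and "\<psi> \<star> \<phi> \<in> lower (i + j)"
proof -
  have "length v < i + j" if v: "v \<in> Poly_Mapping.keys ((\<phi> \<star> \<psi>) k)" for v k
  proof -
    obtain u w g h where "u \<in> Poly_Mapping.keys (\<phi> g)" "w \<in> Poly_Mapping.keys (\<psi> h)"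
      "length v = length u + length w"
      using v by (rule keys_mult_S)
    then have "length u < i" "length w < Suc j" using assms by (auto simp: lower_def)
    then show ?thesis using \<open>length v = _\<close> by simp
  qed
  then show "\<phi> \<star> \<psi> \<in> lower (i + j)" by (simp add: lower_def T.mult_closed)
  have "length v < i + j" if v: "v \<in> Poly_Mapping.keys ((\<psi> \<star> \<phi>) k)" for v k
  proof -
    obtain u w g h where "u \<in> Poly_Mapping.keys (\<psi> g)" "w \<in> Poly_Mapping.keys (\<phi> h)"
      "length v = length u + length w"
      using v by (rule keys_mult_S)
    then have "length u < Suc j" "length w < i" using assms by (auto simp: lower_def)
    then show ?thesis using \<open>length v = _\<close> by simp
  qed
  then show "\<psi> \<star> \<phi> \<in> lower (i + j)" by (simp add: lower_def T.mult_closed)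
qed

lemma filtration_eq: "F k = q ` lower (Suc k)"
  by (auto simp: hecke_filtration_def q_def I_def lower_def tens_skew_def less_Suc_eq_le)

lemma filt_prev_eq: "filt_prev A F k = q ` lower k"
  by (cases k) (simp_all add: filt_prev_def filtration_eq q_zero)

lemma filt_prev_coset: "x \<in> carrier T.S \<Longrightarrow> filt_prev A F k +>\<^bsub>A\<^esub> q x = cls k x"
  by (auto simp: filt_prev_eq a_r_coset_def' cls_def q_add lower_closed)

lemma filt_prev_cls: "filt_prev A F k = cls k 0"
  by (simp add: filt_prev_eq cls_def)

text \<open>Equality in a graded quotient becomes congruence modulo \<open>I + lower k\<close>, so
  that later arguments can stay inside T(V)#G.\<close>

lemma cls_eq_iff:
  assumes "x \<in> carrier T.S" "y \<in> carrier T.S"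
  shows "cls k x = cls k y \<longleftrightarrow> (\<exists>i\<in>I. \<exists>t\<in>lower k. x - y = i + t)"
proof
  assume "cls k x = cls k y"
  moreover have "q x \<in> cls k x" unfolding cls_def by (rule image_eqI[of _ _ 0]) simp_all
  ultimately obtain t where t: "t \<in> lower k" "q x = q (t + y)" by (auto simp: cls_def)
  then have "x - (t + y) \<in> I" using assms lower_closed T.add_closed q_eq_iff by blast
  then show "\<exists>i\<in>I. \<exists>t\<in>lower k. x - y = i + t"
    using t(1) by (intro bexI[of _ "x - (t + y)"] bexI[of _ t]) auto
next
  have sub: "cls k x \<subseteq> cls k y"
    if xy: "x - y = i + t" "i \<in> I" "t \<in> lower k" "x \<in> carrier T.S" "y \<in> carrier T.S" for x y i t
  proof
    fix X assume "X \<in> cls k x"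
    then obtain s where s: "s \<in> lower k" "X = q (s + x)" by (auto simp: cls_def)
    have "(s + x) - (s + t + y) = i" using xy(1) by (simp add: algebra_simps)
    then have "X = q (s + t + y)"
      using s xy lower_closed by (subst s(2), subst q_eq_iff) (auto intro!: T.add_closed)
    then show "X \<in> cls k y" using s(1) xy(3) lower_add by (auto simp: cls_def)
  qed
  assume "\<exists>i\<in>I. \<exists>t\<in>lower k. x - y = i + t"
  then obtain i t where it: "i \<in> I" "t \<in> lower k" "x - y = i + t" by blast
  moreover have "y - x = - i + - t" using it(3) by (metis minus_add minus_diff_eq add.commute)
  ultimately show "cls k x = cls k y"
    using sub[of x y i t] sub[of y x "- i" "- t"] assms I_uminus lower_uminus by blast
qed

text \<open>The canonical surjection from T(V)#G onto gr A. Through it, computations with sequences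
  of cosets become computations with tensors.\<close>

definition gr_map :: "('a \<Rightarrow> 'n tens) \<Rightarrow> nat \<Rightarrow> ('a \<Rightarrow> 'n tens) set set" where
  "gr_map \<phi> = (\<lambda>k. cls k (tpart k \<phi>))"

definition tens_component :: "nat \<Rightarrow> ('a \<Rightarrow> 'n tens) set" where
  "tens_component k = {\<phi> \<in> carrier T.S. tpart k \<phi> = \<phi>}"

lemma tpart_closed: "\<phi> \<in> carrier T.S \<Longrightarrow> tpart k \<phi> \<in> carrier T.S"
  by (auto simp: T.carrier_S tpart_def)

lemma tpart_in_lower: "\<phi> \<in> carrier T.S \<Longrightarrow> tpart k \<phi> \<in> lower (Suc k)"
  by (auto simp: lower_def tpart_closed) (auto simp: tpart_def keys_deg_part)

lemma tpart_add: "tpart k (\<phi> + \<psi>) = tpart k \<phi> + tpart k \<psi>"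
  by (simp add: tpart_def deg_part_add fun_eq_iff)

lemma tpart_diff: "tpart k (\<phi> - \<psi>) = tpart k \<phi> - tpart k \<psi>"
  by (simp add: tpart_def deg_part_diff fun_eq_iff)

lemma tpart_0 [simp]: "tpart k 0 = 0"
  by (simp add: tpart_def fun_eq_iff)

lemma tpart_sum: "tpart k (sum f X) = (\<Sum>x\<in>X. tpart k (f x))"
  using sum_comp_morphism[of "tpart k" f X] by (simp add: tpart_add o_def)

lemma tpart_smult: "tpart k (c \<odot>\<^bsub>T.S\<^esub> \<phi>) = c \<odot>\<^bsub>T.S\<^esub> tpart k \<phi>"
  by (simp add: tpart_def T.smult_S deg_part_scal fun_eq_iff)

lemma tpart_tpart: "tpart j (tpart k \<phi>) = (if j = k then tpart k \<phi> else 0)"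
proof -
  have "deg_part j (deg_part k p) = (if j = k then deg_part k p else 0)" for p :: "'n tens"
    by (intro poly_mapping_eqI) (simp add: lookup_deg_part)
  then show ?thesis by (simp add: tpart_def fun_eq_iff)
qed

lemma tpart_lower: "x \<in> lower k \<Longrightarrow> k \<le> j \<Longrightarrow> tpart j x = 0"
proof -
  assume x: "x \<in> lower k" "k \<le> j"
  have "deg_part j (x g) = 0" for g
  proof (rule poly_mapping_eqI)
    fix w
    show "Poly_Mapping.lookup (deg_part j (x g)) w = Poly_Mapping.lookup 0 w"
    proof (cases "length w = j")
      case True
      then have "w \<notin> Poly_Mapping.keys (x g)" using x by (fastforce simp: lower_def)
      then show ?thesis by (simp add: lookup_deg_part in_keys_iff)
    qed (simp add: lookup_deg_part)
  qed
  then show ?thesis by (simp add: tpart_def fun_eq_iff)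
qed

lemma diff_part_lower: "x \<in> lower (Suc k) \<Longrightarrow> x - tpart k x \<in> lower k"
proof -
  assume x: "x \<in> lower (Suc k)"
  have "length w < k" if w: "w \<in> Poly_Mapping.keys ((x - tpart k x) g)" for w g
  proof -
    have "Poly_Mapping.lookup (x g) w \<noteq> 0" "length w \<noteq> k"
      using w by (auto simp: in_keys_iff tpart_def lookup_minus lookup_deg_part split: if_splits)
    then show ?thesis using x by (force simp: lower_def in_keys_iff)
  qed
  moreover have "x - tpart k x \<in> carrier T.S"
    using x lower_closed tpart_closed T.diff_closed by blast
  ultimately show ?thesis by (simp add: lower_def)
qed

lemma tpart_mult: "tpart k (\<phi> \<star> \<psi>) = (\<Sum>i\<le>k. tpart i \<phi> \<star> tpart (k - i) \<psi>)"
proof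
  fix x
  show "tpart k (\<phi> \<star> \<psi>) x = (\<Sum>i\<le>k. tpart i \<phi> \<star> tpart (k - i) \<psi>) x"
    unfolding sum_fun_apply T.mult_S tpart_def deg_part_sum
    by (subst sum.swap) (simp add: split_def deg_part_mult deg_part_act)
qed

lemma ex_lower: assumes "\<phi> \<in> carrier T.S" shows "\<exists>N. \<phi> \<in> lower N"
proof -
  have "finite (length ` (\<Union>g\<in>carrier G. Poly_Mapping.keys (\<phi> g)))"
    using finite_carrier by simp
  then obtain N where N: "\<And>n. n \<in> length ` (\<Union>g\<in>carrier G. Poly_Mapping.keys (\<phi> g)) \<Longrightarrow> n < N"
    unfolding finite_nat_set_iff_bounded by blast
  have "length w < N" if "w \<in> Poly_Mapping.keys (\<phi> g)" for g w
  proof (cases "g \<in> carrier G")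
    case True
    then show ?thesis using that N by blast
  next
    case False
    then have "\<phi> g = 0" using assms by (simp add: T.carrier_S)
    then show ?thesis using that by simp
  qed
  then have "\<phi> \<in> lower N" using assms by (simp add: lower_def)
  then show ?thesis ..
qed

lemma carrier_gr: "carrier gr =
    {\<psi>. (\<forall>k. \<exists>x\<in>lower (Suc k). \<psi> k = cls k x) \<and> finite {k. \<psi> k \<noteq> cls k 0}}"
  by (auto simp: assoc_graded_def filtration_eq filt_prev_coset lower_closed filt_prev_cls[symmetric])

lemma gr_map_closed: assumes "\<phi> \<in> carrier T.S" shows "gr_map \<phi> \<in> carrier gr"
proof -
  obtain N where N: "\<phi> \<in> lower N" using ex_lower assms by blast
  then have "{k. gr_map \<phi> k \<noteq> cls k 0} \<subseteq> {..<N}"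
    using tpart_lower[OF N] by (auto simp: gr_map_def not_less[symmetric] intro: ccontr)
  then have "finite {k. gr_map \<phi> k \<noteq> cls k 0}" by (rule finite_subset) simp
  then show ?thesis
    using tpart_in_lower[OF assms] by (auto simp: carrier_gr gr_map_def)
qed

lemma cls_cong:
  assumes "x \<in> carrier T.S" "y \<in> carrier T.S" "x - y \<in> lower k"
  shows "cls k x = cls k y"
proof -
  have "\<exists>i\<in>I. \<exists>t\<in>lower k. x - y = i + t"
    using I_zero assms(3) by (metis add_0)
  then show ?thesis using cls_eq_iff assms by blast
qed

lemma gr_map_surj: assumes "\<psi> \<in> carrier gr" shows "\<exists>\<phi>\<in>carrier T.S. gr_map \<phi> = \<psi>"
proof -
  obtain x where x: "\<And>k. x k \<in> lower (Suc k)" "\<And>k. \<psi> k = cls k (x k)"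
    using assms unfolding carrier_gr by (auto simp: Bex_def) metis
  define K where "K = {k. \<psi> k \<noteq> cls k 0}"
  have K: "finite K" using assms by (simp add: carrier_gr K_def)
  \<comment> \<open>Cutting a representative down to its part of degree \<open>k\<close> changes it
    only by an element of \<open>lower k\<close>, and by finiteness of the support the parts can be
    summed to one preimage.\<close>
  define \<phi> where "\<phi> = (\<Sum>k\<in>K. tpart k (x k))"
  have \<phi>: "\<phi> \<in> carrier T.S"
    unfolding \<phi>_def using x(1) lower_closed tpart_closed by (intro T.sum_closed) blast
  have "tpart j \<phi> = (\<Sum>k\<in>K. if j = k then tpart j (x j) else 0)" for j
    unfolding \<phi>_def tpart_sum tpart_tpart by (intro sum.cong) auto
  then have p: "tpart j \<phi> = (if j \<in> K then tpart j (x j) else 0)" for j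
    using K by simp
  have "gr_map \<phi> j = \<psi> j" for j
  proof (cases "j \<in> K")
    case True
    have "x j - tpart j (x j) \<in> lower j" by (rule diff_part_lower) (rule x(1))
    then have "cls j (x j) = cls j (tpart j (x j))"
      using x(1) lower_closed tpart_closed by (intro cls_cong) blast+
    then show ?thesis using True x(2) p by (simp add: gr_map_def)
  next
    case False
    then show ?thesis using p by (simp add: gr_map_def K_def)
  qed
  then show ?thesis using \<phi> by (intro bexI[of _ \<phi>]) auto
qed

lemma gr_map_eq_iff:
  assumes "\<phi> \<in> carrier T.S" "\<psi> \<in> carrier T.S"
  shows "gr_map \<phi> = gr_map \<psi> \<longleftrightarrow> (\<forall>k. \<exists>i\<in>I. \<exists>t\<in>lower k. tpart k (\<phi> - \<psi>) = i + t)"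
proof -
  have "gr_map \<phi> = gr_map \<psi> \<longleftrightarrow> (\<forall>k. cls k (tpart k \<phi>) = cls k (tpart k \<psi>))"
    by (simp only: gr_map_def fun_eq_iff)
  then show ?thesis using assms by (simp only: cls_eq_iff tpart_closed tpart_diff)
qed

lemma gr_map_add:
  assumes "\<phi> \<in> carrier T.S" "\<psi> \<in> carrier T.S"
  shows "gr_map \<phi> \<oplus>\<^bsub>gr\<^esub> gr_map \<psi> = gr_map (\<phi> + \<psi>)"
proof
  fix k
  let ?x = "tpart k \<phi>" and ?y = "tpart k \<psi>"
  have xy: "?x \<in> carrier T.S" "?y \<in> carrier T.S" using assms tpart_closed by blast+
  have sum: "q (t + ?x) \<oplus>\<^bsub>A\<^esub> q (s + ?y) = q (t + s + (?x + ?y))" if "t \<in> lower k" "s \<in> lower k" for s t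
  proof -
    have "q (t + ?x) \<oplus>\<^bsub>A\<^esub> q (s + ?y) = q ((t + ?x) + (s + ?y))"
      using that xy lower_closed T.add_closed by (intro q_add) blast+
    also have "(t + ?x) + (s + ?y) = t + s + (?x + ?y)" by (simp only: ac_simps)
    finally show ?thesis .
  qed
  have "(gr_map \<phi> \<oplus>\<^bsub>gr\<^esub> gr_map \<psi>) k = cls k ?x <+>\<^bsub>A\<^esub> cls k ?y"
    by (simp add: assoc_graded_def gr_map_def)
  also have "\<dots> = cls k (?x + ?y)"
  proof (intro equalityI subsetI)
    fix X assume "X \<in> cls k ?x <+>\<^bsub>A\<^esub> cls k ?y"
    then obtain t s where ts: "t \<in> lower k" "s \<in> lower k" "X = q (t + ?x) \<oplus>\<^bsub>A\<^esub> q (s + ?y)"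
      by (auto simp: set_add_def' cls_def)
    then show "X \<in> cls k (?x + ?y)" using sum lower_add unfolding cls_def by blast
  next
    fix X assume "X \<in> cls k (?x + ?y)"
    then obtain t where t: "t \<in> lower k" "X = q (t + (?x + ?y))" by (auto simp: cls_def)
    then have "X = q (t + ?x) \<oplus>\<^bsub>A\<^esub> q (0 + ?y)" using sum[of t 0] by simp
    then show "X \<in> cls k ?x <+>\<^bsub>A\<^esub> cls k ?y"
      using t(1) zero_in_lower[of k] unfolding set_add_def' cls_def by blast
  qed
  finally show "(gr_map \<phi> \<oplus>\<^bsub>gr\<^esub> gr_map \<psi>) k = gr_map (\<phi> + \<psi>) k" by (simp only: gr_map_def tpart_add)
qed

lemma gr_map_smult:
  assumes "\<phi> \<in> carrier T.S"
  shows "c \<odot>\<^bsub>gr\<^esub> gr_map \<phi> = gr_map (c \<odot>\<^bsub>T.S\<^esub> \<phi>)"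
proof
  fix k
  let ?x = "tpart k \<phi>"
  have x: "?x \<in> carrier T.S" using assms tpart_closed by blast
  have "(c \<odot>\<^bsub>gr\<^esub> gr_map \<phi>) k = (\<Union>X\<in>cls k ?x. filt_prev A F k +>\<^bsub>A\<^esub> (c \<odot>\<^bsub>A\<^esub> X))"
    by (simp add: assoc_graded_def gr_map_def)
  moreover have "filt_prev A F k +>\<^bsub>A\<^esub> (c \<odot>\<^bsub>A\<^esub> X) = cls k (c \<odot>\<^bsub>T.S\<^esub> ?x)" if X: "X \<in> cls k ?x" for X
  proof -
    obtain t where t: "t \<in> lower k" "X = q (t + ?x)" using X by (auto simp: cls_def)
    have tx: "t + ?x \<in> carrier T.S" using t x lower_closed T.add_closed by blast
    have "c \<odot>\<^bsub>T.S\<^esub> (t + ?x) - c \<odot>\<^bsub>T.S\<^esub> ?x = c \<odot>\<^bsub>T.S\<^esub> t"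
      by (simp add: T.smult_S fun_eq_iff distrib_left)
    then have "cls k (c \<odot>\<^bsub>T.S\<^esub> (t + ?x)) = cls k (c \<odot>\<^bsub>T.S\<^esub> ?x)"
      using tx x T.smult_closed lower_smult[OF t(1)] by (intro cls_cong) auto
    then show ?thesis
      using tx t(2) by (simp add: q_smult filt_prev_coset T.smult_closed)
  qed
  moreover have "cls k ?x \<noteq> {}" using zero_in_lower[of k] unfolding cls_def by blast
  ultimately show "(c \<odot>\<^bsub>gr\<^esub> gr_map \<phi>) k = gr_map (c \<odot>\<^bsub>T.S\<^esub> \<phi>) k"
    by (simp add: gr_map_def tpart_smult)
qed

lemma gr_map_one: "\<one>\<^bsub>gr\<^esub> = gr_map (skew_elem 1 \<one>)"
proof
  fix k
  have "tpart k (skew_elem 1 \<one>) = (if k = 0 then skew_elem 1 \<one> else 0)"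
    using deg_part_single[of k "[] :: 'n list" 1]
    by (auto simp: tpart_def skew_elem_def fun_eq_iff)
  then show "\<one>\<^bsub>gr\<^esub> k = gr_map (skew_elem 1 \<one>) k"
    using filt_prev_coset[of "skew_elem 1 \<one>" 0]
    by (simp add: assoc_graded_def q_one gr_map_def T.skew_elem_closed filt_prev_cls)
qed

text \<open>The product in gr A is a union over all choices of representatives. Each choice yields
  the same class (\<open>eq\<close>), because an error of lower degree in one factor stays of lower
  degree after multiplication.\<close>

lemma gr_map_mult:
  assumes "\<phi> \<in> carrier T.S" "\<psi> \<in> carrier T.S"
  shows "gr_map \<phi> \<otimes>\<^bsub>gr\<^esub> gr_map \<psi> = gr_map (\<phi> \<star> \<psi>)"
proof
  fix k
  let ?P = "filt_prev A F k" and ?z = "tpart k (\<phi> \<star> \<psi>)"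
  have eq: "?P +>\<^bsub>A\<^esub> (\<Oplus>\<^bsub>A\<^esub>i\<in>{..k}. X i \<otimes>\<^bsub>A\<^esub> Y (k - i)) = cls k ?z"
    if XY: "X \<in> Pi UNIV (gr_map \<phi>)" "Y \<in> Pi UNIV (gr_map \<psi>)" for X Y
  proof -
    have "\<forall>i. \<exists>t. t \<in> lower i \<and> X i = q (t + tpart i \<phi>)" "\<forall>i. \<exists>s. s \<in> lower i \<and> Y i = q (s + tpart i \<psi>)"
      using XY by (auto simp: gr_map_def cls_def Pi_def)
    then obtain t s where t: "\<And>i. t i \<in> lower i" "\<And>i. X i = q (t i + tpart i \<phi>)"
      and s: "\<And>i. s i \<in> lower i" "\<And>i. Y i = q (s i + tpart i \<psi>)"
      by metis
    have tc: "t i + tpart i \<phi> \<in> carrier T.S" and sc: "s i + tpart i \<psi> \<in> carrier T.S" for i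
      using t(1)[of i] s(1)[of i] assms tpart_closed lower_closed T.add_closed by blast+
    let ?w = "\<Sum>i\<le>k. (t i + tpart i \<phi>) \<star> (s (k - i) + tpart (k - i) \<psi>)"
    have wc: "?w \<in> carrier T.S" by (intro T.sum_closed T.mult_closed)
    have "(\<Oplus>\<^bsub>A\<^esub>i\<in>{..k}. X i \<otimes>\<^bsub>A\<^esub> Y (k - i)) =
        (\<Oplus>\<^bsub>A\<^esub>i\<in>{..k}. q ((t i + tpart i \<phi>) \<star> (s (k - i) + tpart (k - i) \<psi>)))"
      using t(2) s(2) tc sc by (simp add: q_mult)
    also have "\<dots> = q ?w" by (intro q_sum T.mult_closed)
    finally have "?P +>\<^bsub>A\<^esub> (\<Oplus>\<^bsub>A\<^esub>i\<in>{..k}. X i \<otimes>\<^bsub>A\<^esub> Y (k - i)) = cls k ?w"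
      using filt_prev_coset wc by simp
    also have "\<dots> = cls k ?z"
    proof (rule cls_cong[OF wc])
      show "?z \<in> carrier T.S" using tpart_closed T.mult_closed by blast
      have "?w - ?z = (\<Sum>i\<le>k. t i \<star> (s (k - i) + tpart (k - i) \<psi>) + tpart i \<phi> \<star> s (k - i))"
        unfolding tpart_mult sum_subtractf[symmetric]
        by (intro sum.cong refl) (simp only: T.mult_add_left T.mult_add_right, simp add: fun_eq_iff)
      also have "\<dots> \<in> lower k"
      proof (intro lower_sum lower_add)
        fix i assume "i \<in> {..k}"
        then have i: "i + (k - i) = k" "k - i + i = k" by auto
        have "s (k - i) + tpart (k - i) \<psi> \<in> lower (Suc (k - i))"
          using s(1)[of "k - i"] lower_mono[of "k - i" "Suc (k - i)"] tpart_in_lower[OF assms(2)]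
          by (intro lower_add) auto
        from lower_mult(1)[OF t(1)[of i] this]
        show "t i \<star> (s (k - i) + tpart (k - i) \<psi>) \<in> lower k" by (simp only: i)
        from lower_mult(2)[OF s(1)[of "k - i"] tpart_in_lower[OF assms(1), of i]]
        show "tpart i \<phi> \<star> s (k - i) \<in> lower k" by (metis i(2))
      qed
      finally show "?w - ?z \<in> lower k" .
    qed
    finally show ?thesis .
  qed
  \<comment> \<open>Without an admissible choice the union would be empty instead of a
    coset.\<close>
  have ne: "\<exists>X. X \<in> Pi UNIV (gr_map x)" for x
    using zero_in_lower unfolding gr_map_def cls_def Pi_def
    by (intro exI[of _ "\<lambda>k. q (0 + tpart k x)"]) blast
  have "(gr_map \<phi> \<otimes>\<^bsub>gr\<^esub> gr_map \<psi>) k = (\<Union>X\<in>Pi UNIV (gr_map \<phi>). \<Union>Y\<in>Pi UNIV (gr_map \<psi>).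
      ?P +>\<^bsub>A\<^esub> (\<Oplus>\<^bsub>A\<^esub>i\<in>{..k}. X i \<otimes>\<^bsub>A\<^esub> Y (k - i)))"
    by (simp add: assoc_graded_def)
  also have "\<dots> = (\<Union>X\<in>Pi UNIV (gr_map \<phi>). \<Union>Y\<in>Pi UNIV (gr_map \<psi>). cls k ?z)"
    by (intro SUP_cong refl eq)
  also have "\<dots> = cls k ?z" using ne[of \<phi>] ne[of \<psi>] by blast
  finally show "(gr_map \<phi> \<otimes>\<^bsub>gr\<^esub> gr_map \<psi>) k = gr_map (\<phi> \<star> \<psi>) k"
    by (simp only: gr_map_def)
qed

lemma gr_map_component: "gr_map ` tens_component k = graded_component A F k"
proof (intro equalityI subsetI)
  fix \<psi> assume "\<psi> \<in> gr_map ` tens_component k"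
  then obtain \<phi> where \<phi>: "\<phi> \<in> carrier T.S" "tpart k \<phi> = \<phi>" "\<psi> = gr_map \<phi>"
    by (auto simp: tens_component_def)
  have "tpart j \<phi> = 0" if "j \<noteq> k" for j using tpart_tpart[of j k \<phi>] \<phi>(2) that by simp
  then show "\<psi> \<in> graded_component A F k"
    using \<phi> gr_map_closed[OF \<phi>(1)] by (simp add: graded_component_def filt_prev_cls) (simp add: gr_map_def)
next
  fix \<psi> assume \<psi>: "\<psi> \<in> graded_component A F k"
  then have "\<psi> \<in> carrier gr" by (simp add: graded_component_def)
  from gr_map_surj[OF this] obtain \<phi> where \<phi>: "\<phi> \<in> carrier T.S" "\<psi> = gr_map \<phi>" by blast
  have "gr_map (tpart k \<phi>) j = \<psi> j" for j
    using \<psi> \<phi>(2) by (cases "j = k") (auto simp: gr_map_def tpart_tpart graded_component_def filt_prev_cls)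
  then have "\<psi> = gr_map (tpart k \<phi>)" by auto
  then show "\<psi> \<in> gr_map ` tens_component k"
    using \<phi> by (auto simp: tens_component_def tpart_closed tpart_tpart)
qed

section \<open>The projection onto the skew group algebra of the symmetric algebra\<close>

definition proj :: "('a \<Rightarrow> 'n tens) \<Rightarrow> 'a \<Rightarrow> 'n spoly" where
  "proj \<phi> = (\<lambda>g. sym_proj (\<phi> g))"

lemma proj_closed: "\<phi> \<in> carrier T.S \<Longrightarrow> proj \<phi> \<in> carrier Y.S"
  by (simp add: proj_def T.carrier_S Y.carrier_S)

lemma proj_add: "proj (\<phi> + \<psi>) = proj \<phi> + proj \<psi>"
  by (simp add: proj_def sym_proj_add fun_eq_iff)

lemma proj_diff: "proj (\<phi> - \<psi>) = proj \<phi> - proj \<psi>"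
  by (simp add: proj_def sym_proj_diff fun_eq_iff)

lemma proj_mult: "proj (\<phi> \<star> \<psi>) = proj \<phi> \<otimes>\<^bsub>Y.S\<^esub> proj \<psi>"
  by (simp add: proj_def fun_eq_iff T.mult_S Y.mult_S sym_proj_sum split_def sym_proj_mult sym_proj_act)

lemma proj_one: "proj (skew_elem 1 \<one>) = skew_elem 1 \<one>"
  by (simp add: proj_def skew_elem_def fun_eq_iff)

lemma proj_smult: "proj (c \<odot>\<^bsub>T.S\<^esub> \<phi>) = c \<odot>\<^bsub>Y.S\<^esub> proj \<phi>"
  by (simp add: proj_def T.smult_S Y.smult_S sym_proj_scal)

lemma proj_surj: assumes "\<psi> \<in> carrier Y.S" shows "\<exists>\<phi>\<in>carrier T.S. proj \<phi> = \<psi>"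
proof -
  define \<phi> where "\<phi> g = (if g \<in> carrier G then SOME p. sym_proj p = \<psi> g else 0)" for g
  have "sym_proj (\<phi> g) = \<psi> g" for g
  proof (cases "g \<in> carrier G")
    case True
    then show ?thesis using someI_ex[OF surj_sym_proj[of "\<psi> g"]] by (simp add: \<phi>_def)
  next
    case False
    then show ?thesis using assms by (simp add: \<phi>_def Y.carrier_S)
  qed
  then have "proj \<phi> = \<psi>" by (simp add: proj_def)
  moreover have "\<phi> \<in> carrier T.S" by (simp add: T.carrier_S \<phi>_def)
  ultimately show ?thesis by blast
qed

lemma proj_component: "proj ` tens_component k = sym_skew_component G k"
proof (intro equalityI subsetI)
  fix \<psi> assume "\<psi> \<in> proj ` tens_component k"
  then obtain \<phi> where \<phi>: "\<phi> \<in> carrier T.S" "tpart k \<phi> = \<phi>" "\<psi> = proj \<phi>"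
    by (auto simp: tens_component_def)
  have "mono_deg e = k" if "e \<in> Poly_Mapping.keys (\<psi> g)" for e g
  proof -
    have "\<psi> g = sym_proj (deg_part k (\<phi> g))"
      using \<phi>(2,3) by (metis tpart_def proj_def)
    then show ?thesis
      using that lookup_sym_proj_deg_part[of k "\<phi> g" e] by (auto simp: in_keys_iff split: if_splits)
  qed
  then show "\<psi> \<in> sym_skew_component G k"
    using proj_closed[OF \<phi>(1)] \<phi>(3) by (simp add: sym_skew_component_def Y.carrier_S)
next
  fix \<psi> :: "'a \<Rightarrow> 'n spoly" assume \<psi>: "\<psi> \<in> sym_skew_component G k"
  then have "\<psi> \<in> carrier Y.S" by (simp add: sym_skew_component_def Y.carrier_S)
  from proj_surj[OF this] obtain \<phi> where \<phi>: "\<phi> \<in> carrier T.S" "proj \<phi> = \<psi>" by blast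
  have "proj (tpart k \<phi>) = \<psi>"
  proof (rule ext, rule poly_mapping_eqI)
    fix g e
    show "Poly_Mapping.lookup (proj (tpart k \<phi>) g) e = Poly_Mapping.lookup (\<psi> g) e"
      using \<psi> \<phi>(2) by (cases "Poly_Mapping.lookup (\<psi> g) e = 0")
        (auto simp: sym_skew_component_def in_keys_iff proj_def tpart_def lookup_sym_proj_deg_part)
  qed
  then show "\<psi> \<in> proj ` tens_component k"
    using \<phi> by (intro image_eqI[of _ _ "tpart k \<phi>"]) (auto simp: tens_component_def tpart_closed tpart_tpart)
qed

section \<open>The Poincare-Birkhoff-Witt criterion\<close>

text \<open>The elements of T(V)#G whose image in the quotient lies in the filtration step before
  \<open>k\<close>.\<close>

definition small :: "nat \<Rightarrow> ('a \<Rightarrow> 'n tens) set" where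
  "small k = {i + t | i t. i \<in> I \<and> t \<in> lower k}"

lemma small_intro: "i \<in> I \<Longrightarrow> t \<in> lower k \<Longrightarrow> i + t \<in> small k"
  unfolding small_def by blast

lemma small_add: "x \<in> small k \<Longrightarrow> y \<in> small k \<Longrightarrow> x + y \<in> small k"
proof -
  assume "x \<in> small k" "y \<in> small k"
  then obtain i t j s where "i \<in> I" "j \<in> I" "t \<in> lower k" "s \<in> lower k" "x = i + t" "y = j + s"
    by (auto simp: small_def)
  then have "x + y = (i + j) + (t + s)" "i + j \<in> I" "t + s \<in> lower k"
    by (simp_all only: I_add lower_add ac_simps)
  then show ?thesis unfolding small_def by blast
qed

lemma small_I: "x \<in> I \<Longrightarrow> x \<in> small k"
proof -
  assume "x \<in> I"
  moreover have "x = x + 0" by simp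
  ultimately show ?thesis unfolding small_def using zero_in_lower by blast
qed

lemma small_zero: "0 \<in> small k"
  using small_I I_zero by blast

lemma small_smult: "x \<in> small k \<Longrightarrow> c \<odot>\<^bsub>T.S\<^esub> x \<in> small k"
proof -
  assume "x \<in> small k"
  then obtain i t where "i \<in> I" "t \<in> lower k" "x = i + t" by (auto simp: small_def)
  moreover have "c \<odot>\<^bsub>T.S\<^esub> (i + t) = c \<odot>\<^bsub>T.S\<^esub> i + c \<odot>\<^bsub>T.S\<^esub> t"
    by (simp add: T.smult_S fun_eq_iff distrib_left)
  ultimately show ?thesis unfolding small_def using I_smult lower_smult by blast
qed

lemma small_sum: "finite X \<Longrightarrow> (\<And>x. x \<in> X \<Longrightarrow> f x \<in> small k) \<Longrightarrow> sum f X \<in> small k"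
proof (induction X rule: finite_induct)
  case (insert x X)
  then show ?case by (subst sum.insert) (auto intro!: small_add)
qed (simp only: sum.empty small_zero)

lemma skew_elem_lower: "g \<in> carrier G \<Longrightarrow> (\<And>w. w \<in> Poly_Mapping.keys p \<Longrightarrow> length w < k) \<Longrightarrow>
    skew_elem p g \<in> lower k"
  by (auto simp: lower_def T.skew_elem_closed) (auto simp: skew_elem_def split: if_splits)

text \<open>Multiplying a relation by \<open>u\<close> on the left and by \<open>v\<close> and
  \<open>g\<close> on the right gives the exchange plus a sum in which the two exchanged letters are
  replaced by group elements, which lowers the degree.\<close>

lemma swap_small:
  assumes g: "g \<in> carrier G"
  shows "skew_elem (word (u @ x # y # v) - word (u @ y # x # v)) g \<in> small (length u + 2 + length v)"
proof -
  let ?U = "skew_elem (word u) \<one>" and ?V = "skew_elem (word v) g"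
  let ?r = "rel (axis x 1) (axis y 1)"
  let ?s = "\<Sum>h\<in>carrier G. skew_elem (scal (a h (axis x 1) (axis y 1)) :: 'n tens) h"
  let ?b = "skew_elem (word [x] * word [y] - word [y] * word [x]) \<one>"
  have b: "?b = ?r + ?s" by (simp add: rel_def)
  have e1: "?U \<star> ?b \<star> ?V = skew_elem (word (u @ x # y # v) - word (u @ y # x # v)) g"
    using g by (simp add: T.skew_elem_mult) (simp add: word_mult right_diff_distrib left_diff_distrib)
  have e2: "?U \<star> ?b \<star> ?V = ?U \<star> ?r \<star> ?V + ?U \<star> ?s \<star> ?V"
    unfolding b by (simp only: T.mult_add_left T.mult_add_right)
  have m1: "?U \<star> ?r \<star> ?V \<in> I"
    using g by (intro I_mult_left I_mult_right rel_in_I T.skew_elem_closed) auto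
  have m2: "?U \<star> ?s \<star> ?V \<in> lower (length u + 2 + length v)"
  proof -
    have "?U \<in> lower (Suc (length u))" "?V \<in> lower (Suc (length v))"
      using g by (auto intro!: skew_elem_lower split: if_splits)
    moreover have "?s \<in> lower (Suc 0)"
      by (intro lower_sum skew_elem_lower) (auto simp: scal_def zero_list_def split: if_splits)
    ultimately have "?U \<star> ?s \<star> ?V \<in> lower (Suc (length u) + 0 + length v)"
      by (intro lower_mult)
    then show ?thesis by (rule lower_mono[rotated]) simp
  qed
  show ?thesis using small_intro[OF m1 m2] by (simp only: e1[symmetric] e2)
qed

lemma skew_elem_telescope:
  assumes "skew_elem (p - r) g \<in> small k" "skew_elem (r - s) g \<in> small k"
  shows "skew_elem (p - s) g \<in> small k"
proof -
  have "p - s = (p - r) + (r - s)" by simp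
  then show ?thesis using small_add[OF assms] by (metis skew_elem_add)
qed

lemma move_small:
  assumes g: "g \<in> carrier G"
  shows "skew_elem (word (u @ x # v @ w) - word (u @ v @ x # w)) g
    \<in> small (length u + length v + length w + 1)"
proof (induction v arbitrary: u)
  case Nil
  then show ?case by (simp only: append_Nil diff_self skew_elem_0 small_zero)
next
  case (Cons y v)
  have "skew_elem (word (u @ x # y # v @ w) - word (u @ y # x # v @ w)) g
      \<in> small (length u + length (y # v) + length w + 1)"
    using swap_small[OF g, of u x y "v @ w"] by (simp add: ac_simps)
  moreover have "skew_elem (word (u @ y # x # v @ w) - word (u @ y # v @ x # w)) g
      \<in> small (length u + length (y # v) + length w + 1)"
    using Cons[of "u @ [y]"] by (simp add: ac_simps)
  ultimately show ?case unfolding append_Cons by (rule skew_elem_telescope)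
qed

text \<open>One permuted word is sorted into the other letter by letter: the first letter of
  \<open>u\<close> is located in \<open>w\<close> and moved to the front. The prefix
  \<open>p\<close> grows during the induction.\<close>

lemma permuted_words_small:
  assumes g: "g \<in> carrier G" and "mset u = mset w"
  shows "skew_elem (word (p @ u) - word (p @ w)) g \<in> small (length p + length u)"
  using assms(2)
proof (induction u arbitrary: w p)
  case Nil
  then show ?case by (simp add: small_zero flip: zero_fun_def)
next
  case (Cons x u)
  then have "x \<in> set w" by (metis list.set_intros(1) mset_eq_setD)
  then obtain w1 w2 where w: "w = w1 @ x # w2" by (meson split_list)
  then have "mset u = mset (w1 @ w2)" using Cons.prems by simp
  then have len: "length u = length w1 + length w2" by (metis length_append mset_eq_length)
  have "skew_elem (word (p @ x # u) - word (p @ x # w1 @ w2)) g \<in> small (length p + length (x # u))"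
    using Cons.IH[of "w1 @ w2" "p @ [x]"] \<open>mset u = _\<close> by simp
  moreover have "skew_elem (word (p @ x # w1 @ w2) - word (p @ w1 @ x # w2)) g
      \<in> small (length p + length (x # u))"
    using move_small[OF g, of p x w1 w2] len by (simp add: ac_simps)
  ultimately show ?case unfolding w by (rule skew_elem_telescope)
qed

text \<open>A linear section \<open>sec\<close> of the projection picks one word for each
  commutative monomial. It sends \<open>sym_proj p = 0\<close> to 0, so subtracting it changes
  nothing and exhibits \<open>p\<close> as a combination of differences of words with the same
  letters.\<close>

lemma sym_proj_kernel_small:
  assumes g: "g \<in> carrier G" and len: "\<And>w. w \<in> Poly_Mapping.keys p \<Longrightarrow> length w = k"
    and p: "sym_proj p = 0"
  shows "skew_elem p g \<in> small k"
proof -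
  define sec where "sec = lext (\<lambda>e. word (SOME w :: 'n list. letter_exp w = e))"
  let ?c = "\<lambda>w. word (SOME w'. letter_exp w' = letter_exp w) :: 'n tens"
  have "p = p - sec (sym_proj p)" using p by (simp add: sec_def)
  also have "\<dots> = (\<Sum>w\<in>Poly_Mapping.keys p. scal (Poly_Mapping.lookup p w) * (word w - ?c w))"
  proof -
    have "sec (sym_proj p) = lext ?c p" by (simp add: sec_def sym_proj_def lext_comp)
    then show ?thesis
      using lext_ident[of p] by (simp add: lext_def right_diff_distrib sum_subtractf)
  qed
  finally have e: "p = (\<Sum>w\<in>Poly_Mapping.keys p. scal (Poly_Mapping.lookup p w) * (word w - ?c w))" .
  have "skew_elem p g =
      (\<Sum>w\<in>Poly_Mapping.keys p. skew_elem (scal (Poly_Mapping.lookup p w) * (word w - ?c w)) g)"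
    using arg_cong[OF e, of "\<lambda>p. skew_elem p g"] by (simp only: skew_elem_sum)
  also have "\<dots> \<in> small k"
  proof (rule small_sum)
    fix w assume w: "w \<in> Poly_Mapping.keys p"
    have "letter_exp (SOME w'. letter_exp w' = letter_exp w) = letter_exp w"
      by (rule someI[of "\<lambda>w'. letter_exp w' = letter_exp w"]) simp
    then have "skew_elem (word w - ?c w) g \<in> small k"
      using permuted_words_small[OF g, of w _ "[]"] len[OF w] by (simp add: letter_exp_eq_iff)
    then have "Poly_Mapping.lookup p w \<odot>\<^bsub>T.S\<^esub> skew_elem (word w - ?c w) g \<in> small k"
      by (rule small_smult)
    moreover have "c \<odot>\<^bsub>T.S\<^esub> skew_elem r g = skew_elem (scal c * r) g" for c r
      by (auto simp: T.smult_S skew_elem_def fun_eq_iff)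
    ultimately show "skew_elem (scal (Poly_Mapping.lookup p w) * (word w - ?c w)) g \<in> small k"
      by simp
  qed simp
  finally show ?thesis .
qed

text \<open>The easy inclusion: gr A is always a quotient of S(V)#G, because the leading terms of
  the relations are commutators.\<close>

lemma proj_kernel:
  assumes \<phi>: "\<phi> \<in> carrier T.S" and 0: "proj \<phi> = 0"
  shows "gr_map \<phi> = gr_map 0"
proof -
  have "tpart k \<phi> \<in> small k" for k
  proof -
    have "sym_proj (deg_part k (\<phi> g)) = 0" for g
      using fun_cong[OF 0, of g]
      by (intro poly_mapping_eqI) (simp add: proj_def lookup_sym_proj_deg_part)
    then have "(\<Sum>g\<in>carrier G. skew_elem (tpart k \<phi> g) g) \<in> small k"
      by (intro small_sum sym_proj_kernel_small) (auto simp: finite_carrier tpart_def keys_deg_part)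
    then show ?thesis using T.skew_decomp[OF tpart_closed[OF \<phi>, of k]] by metis
  qed
  then have "\<forall>k. \<exists>i\<in>I. \<exists>t\<in>lower k. tpart k \<phi> = i + t"
    unfolding small_def by blast
  then show ?thesis
    using \<phi> by (simp add: gr_map_eq_iff T.zero_closed)
qed

text \<open>With the assumed inclusion and \<open>proj_kernel\<close>, the surjective homomorphisms
  \<open>gr_map\<close> and \<open>proj\<close> on T(V)#G have the same kernel, so their targets are
  identified, compatibly with the grading.\<close>

lemma graded_hecke_if_kernel:
  assumes ker: "\<And>\<phi>. \<phi> \<in> carrier T.S \<Longrightarrow> gr_map \<phi> = gr_map 0 \<Longrightarrow> proj \<phi> = 0"
  shows "is_graded_hecke G \<rho> a"
proof -
  have eq: "gr_map \<phi> = gr_map \<psi> \<longleftrightarrow> proj \<phi> = proj \<psi>" if "\<phi> \<in> carrier T.S" "\<psi> \<in> carrier T.S" for \<phi> \<psi>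
  proof -
    have d: "\<phi> - \<psi> \<in> carrier T.S" using that T.diff_closed by blast
    have "gr_map \<phi> = gr_map \<psi> \<longleftrightarrow> gr_map (\<phi> - \<psi>) = gr_map 0"
      using that d by (simp add: gr_map_eq_iff T.zero_closed)
    also have "\<dots> \<longleftrightarrow> proj (\<phi> - \<psi>) = 0" using ker[OF d] proj_kernel[OF d] by blast
    also have "\<dots> \<longleftrightarrow> proj \<phi> = proj \<psi>" by (simp add: proj_diff)
    finally show ?thesis .
  qed
  \<comment> \<open>Lift along \<open>gr_map\<close> and project; by \<open>eq\<close> the result
    does not depend on the lift.\<close>
  define \<theta> where "\<theta> X = proj (SOME \<phi>. \<phi> \<in> carrier T.S \<and> gr_map \<phi> = X)" for X
  have \<theta>: "\<theta> (gr_map \<phi>) = proj \<phi>" if "\<phi> \<in> carrier T.S" for \<phi>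
  proof -
    let ?\<psi> = "SOME \<psi>. \<psi> \<in> carrier T.S \<and> gr_map \<psi> = gr_map \<phi>"
    have "\<exists>\<psi>. \<psi> \<in> carrier T.S \<and> gr_map \<psi> = gr_map \<phi>" using that by blast
    then have "?\<psi> \<in> carrier T.S \<and> gr_map ?\<psi> = gr_map \<phi>" by (rule someI_ex)
    then have "proj ?\<psi> = proj \<phi>" using eq[of ?\<psi> \<phi>] that by simp
    then show ?thesis by (simp only: \<theta>_def)
  qed
  have rep: "\<exists>\<phi>\<in>carrier T.S. X = gr_map \<phi>" if "X \<in> carrier gr" for X
    using gr_map_surj[OF that] by blast
  have Y: "sym_skew G \<rho> = Y.S" by (simp add: sym_skew_def)
  have "\<theta> \<in> ring_hom gr Y.S"
  proof (rule ring_hom_memI)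
    fix X assume X: "X \<in> carrier gr"
    then obtain \<phi> where \<phi>: "\<phi> \<in> carrier T.S" "X = gr_map \<phi>" using rep by blast
    then show "\<theta> X \<in> carrier Y.S" by (simp add: \<theta> proj_closed)
    fix Z assume "Z \<in> carrier gr"
    then obtain \<psi> where \<psi>: "\<psi> \<in> carrier T.S" "Z = gr_map \<psi>" using rep by blast
    show "\<theta> (X \<otimes>\<^bsub>gr\<^esub> Z) = \<theta> X \<otimes>\<^bsub>Y.S\<^esub> \<theta> Z"
      using \<phi> \<psi> by (simp add: gr_map_mult \<theta> proj_mult T.mult_closed)
    show "\<theta> (X \<oplus>\<^bsub>gr\<^esub> Z) = \<theta> X \<oplus>\<^bsub>Y.S\<^esub> \<theta> Z"
      using \<phi> \<psi> by (simp only: gr_map_add \<theta> proj_add T.add_closed Y.add_S)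
  next
    show "\<theta> \<one>\<^bsub>gr\<^esub> = \<one>\<^bsub>Y.S\<^esub>"
      by (simp add: gr_map_one \<theta> T.skew_elem_closed proj_one Y.one_S)
  qed
  moreover have "bij_betw \<theta> (carrier gr) (carrier Y.S)"
  proof (rule bij_betwI')
    fix X Z assume "X \<in> carrier gr" "Z \<in> carrier gr"
    then obtain \<phi> \<psi> where "\<phi> \<in> carrier T.S" "X = gr_map \<phi>" "\<psi> \<in> carrier T.S" "Z = gr_map \<psi>"
      using rep by metis
    then show "\<theta> X = \<theta> Z \<longleftrightarrow> X = Z" using eq by (simp add: \<theta>)
  next
    fix X assume "X \<in> carrier gr"
    then obtain \<phi> where "\<phi> \<in> carrier T.S" "X = gr_map \<phi>" using rep by blast
    then show "\<theta> X \<in> carrier Y.S" by (simp add: \<theta> proj_closed)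
  next
    fix \<psi> assume "\<psi> \<in> carrier Y.S"
    then obtain \<phi> where "\<phi> \<in> carrier T.S" "proj \<phi> = \<psi>" using proj_surj by blast
    then show "\<exists>X\<in>carrier gr. \<psi> = \<theta> X" using gr_map_closed \<theta> by metis
  qed
  ultimately have "\<theta> \<in> ring_iso gr Y.S" by (simp add: ring_iso_def)
  moreover have "\<theta> (c \<odot>\<^bsub>gr\<^esub> X) = c \<odot>\<^bsub>Y.S\<^esub> \<theta> X" if X: "X \<in> carrier gr" for c X
  proof -
    obtain \<phi> where "\<phi> \<in> carrier T.S" "X = gr_map \<phi>" using rep X by blast
    then show ?thesis by (simp add: gr_map_smult \<theta> proj_smult T.smult_closed)
  qed
  moreover have "\<theta> ` graded_component A F k = sym_skew_component G k" for k
    unfolding gr_map_component[symmetric] proj_component[symmetric] image_image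
    by (intro image_cong refl \<theta>) (simp add: tens_component_def)
  ultimately show ?thesis
    unfolding is_graded_hecke_def graded_isomorphic_def Y by blast
qed

end

section \<open>Sufficiency: the ideal adds nothing to the leading terms\<close>

sublocale pbw_forms \<subseteq> hecke_forms ..

context pbw_forms begin

definition skew_functional :: "('b list \<Rightarrow> 'a \<Rightarrow> complex) \<Rightarrow> ('a \<Rightarrow> 'b tens) \<Rightarrow> complex" where
  "skew_functional \<Lambda> \<phi> = (\<Sum>g\<in>carrier G. lfun (\<lambda>w. \<Lambda> w g) (\<phi> g))"

lemma skew_functional_add: "skew_functional \<Lambda> (\<phi> + \<psi>) = skew_functional \<Lambda> \<phi> + skew_functional \<Lambda> \<psi>"
  by (simp add: skew_functional_def lfun_add sum.distrib)

lemma skew_functional_0 [simp]: "skew_functional \<Lambda> 0 = 0"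
  by (simp add: skew_functional_def)

lemma skew_functional_diff: "skew_functional \<Lambda> (\<phi> - \<psi>) = skew_functional \<Lambda> \<phi> - skew_functional \<Lambda> \<psi>"
  by (simp add: skew_functional_def lfun_diff sum_subtractf)

lemma skew_functional_sum: "skew_functional \<Lambda> (sum f X) = (\<Sum>x\<in>X. skew_functional \<Lambda> (f x))"
  using sum_comp_morphism[of "skew_functional \<Lambda>" f X] by (simp add: skew_functional_add o_def)

lemma skew_functional_elem: "g \<in> carrier G \<Longrightarrow> skew_functional \<Lambda> (skew_elem p g) = lfun (\<lambda>w. \<Lambda> w g) p"
proof -
  assume g: "g \<in> carrier G"
  have "skew_functional \<Lambda> (skew_elem p g) =
      (\<Sum>h\<in>carrier G. if h = g then lfun (\<lambda>w. \<Lambda> w h) p else 0)"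
    unfolding skew_functional_def by (intro sum.cong) (auto simp: skew_elem_def)
  then show ?thesis using g finite_carrier by simp
qed

text \<open>Moving \<open>g\<close> to the right turns the commutator of \<open>v\<close>,
  \<open>w\<close> into that of their images under \<open>g\<close>, while the group part keeps the
  values at \<open>v\<close>, \<open>w\<close> but changes its index. Reindexing by conjugation and
  \<open>a_conj\<close> match the two, and the functional cannot tell them apart.\<close>

lemma skew_functional_rel_elem:
  assumes kill: "\<And>N. kills_relations N \<Lambda>" and g: "g \<in> carrier G" and h: "h \<in> carrier G"
  shows "skew_functional \<Lambda> (skew_elem p g \<star> rel v w \<star> skew_elem r h) = 0"
proof -
  let ?v = "tens_vec v" and ?w = "tens_vec w" and ?gv = "\<rho> g *v v" and ?gw = "\<rho> g *v w"
  let ?F = "\<lambda>l. a l ?gv ?gw * lfun (\<lambda>u. \<Lambda> u (l \<otimes> (g \<otimes> h))) (p * tens_act (\<rho> l) (tens_act (\<rho> g) r))"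
  have fin: "finite ((\<lambda>(u, w). length u + 2 + length w) `
      (Poly_Mapping.keys p \<times> Poly_Mapping.keys (tens_act (\<rho> g) r)))"
    by simp
  \<comment> \<open>Finitely many words occur, so a single bound on the length serves for all of
    them.\<close>
  obtain N where N: "\<And>n. n \<in> (\<lambda>(u, w). length u + 2 + length w) `
      (Poly_Mapping.keys p \<times> Poly_Mapping.keys (tens_act (\<rho> g) r)) \<Longrightarrow> n \<le> N"
    using fin unfolding finite_nat_set_iff_bounded_le by blast
  have N': "length u + 2 + length w \<le> N"
    if "u \<in> Poly_Mapping.keys p" "w \<in> Poly_Mapping.keys (tens_act (\<rho> g) r)" for u w
    using that by (intro N) force
  have "skew_elem p g \<star> skew_elem (?v * ?w - ?w * ?v) \<one> \<star> skew_elem r h =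
      skew_elem (p * (tens_vec ?gv * tens_vec ?gw - tens_vec ?gw * tens_vec ?gv) * tens_act (\<rho> g) r) (g \<otimes> h)"
    using g h by (simp add: T.skew_elem_mult tens_act_diff tens_act_mult tens_act_tens_vec)
  then have 1: "skew_functional \<Lambda> (skew_elem p g \<star> skew_elem (?v * ?w - ?w * ?v) \<one> \<star> skew_elem r h)
      = (\<Sum>l\<in>carrier G. ?F l)"
    using g h kills_relations_tens[OF kill _ N', of "g \<otimes> h"] by (simp add: skew_functional_elem)
  have "skew_elem p g \<star> (\<Sum>k\<in>carrier G. skew_elem (scal (a k v w)) k) \<star> skew_elem r h =
      (\<Sum>k\<in>carrier G. skew_elem (scal (a k v w) * (p * tens_act (\<rho> (g \<otimes> k)) r)) (g \<otimes> k \<otimes> h))"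
    unfolding T.mult_sum_left T.mult_sum_right
    using g h by (intro sum.cong refl) (simp add: T.skew_elem_mult scal_comm[of p] mult.assoc)
  then have "skew_functional \<Lambda> (skew_elem p g \<star> (\<Sum>k\<in>carrier G. skew_elem (scal (a k v w)) k) \<star> skew_elem r h)
      = (\<Sum>k\<in>carrier G. a k v w * lfun (\<lambda>u. \<Lambda> u (g \<otimes> k \<otimes> h)) (p * tens_act (\<rho> (g \<otimes> k)) r))"
    using g h by (simp add: skew_functional_sum skew_functional_elem lfun_scal)
  also have "\<dots> = (\<Sum>k\<in>carrier G. ?F (g \<otimes> k \<otimes> inv g))"
  proof (intro sum.cong refl)
    fix k assume k: "k \<in> carrier G"
    have "\<rho> (g \<otimes> k \<otimes> inv g) ** \<rho> g = \<rho> (g \<otimes> k)"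
      using g k by (simp add: m_assoc flip: rho_mult)
    then have "tens_act (\<rho> (g \<otimes> k \<otimes> inv g)) (tens_act (\<rho> g) r) = tens_act (\<rho> (g \<otimes> k)) r"
      by (simp flip: tens_act_comp)
    moreover have "g \<otimes> k \<otimes> inv g \<otimes> (g \<otimes> h) = g \<otimes> k \<otimes> h"
      using g h k by (simp add: m_assoc)
    ultimately show "a k v w * lfun (\<lambda>u. \<Lambda> u (g \<otimes> k \<otimes> h)) (p * tens_act (\<rho> (g \<otimes> k)) r) = ?F (g \<otimes> k \<otimes> inv g)"
      using a_conj[OF g k] by (simp only:)
  qed
  also have "\<dots> = (\<Sum>l\<in>carrier G. ?F l)"
    by (rule sum.reindex_bij_betw[OF bij_betw_conj[OF g]])
  finally have 2: "skew_functional \<Lambda> (skew_elem p g \<star> (\<Sum>k\<in>carrier G. skew_elem (scal (a k v w)) k)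
      \<star> skew_elem r h) = (\<Sum>l\<in>carrier G. ?F l)" .
  show ?thesis
    unfolding rel_def T.mult_diff_left T.mult_diff_right skew_functional_diff 1 2 by simp
qed

lemma skew_functional_rel:
  assumes kill: "\<And>N. kills_relations N \<Lambda>" and \<alpha>: "\<alpha> \<in> carrier T.S" and \<beta>: "\<beta> \<in> carrier T.S"
  shows "skew_functional \<Lambda> (\<alpha> \<star> rel v w \<star> \<beta>) = 0"
proof (rule T.skew_induct[OF \<alpha>, where P = "\<lambda>\<alpha>. skew_functional \<Lambda> (\<alpha> \<star> rel v w \<star> \<beta>) = 0"])
  fix p g assume g: "g \<in> carrier G"
  show "skew_functional \<Lambda> (skew_elem p g \<star> rel v w \<star> \<beta>) = 0"
    by (rule T.skew_induct[OF \<beta>, where P = "\<lambda>\<beta>. skew_functional \<Lambda> (skew_elem p g \<star> rel v w \<star> \<beta>) = 0"])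
      (simp_all add: skew_functional_rel_elem[OF kill g] T.mult_add_right skew_functional_add)
qed (simp_all add: T.mult_add_left skew_functional_add)

lemma skew_functional_ideal:
  assumes kill: "\<And>N. kills_relations N \<Lambda>" and "x \<in> I"
  shows "skew_functional \<Lambda> x = 0"
proof -
  interpret R: ring T.S by (rule T.ring_S)
  \<comment> \<open>The largest two-sided ideal inside the kernel of the functional. The kernel
    itself is only a subspace, so minimality of the generated ideal has to be applied to
    \<open>J\<close>; multiplying by the unit on both sides returns to the functional.\<close>
  define J where "J = {x \<in> carrier T.S. \<forall>\<alpha>\<in>carrier T.S. \<forall>\<beta>\<in>carrier T.S.
    skew_functional \<Lambda> (\<alpha> \<star> x \<star> \<beta>) = 0}"
  have "ideal J T.S"
  proof (rule idealI[OF T.ring_S])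
    show "subgroup J (add_monoid T.S)"
    proof
      show "J \<subseteq> carrier (add_monoid T.S)" by (auto simp: J_def)
      show "x \<otimes>\<^bsub>add_monoid T.S\<^esub> y \<in> J" if "x \<in> J" "y \<in> J" for x y
        using that by (auto simp: J_def T.add_closed T.mult_add_left T.mult_add_right skew_functional_add)
      show "\<one>\<^bsub>add_monoid T.S\<^esub> \<in> J" by (simp add: J_def T.zero_closed)
      show "inv\<^bsub>add_monoid T.S\<^esub> x \<in> J" if "x \<in> J" for x
      proof -
        have x: "x \<in> carrier T.S" using that by (simp add: J_def)
        have "skew_functional \<Lambda> (\<alpha> \<star> (0 - x) \<star> \<beta>) = 0"
          if "\<alpha> \<in> carrier T.S" "\<beta> \<in> carrier T.S" for \<alpha> \<beta>
          unfolding T.mult_diff_left T.mult_diff_right skew_functional_diff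
          using that \<open>x \<in> J\<close> by (simp add: J_def)
        then have "- x \<in> J" using x by (simp add: J_def T.uminus_closed)
        moreover have "inv\<^bsub>add_monoid T.S\<^esub> x = - x" using T.uminus_S[OF x] by (simp add: a_inv_def)
        ultimately show ?thesis by simp
      qed
    qed
    show "y \<star> x \<in> J" if "x \<in> J" "y \<in> carrier T.S" for x y
      using that by (auto simp: J_def T.mult_closed simp flip: R.m_assoc)
    show "x \<star> y \<in> J" if "x \<in> J" "y \<in> carrier T.S" for x y
    proof -
      have "\<alpha> \<star> (x \<star> y) \<star> \<beta> = \<alpha> \<star> x \<star> (y \<star> \<beta>)"
        if "\<alpha> \<in> carrier T.S" "\<beta> \<in> carrier T.S" for \<alpha> \<beta>
        using that \<open>x \<in> J\<close> \<open>y \<in> carrier T.S\<close> by (simp add: J_def R.m_assoc)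
      then show ?thesis using that by (simp add: J_def T.mult_closed)
    qed
  qed
  moreover have "{rel v w | v w. True} \<subseteq> J"
    using skew_functional_rel[OF kill] rel_closed by (auto simp: J_def)
  ultimately have "I \<subseteq> J" unfolding I_eq by (rule R.genideal_minimal)
  then have "x \<in> J" using assms(2) by blast
  then have "skew_functional \<Lambda> (skew_elem 1 \<one> \<star> x \<star> skew_elem 1 \<one>) = 0"
    by (simp add: J_def T.skew_elem_closed)
  moreover have "x \<in> carrier T.S" using assms(2) by (rule I_closed)
  ultimately show ?thesis by (simp add: T.one_mult T.mult_one)
qed

text \<open>The functional dual to \<open>e\<close> at \<open>h\<close>, applied to the part of
  degree \<open>mono_deg e\<close>, gives the coefficient of the projection there. That part lies in
  \<open>I + lower (mono_deg e)\<close>, and the functional vanishes on both summands.\<close>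

lemma gr_map_kernel:
  assumes \<phi>: "\<phi> \<in> carrier T.S" and 0: "gr_map \<phi> = gr_map 0"
  shows "proj \<phi> = 0"
proof
  fix h
  show "proj \<phi> h = 0 h"
  proof (cases "h \<in> carrier G")
    case False
    then show ?thesis using \<phi> by (simp add: proj_def T.carrier_S)
  next
    case h: True
    have "Poly_Mapping.lookup (sym_proj (\<phi> h)) e = 0" for e
    proof -
      obtain \<Lambda> where \<Lambda>: "\<And>N. kills_relations N \<Lambda>" "\<And>w g. length w \<le> mono_deg e \<Longrightarrow>
          \<Lambda> w g = (if letter_exp w = e \<and> g = h then 1 else 0)"
        using ex_pbw_functional[of e h] by metis
      have "\<forall>k. \<exists>i\<in>I. \<exists>t\<in>lower k. tpart k (\<phi> - 0) = i + t"
        using 0 gr_map_eq_iff[OF \<phi> T.zero_closed] by blast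
      then obtain i t where it: "i \<in> I" "t \<in> lower (mono_deg e)" "tpart (mono_deg e) \<phi> = i + t"
        by (metis diff_zero)
      have "skew_functional \<Lambda> t = (\<Sum>g\<in>carrier G. 0)"
        unfolding skew_functional_def
      proof (intro sum.cong refl)
        fix g
        have "\<Lambda> w g = 0" if "w \<in> Poly_Mapping.keys (t g)" for w
        proof -
          have "length w < mono_deg e" using it(2) that by (auto simp: lower_def)
          then show ?thesis using \<Lambda>(2)[of w g] mono_deg_letter_exp[of w] by auto
        qed
        then show "lfun (\<lambda>w. \<Lambda> w g) (t g) = 0" by (simp add: lfun_def)
      qed
      then have "skew_functional \<Lambda> (tpart (mono_deg e) \<phi>) = 0"
        unfolding it(3) skew_functional_add using skew_functional_ideal[OF \<Lambda>(1) it(1)] by simp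
      moreover have "skew_functional \<Lambda> (tpart (mono_deg e) \<phi>) =
          (\<Sum>g\<in>carrier G. if g = h then Poly_Mapping.lookup (sym_proj (\<phi> h)) e else 0)"
        unfolding skew_functional_def
      proof (intro sum.cong refl)
        fix g
        have "lfun (\<lambda>w. \<Lambda> w g) (deg_part (mono_deg e) (\<phi> g)) =
            lfun (\<lambda>w. if letter_exp w = e \<and> g = h then 1 else 0) (deg_part (mono_deg e) (\<phi> g))"
          by (intro lfun_cong \<Lambda>(2)) (simp add: keys_deg_part)
        also have "\<dots> = (if g = h then Poly_Mapping.lookup (sym_proj (deg_part (mono_deg e) (\<phi> g))) e else 0)"
          by (auto simp: sym_proj_def lookup_lext lookup_single when_def lfun_def)
        finally show "lfun (\<lambda>w. \<Lambda> w g) (tpart (mono_deg e) \<phi> g) =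
            (if g = h then Poly_Mapping.lookup (sym_proj (\<phi> h)) e else 0)"
          by (simp add: tpart_def lookup_sym_proj_deg_part)
      qed
      ultimately show ?thesis using h finite_carrier by simp
    qed
    then show ?thesis by (simp add: proj_def poly_mapping_eqI)
  qed
qed

end

section \<open>Necessity: consequences of the relations in degrees 0 and 1\<close>

lemma tens_vec_eq_0_iff [simp]: "tens_vec v = 0 \<longleftrightarrow> v = 0"
proof
  assume 0: "tens_vec v = 0"
  have "Poly_Mapping.lookup (tens_vec v) [i] = v $ i" for i
    by (simp add: tens_vec_def lookup_sum lookup_single when_def)
  then show "v = 0" using 0 by (simp add: vec_eq_iff)
qed simp

text \<open>A word with at most one letter has no other arrangement, so in these degrees words and
  commutative monomials correspond.\<close>

lemma letter_exp_inj_short: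
  assumes "length u = k" "length w = k" "k \<le> 1" "letter_exp u = letter_exp w"
  shows "u = w"
proof -
  have "mset u = mset w" using assms(4) by (simp add: letter_exp_eq_iff)
  then show ?thesis
    using assms(1-3) by (cases u; cases w; auto)
qed

context hecke_forms begin

lemma lookup_tens_component:
  assumes "\<phi> \<in> tens_component k" and "g \<notin> carrier G \<or> length w \<noteq> k"
  shows "Poly_Mapping.lookup (\<phi> g) w = 0"
  using assms(2)
proof
  assume "length w \<noteq> k"
  then have "Poly_Mapping.lookup (tpart k \<phi> g) w = 0" by (simp add: tpart_def lookup_deg_part)
  then show ?thesis using assms(1) by (simp add: tens_component_def)
qed (use assms(1) in \<open>simp add: tens_component_def T.carrier_S\<close>)

text \<open>For words of length at most 1 the projection to the symmetric algebra is injective, so that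
  both degree components have the same finite dimension; a surjection between them is injective.\<close>

lemma kernel_short:
  assumes hecke: "is_graded_hecke G \<rho> a" and k: "k \<le> 1"
    and \<phi>: "\<phi> \<in> tens_component k" and 0: "gr_map \<phi> = gr_map 0"
  shows "\<phi> = 0"
proof (rule ccontr)
  assume "\<phi> \<noteq> 0"
  have Y: "sym_skew G \<rho> = Y.S" by (simp add: sym_skew_def)
  obtain \<theta> where \<theta>: "\<theta> \<in> ring_iso gr Y.S" "\<And>c X. X \<in> carrier gr \<Longrightarrow> \<theta> (c \<odot>\<^bsub>gr\<^esub> X) = c \<odot>\<^bsub>Y.S\<^esub> \<theta> X"
    "\<And>k. \<theta> ` graded_component A F k = sym_skew_component G k"
    using hecke unfolding is_graded_hecke_def graded_isomorphic_def Y by blast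
  \<comment> \<open>Nothing is known about the values of the given isomorphism
    \<open>\<theta>\<close>; only its linearity and the images of the graded components are
    used.\<close>
  define \<tau> where "\<tau> x = \<theta> (gr_map x)" for x
  have \<tau>_add: "\<tau> (x + y) = \<tau> x + \<tau> y" if "x \<in> carrier T.S" "y \<in> carrier T.S" for x y
  proof -
    have "\<tau> (x + y) = \<theta> (gr_map x \<oplus>\<^bsub>gr\<^esub> gr_map y)" using that by (simp only: \<tau>_def gr_map_add)
    also have "\<dots> = \<tau> x \<oplus>\<^bsub>Y.S\<^esub> \<tau> y"
      using that \<theta>(1) gr_map_closed by (simp only: \<tau>_def ring_iso_memE(3))
    finally show ?thesis by (simp only: Y.add_S)
  qed
  have \<tau>_smult: "\<tau> (c \<odot>\<^bsub>T.S\<^esub> x) = c \<odot>\<^bsub>Y.S\<^esub> \<tau> x" if "x \<in> carrier T.S" for c x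
    using \<theta>(2)[OF gr_map_closed[OF that]] that by (simp only: \<tau>_def gr_map_smult[symmetric])
  have \<tau>_0: "\<tau> 0 = 0"
    using \<tau>_add[OF T.zero_closed T.zero_closed] by simp
  have \<tau>_sum: "\<tau> (sum f X) = (\<Sum>x\<in>X. \<tau> (f x))" if "finite X" "\<And>x. x \<in> X \<Longrightarrow> f x \<in> carrier T.S"
    for f and X :: "('n list \<times> 'a) set"
    using that
  proof (induction X rule: finite_induct)
    case empty
    show ?case by (simp only: sum.empty \<tau>_0)
  next
    case (insert x X)
    then have "\<tau> (f x + sum f X) = \<tau> (f x) + (\<Sum>x\<in>X. \<tau> (f x))"
      by (subst \<tau>_add) (auto intro!: T.sum_closed)
    then show ?case by (simp only: sum.insert[OF insert(1,2)])
  qed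
  \<comment> \<open>\<open>J\<close> indexes a basis \<open>b\<close> of the degree \<open>k\<close>
    component of T(V)#G and, by \<open>letter_exp_inj_short\<close>, independent elements
    \<open>c\<close> of that of S(V)#G.\<close>
  define J where "J = {w :: 'n list. length w = k} \<times> carrier G"
  define b :: "'n list \<times> 'a \<Rightarrow> 'a \<Rightarrow> 'n tens" where "b j = skew_elem (word (fst j)) (snd j)" for j
  define c :: "'n list \<times> 'a \<Rightarrow> 'a \<Rightarrow> 'n spoly"
    where "c j = skew_elem (Poly_Mapping.single (letter_exp (fst j)) 1) (snd j)" for j
  have finJ: "finite J"
    using finite_carrier finite_lists_length_eq[of "UNIV :: 'n set" k] by (simp add: J_def)
  have b_closed: "b j \<in> carrier T.S" if "j \<in> J" for j
    using that by (auto simp: b_def J_def intro!: T.skew_elem_closed)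
  have coord: "\<psi> = (\<Sum>j\<in>J. Poly_Mapping.lookup (\<psi> (snd j)) (fst j) \<odot>\<^bsub>T.S\<^esub> b j)"
    if "\<psi> \<in> tens_component k" for \<psi>
  proof (rule ext, rule poly_mapping_eqI)
    fix g w
    have "Poly_Mapping.lookup ((\<Sum>j\<in>J. Poly_Mapping.lookup (\<psi> (snd j)) (fst j) \<odot>\<^bsub>T.S\<^esub> b j) g) w =
        (\<Sum>j\<in>J. if j = (w, g) then Poly_Mapping.lookup (\<psi> g) w else 0)"
      unfolding sum_fun_apply lookup_sum
      by (intro sum.cong refl)
        (auto simp: T.smult_S b_def skew_elem_def lookup_single when_def split: if_splits)
    also have "\<dots> = Poly_Mapping.lookup (\<psi> g) w"
    proof (cases "(w, g) \<in> J")
      case False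
      then have "g \<notin> carrier G \<or> length w \<noteq> k" by (auto simp: J_def)
      then have "Poly_Mapping.lookup (\<psi> g) w = 0" using lookup_tens_component[OF that] by blast
      then show ?thesis using False finJ by simp
    qed (use finJ in simp)
    finally show "Poly_Mapping.lookup (\<psi> g) w =
      Poly_Mapping.lookup ((\<Sum>j\<in>J. Poly_Mapping.lookup (\<psi> (snd j)) (fst j) \<odot>\<^bsub>T.S\<^esub> b j) g) w" ..
  qed
  interpret V: vector_space "\<lambda>d (\<psi> :: 'a \<Rightarrow> 'n spoly). d \<odot>\<^bsub>Y.S\<^esub> \<psi>"
    by unfold_locales
      (simp_all add: Y.smult_S fun_eq_iff distrib_left distrib_right scal_add scal_mult_assoc)
  have \<tau>_coord: "\<tau> \<psi> = (\<Sum>j\<in>J. Poly_Mapping.lookup (\<psi> (snd j)) (fst j) \<odot>\<^bsub>Y.S\<^esub> \<tau> (b j))"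
    if "\<psi> \<in> tens_component k" for \<psi>
  proof -
    have "\<tau> \<psi> = \<tau> (\<Sum>j\<in>J. Poly_Mapping.lookup (\<psi> (snd j)) (fst j) \<odot>\<^bsub>T.S\<^esub> b j)"
      using coord[OF that] by (rule arg_cong)
    also have "\<dots> = (\<Sum>j\<in>J. \<tau> (Poly_Mapping.lookup (\<psi> (snd j)) (fst j) \<odot>\<^bsub>T.S\<^esub> b j))"
      by (intro \<tau>_sum finJ T.smult_closed b_closed)
    finally show ?thesis by (simp only: \<tau>_smult b_closed cong: sum.cong)
  qed
  obtain g w where nz: "Poly_Mapping.lookup (\<phi> g) w \<noteq> 0"
    using \<open>\<phi> \<noteq> 0\<close> by (metis ext lookup_zero poly_mapping_eqI zero_fun_apply)
  define j0 where "j0 = (w, g)"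
  have j0: "j0 \<in> J"
  proof (rule ccontr)
    assume "j0 \<notin> J"
    then have "g \<notin> carrier G \<or> length w \<noteq> k" by (auto simp: J_def j0_def)
    then show False using lookup_tens_component[OF \<phi>] nz by blast
  qed
  \<comment> \<open>A nonzero coefficient of \<open>\<phi>\<close> at \<open>j0\<close> makes the
    image of \<open>b j0\<close> redundant. The remaining images, fewer than \<open>J\<close> has
    elements, would span a space containing the independent family \<open>c\<close>.\<close>
  let ?B = "(\<lambda>j. \<tau> (b j)) ` (J - {j0})"
  have "\<tau> (b j0) \<in> V.span ?B"
  proof -
    let ?l = "\<lambda>j. Poly_Mapping.lookup (\<phi> (snd j)) (fst j)"
    have "\<tau> \<phi> = 0" using 0 \<tau>_0 by (simp only: \<tau>_def)
    then have "(\<Sum>j\<in>J. ?l j \<odot>\<^bsub>Y.S\<^esub> \<tau> (b j)) = 0" by (simp only: \<tau>_coord[OF \<phi>])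
    then have "?l j0 \<odot>\<^bsub>Y.S\<^esub> \<tau> (b j0) + (\<Sum>j\<in>J - {j0}. ?l j \<odot>\<^bsub>Y.S\<^esub> \<tau> (b j)) = 0"
      by (simp only: sum.remove[OF finJ j0])
    then have "?l j0 \<odot>\<^bsub>Y.S\<^esub> \<tau> (b j0) = - (\<Sum>j\<in>J - {j0}. ?l j \<odot>\<^bsub>Y.S\<^esub> \<tau> (b j))"
      by (rule eq_neg_iff_add_eq_0[THEN iffD2])
    moreover have "- (\<Sum>j\<in>J - {j0}. ?l j \<odot>\<^bsub>Y.S\<^esub> \<tau> (b j)) \<in> V.span ?B"
      by (intro V.span_neg V.span_sum V.span_scale V.span_base) blast
    ultimately have "?l j0 \<odot>\<^bsub>Y.S\<^esub> \<tau> (b j0) \<in> V.span ?B" by (simp only:)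
    from V.span_scale[OF this, of "inverse (?l j0)"] show ?thesis
      using nz by (simp add: j0_def)
  qed
  then have "\<tau> (b j) \<in> V.span ?B" if "j \<in> J" for j
    using that by (cases "j = j0") (auto intro: V.span_base)
  then have span: "\<tau> \<psi> \<in> V.span ?B" if "\<psi> \<in> tens_component k" for \<psi>
    using \<tau>_coord[OF that] by (auto intro!: V.span_sum V.span_scale)
  have "sym_skew_component G k = \<tau> ` tens_component k"
    using \<theta>(3)[of k] by (simp add: gr_map_component[symmetric] \<tau>_def image_image)
  then have sub: "sym_skew_component G k \<subseteq> V.span ?B"
    by (simp only: image_subset_iff) (rule ballI, rule span)
  have c_coord: "Poly_Mapping.lookup ((\<Sum>j\<in>J. f j \<odot>\<^bsub>Y.S\<^esub> c j) g) (letter_exp w) = f (w, g)"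
    if "(w, g) \<in> J" for f w g
  proof -
    have "Poly_Mapping.lookup ((\<Sum>j\<in>J. f j \<odot>\<^bsub>Y.S\<^esub> c j) g) (letter_exp w) =
        (\<Sum>j\<in>J. if j = (w, g) then f (w, g) else 0)"
      unfolding sum_fun_apply lookup_sum
    proof (intro sum.cong refl)
      fix j assume j: "j \<in> J"
      have "length (fst j) = k" "length w = k" using j that by (auto simp: J_def)
      from letter_exp_inj_short[OF this k] have "letter_exp (fst j) = letter_exp w \<longleftrightarrow> fst j = w"
        by (rule iffI) (simp_all only:)
      then show "Poly_Mapping.lookup ((f j \<odot>\<^bsub>Y.S\<^esub> c j) g) (letter_exp w) = (if j = (w, g) then f (w, g) else 0)"
        by (cases j) (auto simp: Y.smult_S c_def skew_elem_def lookup_single when_def)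
    qed
    then show ?thesis using that finJ by simp
  qed
  have inj: "inj_on c J"
  proof (rule inj_onI)
    fix i j assume ij: "i \<in> J" "j \<in> J" "c i = c j"
    have "Poly_Mapping.lookup (c i (snd i)) (letter_exp (fst i)) = 1" by (simp add: c_def skew_elem_def)
    then have "Poly_Mapping.lookup (c j (snd i)) (letter_exp (fst i)) \<noteq> 0" using ij(3) by simp
    then have "snd i = snd j" "letter_exp (fst j) = letter_exp (fst i)"
      by (auto simp: c_def skew_elem_def lookup_single when_def split: if_splits)
    moreover have "length (fst j) = k" "length (fst i) = k" using ij by (auto simp: J_def)
    ultimately show "i = j" using letter_exp_inj_short[of "fst j" k "fst i"] k by (metis prod_eqI)
  qed
  have "V.independent (c ` J)"
  proof (rule V.independent_if_scalars_zero)
    show "finite (c ` J)" using finJ by simp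
    fix f x assume s: "(\<Sum>x\<in>c ` J. f x \<odot>\<^bsub>Y.S\<^esub> x) = 0" and "x \<in> c ` J"
    then obtain w g where wg: "(w, g) \<in> J" "x = c (w, g)" by auto
    have "(\<Sum>j\<in>J. f (c j) \<odot>\<^bsub>Y.S\<^esub> c j) = 0" using s inj by (simp add: sum.reindex)
    then show "f x = 0" using c_coord[OF wg(1), of "\<lambda>j. f (c j)"] wg(2) by simp
  qed
  moreover have "c ` J \<subseteq> V.span ?B"
  proof -
    have "c j \<in> sym_skew_component G k" if "j \<in> J" for j
      using that by (auto simp: sym_skew_component_def c_def skew_elem_def J_def mono_deg_letter_exp split: if_splits)
    then show ?thesis using sub by blast
  qed
  ultimately have "card (c ` J) \<le> card ?B"
    using V.independent_span_bound[of ?B "c ` J"] finJ by simp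
  also have "\<dots> \<le> card (J - {j0})" using finJ by (intro card_image_le) simp
  also have "\<dots> < card J" using finJ j0 by (rule card_Diff1_less)
  finally show False using inj by (simp add: card_image)
qed

text \<open>The part of degree 1 agrees modulo \<open>I\<close> with an element of degree 0, so its
  class in gr A is zero and \<open>kernel_short\<close> removes it. Then \<open>x\<close> is itself
  homogeneous of degree 0 and the argument repeats.\<close>

lemma ideal_short:
  assumes hecke: "is_graded_hecke G \<rho> a" and x: "x \<in> I" "x \<in> lower 2"
  shows "x = 0"
proof -
  have xc: "x \<in> carrier T.S" using x(1) by (rule I_closed)
  have x1: "x - tpart 1 x \<in> lower 1" using diff_part_lower[of x 1] x(2) by (simp add: numeral_2_eq_2)
  have "gr_map (tpart 1 x) = gr_map 0"
  proof -
    have "tpart j (tpart 1 x - 0) \<in> small j" for j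
    proof (cases "j = 1")
      case True
      have "x + - (x - tpart 1 x) \<in> small 1" by (intro small_intro x(1) lower_uminus x1)
      then show ?thesis using True by (simp add: tpart_tpart)
    next
      case False
      then show ?thesis using small_zero[of j] by (simp add: tpart_tpart)
    qed
    then show ?thesis
      using gr_map_eq_iff[OF tpart_closed[OF xc] T.zero_closed] unfolding small_def by blast
  qed
  moreover have "tpart 1 x \<in> tens_component 1" using xc by (simp add: tens_component_def tpart_closed tpart_tpart)
  ultimately have 1: "tpart 1 x = 0" using kernel_short[OF hecke, of 1] by blast
  then have "x \<in> lower 1" using x1 by simp
  then have "x - tpart 0 x \<in> lower 0" using diff_part_lower[of x 0] by simp
  then have x0: "tpart 0 x = x" by simp
  have "gr_map x = gr_map 0"
  proof -
    have "tpart j (x - 0) \<in> small j" for j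
    proof (cases "j = 0")
      case True
      then show ?thesis using small_I[OF x(1)] x0 by simp
    next
      case False
      then have "tpart j x = 0" using tpart_tpart[of j 0 x] x0 by simp
      then show ?thesis using small_zero[of j] by simp
    qed
    then show ?thesis
      using gr_map_eq_iff[OF xc T.zero_closed] unfolding small_def by blast
  qed
  moreover have "x \<in> tens_component 0" using xc x0 by (simp add: tens_component_def)
  ultimately show ?thesis using kernel_short[OF hecke, of 0] by blast
qed

text \<open>The relation for \<open>v\<close>, \<open>w\<close> conjugated by \<open>h\<close> and
  the relation for their images under \<open>h\<close> have the same commutator part. Their
  difference lies in the ideal and in the group algebra, hence is zero; its coefficient at
  \<open>g\<close> is the claim.\<close>

lemma hecke_equivariant:
  assumes hecke: "is_graded_hecke G \<rho> a"
  shows "equivariant_forms G \<rho> a"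
  unfolding equivariant_forms_def
proof (intro ballI allI)
  fix g h v w assume g: "g \<in> carrier G" and h: "h \<in> carrier G"
  let ?H = "skew_elem 1 h" and ?H' = "skew_elem 1 (inv h)"
  let ?hv = "\<rho> h *v v" and ?hw = "\<rho> h *v w"
  let ?c = "\<lambda>v w. tens_vec v * tens_vec w - tens_vec w * tens_vec v"
  let ?s = "\<lambda>v w. \<Sum>k\<in>carrier G. skew_elem (scal (a k v w) :: 'n tens) k"
  let ?s' = "\<Sum>k\<in>carrier G. skew_elem (scal (a (inv h \<otimes> k \<otimes> h) v w) :: 'n tens) k"
  have "?H \<star> skew_elem (?c v w) \<one> \<star> ?H' = skew_elem (?c ?hv ?hw) \<one>"
    using h by (simp add: T.skew_elem_mult tens_act_diff tens_act_mult tens_act_tens_vec)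
  moreover have "?H \<star> ?s v w \<star> ?H' = ?s'"
  proof -
    have "?H \<star> ?s v w \<star> ?H' =
        (\<Sum>k\<in>carrier G. skew_elem (scal (a k v w)) (h \<otimes> k \<otimes> inv h))"
      unfolding T.mult_sum_left T.mult_sum_right
      using h by (intro sum.cong refl) (simp add: T.skew_elem_mult)
    also have "\<dots> = (\<Sum>k\<in>carrier G. skew_elem (scal (a (inv h \<otimes> (h \<otimes> k \<otimes> inv h) \<otimes> h) v w)) (h \<otimes> k \<otimes> inv h))"
      using h by (intro sum.cong refl) (simp add: m_assoc)
    also have "\<dots> = ?s'"
      by (rule sum.reindex_bij_betw[OF bij_betw_conj[OF h]])
    finally show ?thesis .
  qed
  ultimately have "?H \<star> rel v w \<star> ?H' - rel ?hv ?hw = ?s ?hv ?hw - ?s'"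
    unfolding rel_def T.mult_diff_left T.mult_diff_right by simp
  moreover have "?H \<star> rel v w \<star> ?H' - rel ?hv ?hw \<in> I"
    using h by (intro I_diff I_mult_left I_mult_right rel_in_I T.skew_elem_closed) auto
  moreover have "?s ?hv ?hw - ?s' \<in> lower 2"
    by (intro lower_diff lower_sum skew_elem_lower) (auto simp: scal_def zero_list_def split: if_splits)
  ultimately have "?s ?hv ?hw - ?s' \<in> I" "?s ?hv ?hw - ?s' \<in> lower 2" by (simp_all only:)
  from ideal_short[OF hecke this] have "(?s ?hv ?hw) g = ?s' g" by (simp only: right_minus_eq)
  then show "a (inv h \<otimes> g \<otimes> h) v w = a g ?hv ?hw"
    using g finite_carrier by (simp add: sum_fun_apply skew_elem_def)
qed

text \<open>The cyclic sum of the commutators of a vector with a relation lies in the ideal. Its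
  cubic part cancels, and the linear part that remains has the expression of
  \<open>jacobi_form\<close> as its component at \<open>g\<close>.\<close>

lemma hecke_jacobi:
  assumes hecke: "is_graded_hecke G \<rho> a" and skew: "\<And>g. g \<in> carrier G \<Longrightarrow> skew_form (a g)"
    and g: "g \<in> carrier G"
  shows "jacobi_form (\<rho> g) (a g)"
  unfolding jacobi_form_def
proof (intro allI)
  fix u v w
  let ?t = "\<lambda>u. skew_elem (tens_vec u) \<one>"
  let ?c = "\<lambda>v w. tens_vec v * tens_vec w - tens_vec w * tens_vec v"
  let ?s = "\<lambda>v w. \<Sum>k\<in>carrier G. skew_elem (scal (a k v w) :: 'n tens) k"
  let ?d = "\<lambda>u v w k. a k v w *s (\<rho> k *v u - u)"
  let ?x = "\<lambda>u v w. ?t u \<star> rel v w - rel v w \<star> ?t u"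
  have comm: "?x u v w = skew_elem (tens_vec u * ?c v w - ?c v w * tens_vec u) \<one>
      + (\<Sum>k\<in>carrier G. skew_elem (tens_vec (?d u v w k)) k)" for u v w
  proof -
    have "?t u \<star> skew_elem (?c v w) \<one> - skew_elem (?c v w) \<one> \<star> ?t u =
        skew_elem (tens_vec u * ?c v w - ?c v w * tens_vec u) \<one>"
      by (simp add: T.skew_elem_mult flip: skew_elem_diff)
    moreover have "?s v w \<star> ?t u - ?t u \<star> ?s v w = (\<Sum>k\<in>carrier G. skew_elem (tens_vec (?d u v w k)) k)"
      unfolding T.mult_sum_left T.mult_sum_right sum_subtractf[symmetric]
    proof (intro sum.cong refl)
      fix k assume k: "k \<in> carrier G"
      have "tens_vec (x - y) = tens_vec x - tens_vec y" for x y :: "complex ^ 'n"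
        using tens_vec_add[of "x - y" y] by simp
      then show "skew_elem (scal (a k v w)) k \<star> ?t u - ?t u \<star> skew_elem (scal (a k v w)) k =
          skew_elem (tens_vec (?d u v w k)) k"
        using k by (simp add: T.skew_elem_mult tens_act_tens_vec tens_vec_scale scal_comm[of "tens_vec u"]
            right_diff_distrib flip: skew_elem_diff)
    qed
    ultimately show ?thesis
      unfolding rel_def T.mult_diff_left T.mult_diff_right by (simp add: algebra_simps)
  qed
  let ?e = "\<lambda>k. ?d u v w k + ?d v w u k + ?d w u v k"
  have "?x u v w + ?x v w u + ?x w u v = (\<Sum>k\<in>carrier G. skew_elem (tens_vec (?e k)) k)"
  proof -
    have "?x u v w + ?x v w u + ?x w u v =
        skew_elem ((tens_vec u * ?c v w - ?c v w * tens_vec u) + (tens_vec v * ?c w u - ?c w u * tens_vec v)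
          + (tens_vec w * ?c u v - ?c u v * tens_vec w)) \<one> + (\<Sum>k\<in>carrier G. skew_elem (tens_vec (?e k)) k)"
      unfolding comm by (simp only: skew_elem_add tens_vec_add sum.distrib ac_simps)
    \<comment> \<open>The Jacobi identity for commutators in the associative algebra T(V).\<close>
    also have "(tens_vec u * ?c v w - ?c v w * tens_vec u) + (tens_vec v * ?c w u - ?c w u * tens_vec v)
          + (tens_vec w * ?c u v - ?c u v * tens_vec w) = 0"
      by (simp add: algebra_simps)
    finally show ?thesis by (simp only: skew_elem_0 add_0)
  qed
  moreover have "?x u v w + ?x v w u + ?x w u v \<in> I"
    by (intro I_add I_diff I_mult_left I_mult_right rel_in_I T.skew_elem_closed) auto
  moreover have "(\<Sum>k\<in>carrier G. skew_elem (tens_vec (?e k)) k) \<in> lower 2"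
  proof (intro lower_sum skew_elem_lower)
    fix k x y assume "y \<in> Poly_Mapping.keys (tens_vec (?e k))"
    then show "length y < 2"
      using keys_sum[of "\<lambda>i. Poly_Mapping.single [i] (?e k $ i)" UNIV]
      by (fastforce simp: tens_vec_def split: if_splits)
  qed
  ultimately have "(\<Sum>k\<in>carrier G. skew_elem (tens_vec (?e k)) k) \<in> I"
    "(\<Sum>k\<in>carrier G. skew_elem (tens_vec (?e k)) k) \<in> lower 2" by (simp_all only:)
  from ideal_short[OF hecke this] have "(\<Sum>k\<in>carrier G. skew_elem (tens_vec (?e k)) k) g = 0" by simp
  then have "?e g = 0"
    using g finite_carrier by (simp only: sum_fun_apply skew_elem_def) simp
  then show "a g u v *s (\<rho> g *v w - w) + a g v w *s (\<rho> g *v u - u) + a g w u *s (\<rho> g *v v - v) = 0"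
    by (simp only: ac_simps)
qed

end

text \<open>From here on no associated graded algebra is needed; the parameters are described by
  linear algebra at each group element.\<close>

lemma (in finite_rep) hecke_parameters_iff:
  "a \<in> hecke_parameters G \<rho> \<longleftrightarrow>
     (\<forall>g\<in>carrier G. skew_form (a g)) \<and> (\<forall>g. g \<notin> carrier G \<longrightarrow> a g = (\<lambda>_ _. 0)) \<and>
     equivariant_forms G \<rho> a \<and> (\<forall>g\<in>carrier G. jacobi_form (\<rho> g) (a g))"
proof -
  interpret hecke_forms G \<rho> a ..
  have "is_graded_hecke G \<rho> a"
    if "\<forall>g\<in>carrier G. skew_form (a g)" "equivariant_forms G \<rho> a" "\<forall>g\<in>carrier G. jacobi_form (\<rho> g) (a g)"
  proof -
    interpret pbw_forms G \<rho> a using that by unfold_locales auto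
    show ?thesis using graded_hecke_if_kernel gr_map_kernel by blast
  qed
  then show ?thesis
    using hecke_equivariant hecke_jacobi by (auto simp: hecke_parameters_def)
qed

section \<open>The fixed space of a unitary map\<close>

lemma vec_scale_simps:
  fixes v :: "complex ^ 'n"
  shows "a *s (v + w) = a *s v + a *s w" "a *s (v - w) = a *s v - a *s w" "(a + b) *s v = a *s v + b *s v"
    "(a - b) *s v = a *s v - b *s v" "a *s (b *s v) = (a * b) *s v"
  by (simp_all add: vec_eq_iff algebra_simps)

locale hermitian_ip =
  fixes ip :: "complex ^ 'n \<Rightarrow> complex ^ 'n::finite \<Rightarrow> complex"
  assumes herm: "hermitian_inner_product ip"
begin

lemma ip_swap: "ip w v = cnj (ip v w)"
  using herm unfolding hermitian_inner_product_def by blast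

lemma ip_lin: "ip (c *s u + v) w = c * ip u w + ip v w"
  using herm unfolding hermitian_inner_product_def by blast

lemma ip_add: "ip (u + v) w = ip u w + ip v w"
  using ip_lin[of 1 u v w] by simp

lemma ip_0 [simp]: "ip 0 w = 0"
  using ip_add[of 0 0 w] by simp

lemma ip_scale: "ip (c *s u) w = c * ip u w"
  using ip_lin[of c u 0 w] by simp

lemma ip_diff: "ip (u - v) w = ip u w - ip v w"
  using ip_add[of "u - v" v w] by simp

lemma ip_add_right: "ip w (u + v) = ip w u + ip w v"
  using ip_add[of u v w] ip_swap[of w "u + v"] ip_swap[of w u] ip_swap[of w v] by simp

lemma ip_0_right [simp]: "ip w 0 = 0"
  using ip_swap[of w 0] by simp

lemma ip_scale_right: "ip w (c *s u) = cnj c * ip w u"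
  using ip_scale[of c u w] ip_swap[of w "c *s u"] ip_swap[of w u] by simp

lemma ip_self: "ip v v = 0 \<Longrightarrow> v = 0"
  using herm unfolding hermitian_inner_product_def by (metis less_irrefl zero_complex.simps(1))

text \<open>Gram-Schmidt. The induction hypothesis is used twice: to make the new vector
  \<open>b\<close> orthogonal to the span of \<open>B\<close>, and to project \<open>v\<close> onto
  that span.\<close>

lemma orthogonal_projection_span:
  assumes "finite B"
  shows "\<exists>w\<in>vec.span B. \<forall>x\<in>vec.span B. ip (v - w) x = 0"
  using assms
proof (induction B arbitrary: v rule: finite_induct)
  case empty
  show ?case by simp
next
  case (insert b B)
  obtain p where p: "p \<in> vec.span B" "\<And>x. x \<in> vec.span B \<Longrightarrow> ip (b - p) x = 0"
    using insert.IH by blast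
  obtain w0 where w0: "w0 \<in> vec.span B" "\<And>x. x \<in> vec.span B \<Longrightarrow> ip (v - w0) x = 0"
    using insert.IH by blast
  define b' where "b' = b - p"
  \<comment> \<open>The coefficient of \<open>v - w0\<close> along \<open>b'\<close>. If
    \<open>b\<close> already lies in the span of \<open>B\<close>, then \<open>b' = 0\<close> and
    the correction \<open>c *s b'\<close> vanishes.\<close>
  define c where "c = ip (v - w0) b' / ip b' b'"
  have b'_in: "b' \<in> vec.span (insert b B)"
    unfolding b'_def using p(1) by (meson insertI1 subset_insertI vec.span_base vec.span_diff vec.span_mono subsetD)
  have w_in: "w0 + c *s b' \<in> vec.span (insert b B)"
    using w0(1) b'_in by (meson subset_insertI subsetD vec.span_add vec.span_mono vec.span_scale)
  have "ip (v - (w0 + c *s b')) x = 0" if x: "x \<in> vec.span (insert b B)" for x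
  proof -
    obtain k where k: "x - k *s b \<in> vec.span B" using x vec.span_breakdown_eq by metis
    define y where "y = x - k *s b'"
    have "y = (x - k *s b) + k *s p" by (simp add: y_def b'_def vec_scale_simps)
    then have y: "y \<in> vec.span B" using k p(1) by (simp add: vec.span_add vec.span_scale)
    have "x = k *s b' + y" by (simp add: y_def)
    moreover have "ip (v - (w0 + c *s b')) y = 0"
      using w0(2)[OF y] p(2)[OF y] by (simp add: ip_diff ip_add ip_scale b'_def)
    moreover have "ip (v - (w0 + c *s b')) b' = 0"
    proof (cases "b' = 0")
      case False
      then have "ip b' b' \<noteq> 0" using ip_self by blast
      then show ?thesis by (simp add: ip_diff ip_add ip_scale c_def)
    qed simp
    ultimately show ?thesis by (simp add: ip_add_right ip_scale_right)
  qed
  then show ?case using w_in by blast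
qed

end

locale unitary_map = hermitian_ip ip for ip :: "complex ^ 'n \<Rightarrow> complex ^ 'n::finite \<Rightarrow> complex" +
  fixes M :: "complex ^ 'n ^ 'n"
  assumes unitary: "ip (M *v v) (M *v w) = ip v w"
begin

definition W where "W = fixed_space M"
definition U where "U = orth_compl ip W"

lemma in_W_iff: "v \<in> W \<longleftrightarrow> M *v v = v"
  by (simp add: W_def fixed_space_def)

lemma subspace_W: "vec.subspace W"
  by (simp add: vec.subspace_def in_W_iff matrix_vector_right_distrib
      matrix_vector_mult_0_right vector_scalar_commute)

lemma subspace_U: "vec.subspace U"
  by (auto simp: vec.subspace_def U_def orth_compl_def ip_add ip_scale)

lemma in_U: "u \<in> U \<Longrightarrow> w \<in> W \<Longrightarrow> ip u w = 0"
  by (simp add: U_def orth_compl_def)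

lemma W_Int_U: "v \<in> W \<Longrightarrow> v \<in> U \<Longrightarrow> v = 0"
  using in_U ip_self by blast

lemma decomp: "\<exists>w\<in>W. v - w \<in> U"
proof -
  obtain B where B: "B \<subseteq> W" "vec.independent B" "W \<subseteq> vec.span B" "card B = vec.dim W"
    by (rule vec.basis_exists)
  then have "vec.span B = W" using subspace_W by (intro vec.span_subspace)
  then show ?thesis
    using orthogonal_projection_span[OF vec.finiteI_independent[OF B(2)], of v]
    by (simp add: U_def orth_compl_def)
qed

lemma codim_eq: "codim W = vec.dim U"
proof -
  have "{x + y |x y. x \<in> W \<and> y \<in> U} = UNIV"
  proof -
    have "v \<in> {x + y |x y. x \<in> W \<and> y \<in> U}" for v
      using decomp[of v] by force
    then show ?thesis by blast
  qed
  moreover have "W \<inter> U = {0}"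
    using W_Int_U vec.subspace_0[OF subspace_W] vec.subspace_0[OF subspace_U] by blast
  ultimately have "CARD('n) + vec.dim ({0} :: (complex ^ 'n) set) = vec.dim W + vec.dim U"
    using vec.dim_sums_Int[OF subspace_W subspace_U] by (simp only: vec_dim_card)
  then show ?thesis by (simp add: codim_def)
qed

definition pW where "pW = proj_along W U"
definition pU where "pU = proj_along U W"

lemma unique_decomp:
  assumes "w \<in> W" "u \<in> U" "w' \<in> W" "u' \<in> U" "w + u = w' + u'"
  shows "w = w'" "u = u'"
proof -
  have "w - w' = u' - u" using assms(5) by (simp add: algebra_simps)
  moreover have "w - w' \<in> W" "u' - u \<in> U"
    using assms subspace_W subspace_U by (auto intro: vec.subspace_diff)
  ultimately have "w - w' = 0" "u' - u = 0" using W_Int_U by metis+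
  then show "w = w'" "u = u'" by simp_all
qed

lemma pW_eq: "w \<in> W \<Longrightarrow> u \<in> U \<Longrightarrow> pW (w + u) = w"
  unfolding pW_def proj_along_def
  by (rule the_equality) (use unique_decomp(1) in \<open>force simp: algebra_simps\<close>)+

lemma pU_eq: "w \<in> W \<Longrightarrow> u \<in> U \<Longrightarrow> pU (w + u) = u"
  unfolding pU_def proj_along_def
  by (rule the_equality) (use unique_decomp(2) in \<open>force simp: algebra_simps\<close>)+

lemma decompE:
  obtains w u where "w \<in> W" "u \<in> U" "v = w + u"
proof -
  obtain w where "w \<in> W" "v - w \<in> U" using decomp by blast
  then show thesis using that[of w "v - w"] by simp
qed

lemma pW_in: "pW v \<in> W" and pU_in: "pU v \<in> U" and pW_pU: "pW v + pU v = v"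
  by (rule decompE[of v], simp add: pW_eq pU_eq)+

lemma pU_add: "pU (v + v') = pU v + pU v'" and pW_add: "pW (v + v') = pW v + pW v'"
proof -
  have "v + v' = (pW v + pW v') + (pU v + pU v')"
    using pW_pU[of v] pW_pU[of v'] by (simp add: algebra_simps)
  moreover have "pW v + pW v' \<in> W" "pU v + pU v' \<in> U"
    using pW_in pU_in subspace_W subspace_U by (auto intro: vec.subspace_add)
  ultimately show "pU (v + v') = pU v + pU v'" "pW (v + v') = pW v + pW v'"
    using pU_eq pW_eq by metis+
qed

lemma pU_scale: "pU (c *s v) = c *s pU v" and pW_scale: "pW (c *s v) = c *s pW v"
proof -
  have "c *s v = c *s pW v + c *s pU v"
    using pW_pU[of v] by (metis vec_scale_simps(1))
  moreover have "c *s pW v \<in> W" "c *s pU v \<in> U"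
    using pW_in pU_in subspace_W subspace_U by (auto intro: vec.subspace_scale)
  ultimately show "pU (c *s v) = c *s pU v" "pW (c *s v) = c *s pW v"
    using pU_eq pW_eq by metis+
qed

lemma pU_U: "u \<in> U \<Longrightarrow> pU u = u" and pU_W: "w \<in> W \<Longrightarrow> pU w = 0"
  using pU_eq[of 0 u] pU_eq[of w 0] vec.subspace_0[OF subspace_W] vec.subspace_0[OF subspace_U] by simp_all

text \<open>The operator M - 1 of the Jacobi condition. It vanishes on \<open>W\<close> and is
  injective on \<open>U\<close>, so a linear relation between its values is a relation between the
  components in \<open>U\<close>.\<close>

definition N where "N v = M *v v - v"

lemma N_lin: "N (u + v) = N u + N v" "N (c *s v) = c *s N v"
  by (simp_all add: N_def matrix_vector_right_distrib vector_scalar_commute vec_scale_simps)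

lemma N_W: "w \<in> W \<Longrightarrow> N w = 0"
  by (simp add: N_def in_W_iff)

lemma N_U_inj: "u \<in> U \<Longrightarrow> N u = 0 \<Longrightarrow> u = 0"
  using W_Int_U by (simp add: N_def in_W_iff)

lemma N_pU: "N v = N (pU v)"
  using pW_pU[of v] N_lin(1)[of "pW v" "pU v"] N_W[OF pW_in] by simp

lemma M_U: "u \<in> U \<Longrightarrow> M *v u \<in> U"
proof -
  assume u: "u \<in> U"
  have "ip (M *v u) w = 0" if "w \<in> W" for w
  proof -
    have "ip (M *v u) (M *v w) = 0" using unitary in_U[OF u that] by simp
    then show ?thesis using that by (simp add: in_W_iff)
  qed
  then show ?thesis by (simp add: U_def orth_compl_def)
qed

lemma ex_outside:
  assumes "finite B" "card B < vec.dim U"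
  shows "\<exists>x\<in>U. x \<notin> vec.span B"
  using vec.dim_le_card[of U B] assms by (meson leD subsetI)

section \<open>Forms with the Jacobi identity, according to the codimension of the fixed
  space\<close>

lemma jacobiD:
  assumes "jacobi_form M b"
  shows "b u v *s N w + b v w *s N u + b w u *s N v = 0"
  using assms by (simp add: jacobi_form_def N_def)

text \<open>With \<open>w\<close> fixed, the Jacobi identity for \<open>x\<close>, \<open>u\<close>,
  \<open>w\<close> loses one term, and injectivity of \<open>N\<close> on \<open>U\<close> makes
  \<open>x\<close> and \<open>u\<close> linearly dependent unless \<open>b u w = 0\<close>.
  Dimension 2 leaves room for an \<open>x\<close> outside the line of \<open>u\<close>.\<close>

lemma form_W_left_U:
  assumes b: "skew_form b" "jacobi_form M b" and dim: "2 \<le> vec.dim U" and w: "w \<in> W" and u: "u \<in> U"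
  shows "b u w = 0"
proof (rule ccontr)
  assume nz: "b u w \<noteq> 0"
  obtain x where x: "x \<in> U" "x \<notin> vec.span {u}"
    using ex_outside[of "{u}"] dim by auto
  have "b u w *s N x + b w x *s N u = 0"
    using jacobiD[OF b(2), of x u w] N_W[OF w] by simp
  then have "N (b u w *s x + b w x *s u) = 0" by (simp add: N_lin)
  moreover have "b u w *s x + b w x *s u \<in> U"
    using x u subspace_U by (auto intro!: vec.subspace_add vec.subspace_scale)
  ultimately have "b u w *s x + b w x *s u = 0" using N_U_inj by blast
  then have "b u w *s x = - (b w x *s u)" by (rule eq_neg_iff_add_eq_0[THEN iffD2])
  then have "b u w *s x \<in> vec.span {u}"
    by (simp add: vec.span_base vec.span_neg vec.span_scale)
  then have "inverse (b u w) *s (b u w *s x) \<in> vec.span {u}" by (rule vec.span_scale)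
  then show False using x(2) nz by (simp add: vec_scale_simps)
qed

text \<open>Two fixed arguments leave only \<open>b v w *s N x\<close>, and \<open>N x\<close> is
  nonzero for nonzero \<open>x\<close> in \<open>U\<close>.\<close>

lemma form_W_W:
  assumes b: "skew_form b" "jacobi_form M b" and dim: "1 \<le> vec.dim U" and vw: "v \<in> W" "w \<in> W"
  shows "b v w = 0"
proof -
  obtain x where x: "x \<in> U" "x \<notin> vec.span {}"
    using ex_outside[of "{}"] dim by auto
  have "b v w *s N x = 0" using jacobiD[OF b(2), of x v w] N_W vw by simp
  moreover have "N x \<noteq> 0" using N_U_inj[OF x(1)] x(2) by (auto simp: vec.span_zero)
  ultimately show ?thesis by simp
qed

lemma form_pU:
  assumes b: "skew_form b" "jacobi_form M b" and dim: "2 \<le> vec.dim U"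
  shows "b v w = b (pU v) (pU w)"
proof -
  have "b v w = b (pW v + pU v) (pW w + pU w)" by (simp add: pW_pU)
  also have "\<dots> = b (pW v) (pW w) + b (pW v) (pU w) + b (pU v) (pW w) + b (pU v) (pU w)"
    by (simp add: skew_form_add_left[OF b(1)] skew_form_add_right[OF b(1)])
  also have "b (pW v) (pU w) = - b (pU w) (pW v)" by (rule skew_form_swap[OF b(1)])
  finally show ?thesis
    using form_W_left_U[OF b dim pW_in pU_in] form_W_W[OF b _ pW_in pW_in] dim by simp
qed

text \<open>On \<open>U\<close> the Jacobi identity is a linear dependence between three vectors
  with coefficient \<open>b u v\<close> at \<open>x\<close>; in dimension 3 the vector
  \<open>x\<close> can be chosen outside the span of \<open>u\<close> and \<open>v\<close>.\<close>

lemma form_zero_ge_3: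
  assumes b: "skew_form b" "jacobi_form M b" and dim: "3 \<le> vec.dim U"
  shows "b v w = 0"
proof -
  have U: "b u v = 0" if u: "u \<in> U" and v: "v \<in> U" for u v
  proof (rule ccontr)
    assume nz: "b u v \<noteq> 0"
    have "card {u, v} \<le> 2" by (simp add: card_insert_if)
    then obtain x where x: "x \<in> U" "x \<notin> vec.span {u, v}"
      using ex_outside[of "{u, v}"] dim by auto
    have "N (b u v *s x + (b v x *s u + b x u *s v)) = 0"
      using jacobiD[OF b(2), of u v x] by (simp add: N_lin add.assoc)
    moreover have "b u v *s x + (b v x *s u + b x u *s v) \<in> U"
      using x u v subspace_U by (auto intro!: vec.subspace_add vec.subspace_scale)
    ultimately have "b u v *s x + (b v x *s u + b x u *s v) = 0" using N_U_inj by blast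
    then have "b u v *s x = - (b v x *s u + b x u *s v)" by (rule eq_neg_iff_add_eq_0[THEN iffD2])
    then have "b u v *s x \<in> vec.span {u, v}"
      by (metis insertI1 insertI2 vec.span_add vec.span_base vec.span_neg vec.span_scale singletonI)
    then have "inverse (b u v) *s (b u v *s x) \<in> vec.span {u, v}" by (rule vec.span_scale)
    then show False using x(2) nz by (simp add: vec_scale_simps)
  qed
  show ?thesis using form_pU[OF b, of v w] U[OF pU_in pU_in] dim by simp
qed

text \<open>The line \<open>U\<close> is stable under \<open>M\<close>, and eigenvalue 1 would place
  it inside the fixed space.\<close>

lemma eigenvalue_dim_1:
  assumes dim: "vec.dim U = 1"
  shows "\<exists>\<zeta> x. x \<noteq> 0 \<and> U = vec.span {x} \<and> \<zeta> \<noteq> 1 \<and> (\<forall>u\<in>U. M *v u = \<zeta> *s u)"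
proof -
  obtain B where B: "B \<subseteq> U" "vec.independent B" "U \<subseteq> vec.span B" "card B = vec.dim U"
    by (rule vec.basis_exists)
  then obtain x where x: "B = {x}" using dim by (metis card_1_singletonE)
  have sp: "U = vec.span {x}" using vec.span_subspace[OF B(1,3) subspace_U] x by simp
  have x0: "x \<noteq> 0" using B(2) x vec.dependent_zero by auto
  have xU: "x \<in> U" using B(1) x by auto
  then obtain \<zeta> where \<zeta>: "M *v x = \<zeta> *s x"
    using M_U[OF xU] sp by (auto simp: vec.span_singleton)
  have "\<zeta> \<noteq> 1" using \<zeta> N_U_inj[OF xU] x0 by (auto simp: N_def)
  moreover have "M *v u = \<zeta> *s u" if u: "u \<in> U" for u
  proof -
    obtain c where "u = c *s x" using u sp by (auto simp: vec.span_singleton)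
    then show ?thesis using \<zeta> by (simp add: vector_scalar_commute mult.commute)
  qed
  ultimately show ?thesis using x0 sp by blast
qed

text \<open>In codimension 1 the Jacobi identity says nothing about \<open>b\<close> between
  \<open>U\<close> and \<open>W\<close>. Invariance under \<open>M\<close> does: it multiplies these
  values by the eigenvalue \<open>\<zeta>\<close>, which is not 1.\<close>

lemma form_zero_dim_1:
  assumes b: "skew_form b" "jacobi_form M b" and inv: "\<And>v w. b (M *v v) (M *v w) = b v w"
    and dim: "vec.dim U = 1"
  shows "b v w = 0"
proof -
  obtain \<zeta> x where x: "x \<noteq> 0" "U = vec.span {x}" "\<zeta> \<noteq> 1" "\<And>u. u \<in> U \<Longrightarrow> M *v u = \<zeta> *s u"
    using eigenvalue_dim_1[OF dim] by blast
  have UW: "b u w = 0" if "u \<in> U" "w \<in> W" for u w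
  proof -
    have "\<zeta> * b u w = b u w"
      using inv[of u w] x(4)[OF that(1)] that(2) by (simp add: in_W_iff skew_form_scale_left[OF b(1)])
    then show ?thesis using x(3) by simp
  qed
  have UU: "b u v = 0" if uv: "u \<in> U" "v \<in> U" for u v
  proof -
    obtain c d where "u = c *s x" "v = d *s x" using uv x(2) by (auto simp: vec.span_singleton)
    then show ?thesis
      by (simp add: skew_form_scale_left[OF b(1)] skew_form_scale_right[OF b(1)] skew_form_same[OF b(1)])
  qed
  have "b v w = b (pW v + pU v) (pW w + pU w)" by (simp add: pW_pU)
  also have "\<dots> = b (pW v) (pW w) + b (pW v) (pU w) + b (pU v) (pW w) + b (pU v) (pU w)"
    by (simp add: skew_form_add_left[OF b(1)] skew_form_add_right[OF b(1)])
  also have "b (pW v) (pU w) = - b (pU w) (pW v)" by (rule skew_form_swap[OF b(1)])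
  finally show ?thesis
    using UW[OF pU_in pW_in] UU[OF pU_in pU_in] form_W_W[OF b _ pW_in pW_in] dim by simp
qed

text \<open>Cramer's rule in a plane: the hypothesis says that \<open>\<omega>\<close> is a multiple
  of the determinant of the coordinates.\<close>

lemma plane_identity:
  fixes x y z :: "complex ^ 'n"
  assumes \<omega>: "\<And>a b c d. \<omega> (a *s b0 + b *s b1) (c *s b0 + d *s b1) = (a * d - b * c) * e"
    and "x = x0 *s b0 + x1 *s b1" "y = y0 *s b0 + y1 *s b1" "z = z0 *s b0 + z1 *s b1"
  shows "\<omega> x y *s z + \<omega> y z *s x + \<omega> z x *s y = 0"
proof -
  have e: "\<omega> x y = (x0 * y1 - x1 * y0) * e" "\<omega> y z = (y0 * z1 - y1 * z0) * e" "\<omega> z x = (z0 * x1 - z1 * x0) * e"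
    using \<omega> assms(2-4) by simp_all
  show ?thesis unfolding e unfolding assms(2-4) by (simp add: vec_eq_iff algebra_simps)
qed

end

section \<open>Determinants on lines and planes\<close>

definition alt_on :: "(complex ^ 'n) set \<Rightarrow> (complex ^ 'n \<Rightarrow> complex ^ 'n \<Rightarrow> complex) \<Rightarrow> bool" where
  "alt_on U b \<longleftrightarrow> (\<forall>x\<in>U. \<forall>y\<in>U. \<forall>z\<in>U. \<forall>c.
     b (c *s x + y) z = c * b x z + b y z \<and> b z (c *s x + y) = c * b z x + b z y) \<and> (\<forall>x\<in>U. b x x = 0)"

lemma alt_onD:
  assumes "alt_on U b" "x \<in> U" "y \<in> U" "z \<in> U"
  shows "b (c *s x + y) z = c * b x z + b y z" "b z (c *s x + y) = c * b z x + b z y" "b x x = 0"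
  using assms unfolding alt_on_def by blast+

lemma alt_on_swap:
  assumes b: "alt_on U b" and U: "vec.subspace U" and xy: "x \<in> U" "y \<in> U"
  shows "b x y = - b y x"
proof -
  have s: "1 *s x + y \<in> U" using xy U by (simp add: vec.subspace_add)
  have "0 = b (1 *s x + y) (1 *s x + y)" using alt_onD(3)[OF b s s s] by simp
  also have "\<dots> = 1 * b x (1 *s x + y) + b y (1 *s x + y)" by (rule alt_onD(1)[OF b xy s])
  also have "b x (1 *s x + y) = 1 * b x x + b x y" by (rule alt_onD(2)[OF b xy xy(1)])
  also have "b y (1 *s x + y) = 1 * b y x + b y y" by (rule alt_onD(2)[OF b xy xy(2)])
  finally have "b x y + b y x = 0" using alt_onD(3)[OF b] xy by simp
  then show ?thesis by (rule eq_neg_iff_add_eq_0[THEN iffD2])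
qed

lemma alt_on_coords:
  assumes b: "alt_on U b" and U: "vec.subspace U" and xy: "x \<in> U" "y \<in> U"
  shows "b (p *s x + q *s y) (r *s x + s *s y) = (p * s - q * r) * b x y"
proof -
  have U0: "0 \<in> U" by (rule vec.subspace_0[OF U])
  have m: "c *s x \<in> U" "c *s y \<in> U" for c using U xy by (simp_all add: vec.subspace_scale)
  have z: "r *s x + s *s y \<in> U" using U m by (simp add: vec.subspace_add)
  have b0: "b 0 z = 0" "b z 0 = 0" if "z \<in> U" for z
    using alt_onD(1,2)[OF b U0 U0 that, of 1] by simp_all
  have sc: "b (c *s u) z = c * b u z" "b z (c *s u) = c * b z u" if "z \<in> U" "u \<in> U" for c u z
    using alt_onD(1,2)[OF b that(2) U0 that(1), of c] b0[OF that(1)] by simp_all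
  have "b (p *s x + q *s y) (r *s x + s *s y) = p * b x (r *s x + s *s y) + b (q *s y) (r *s x + s *s y)"
    by (rule alt_onD(1)[OF b xy(1) m(2) z])
  also have "b x (r *s x + s *s y) = r * b x x + b x (s *s y)" by (rule alt_onD(2)[OF b xy(1) m(2) xy(1)])
  also have "b (q *s y) (r *s x + s *s y) = q * b y (r *s x + s *s y)" by (rule sc(1)[OF z xy(2)])
  also have "b y (r *s x + s *s y) = r * b y x + b y (s *s y)" by (rule alt_onD(2)[OF b xy(1) m(2) xy(2)])
  also have "b y x = - b x y" by (rule alt_on_swap[OF b U xy(2) xy(1)])
  finally show ?thesis
    using alt_onD(3)[OF b] xy by (simp add: sc algebra_simps)
qed

lemma span_two: "x \<in> vec.span {a, b} \<longleftrightarrow> (\<exists>p q. x = p *s a + q *s (b :: complex ^ 'n))"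
proof -
  have "x \<in> vec.span {a, b} \<longleftrightarrow> (\<exists>k. x - k *s a \<in> vec.span {b})" by (rule vec.span_breakdown_eq)
  also have "\<dots> \<longleftrightarrow> (\<exists>p q. x - p *s a = q *s b)" by (auto simp: vec.span_singleton)
  also have "\<dots> \<longleftrightarrow> (\<exists>p q. x = p *s a + q *s b)" by (simp add: diff_eq_eq add.commute)
  finally show ?thesis .
qed

lemma lessThan_2: "{..<2::nat} = {0, 1}"
  by auto

lemma sum_permutes_2:
  "(\<Sum>\<sigma> | \<sigma> permutes {..<2::nat}. f \<sigma>) = f id + f (Transposition.transpose 0 1)"
proof -
  have "{\<sigma>. \<sigma> permutes {..<2::nat}} = {id, Transposition.transpose 0 1}"
    by (auto simp: lessThan_2 permutes_doubleton_iff)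
  moreover have "id \<noteq> Transposition.transpose 0 (1::nat)" by (metis id_apply transpose_apply_first zero_neq_one)
  ultimately show ?thesis by simp
qed

lemma det_on_zero: "det_on {0} f = 1"
  unfolding det_on_def by (rule the_equality) (auto simp: vec.independent_empty)

text \<open>\<open>det_on\<close> is a definite description over all bases, so besides one basis
  giving \<open>\<zeta>\<close> every other basis has to be shown to give the same value.\<close>

lemma det_on_line:
  fixes x :: "complex ^ 'n::finite"
  assumes x: "x \<noteq> 0" and f: "\<And>u. u \<in> vec.span {x} \<Longrightarrow> f u = \<zeta> *s u"
  shows "det_on (vec.span {x}) f = \<zeta>"
proof -
  have ind: "vec.independent {x}" using x by (metis vec.dependent_single)
  then have dim: "vec.dim (vec.span {x}) = 1" using vec.dim_eq_card_independent[OF ind] by simp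
  have l: "{..<Suc 0} = {0}" by auto
  show ?thesis
    unfolding det_on_def dim
  proof (rule the_equality)
    show "\<exists>b M. inj_on b {..<1::nat} \<and> vec.independent (b ` {..<1}) \<and> vec.span (b ` {..<1}) = vec.span {x} \<and>
      (\<forall>j<1. f (b j) = (\<Sum>i<1. M i j *s b i)) \<and>
      \<zeta> = (\<Sum>\<sigma> | \<sigma> permutes {..<1}. of_int (sign \<sigma>) * (\<Prod>i<1. M i (\<sigma> i)))"
      using ind f[OF vec.span_base[of x "{x}"]]
      by (intro exI[of _ "\<lambda>_. x"] exI[of _ "\<lambda>_ _. \<zeta>"]) (simp add: l)
    fix D assume "\<exists>b M. inj_on b {..<1::nat} \<and> vec.independent (b ` {..<1}) \<and> vec.span (b ` {..<1}) = vec.span {x} \<and>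
      (\<forall>j<1. f (b j) = (\<Sum>i<1. M i j *s b i)) \<and>
      D = (\<Sum>\<sigma> | \<sigma> permutes {..<1}. of_int (sign \<sigma>) * (\<Prod>i<1. M i (\<sigma> i)))"
    then obtain b and M :: "nat \<Rightarrow> nat \<Rightarrow> complex" where b: "vec.independent {b 0}" "vec.span {b 0} = vec.span {x}"
      "f (b 0) = M 0 0 *s b 0" "D = M 0 0"
      by (auto simp: l)
    have "b 0 \<in> vec.span {b 0}" by (rule vec.span_base) simp
    then have "b 0 \<in> vec.span {x}" by (simp only: b(2))
    then have "f (b 0) = \<zeta> *s b 0" by (rule f)
    moreover have "b 0 \<noteq> 0" using b(1) by (metis vec.dependent_single)
    ultimately show "D = \<zeta>" using b(3,4) by simp
  qed
qed

text \<open>A nonzero alternating form on a plane is multiplied by the determinant of the matrix of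
  \<open>f\<close> in any basis (\<open>char\<close>). The factor by which the form changes does not
  mention a basis, so this also gives the uniqueness that the definite description demands.\<close>

lemma det_on_plane:
  fixes U :: "(complex ^ 'n::finite) set"
  assumes b: "alt_on U b" and nz: "u0 \<in> U" "u1 \<in> U" "b u0 u1 \<noteq> 0"
    and U: "vec.subspace U" and dim: "vec.dim U = 2"
    and f: "\<And>u. u \<in> U \<Longrightarrow> f u \<in> U" "\<And>c u v. f (c *s u + v) = c *s f u + f v"
    and xy: "x \<in> U" "y \<in> U"
  shows "b (f x) (f y) = det_on U f * b x y"
proof -
  let ?P = "\<lambda>D e M. inj_on e {..<2::nat} \<and> vec.independent (e ` {..<2}) \<and> vec.span (e ` {..<2}) = U \<and>
      (\<forall>j<2. f (e j) = (\<Sum>i<2. M i j *s e i)) \<and>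
      D = (\<Sum>\<sigma> | \<sigma> permutes {..<2}. of_int (sign \<sigma>) * (\<Prod>i<2. M i (\<sigma> i)))"
  have f0: "f 0 = 0" using f(2)[of 1 0 0] by simp
  have f_scale: "f (c *s u) = c *s f u" for c u using f(2)[of c u 0] f0 by simp
  \<comment> \<open>The first fact allows the form to be cancelled when two candidates for
    \<open>D\<close> are compared; it holds since a form that vanishes on a basis pair vanishes on
    the plane.\<close>
  have char: "b (e 0) (e 1) \<noteq> 0" "\<And>x y. x \<in> U \<Longrightarrow> y \<in> U \<Longrightarrow> b (f x) (f y) = D * b x y"
    if P: "?P D e M" for D e and M :: "nat \<Rightarrow> nat \<Rightarrow> complex"
  proof -
    have sp: "vec.span {e 0, e 1} = U" using P by (simp add: lessThan_2)
    have fe: "f (e 0) = M 0 0 *s e 0 + M 1 0 *s e 1" "f (e 1) = M 0 1 *s e 0 + M 1 1 *s e 1"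
      using P by (simp_all add: lessThan_2)
    have D: "D = M 0 0 * M 1 1 - M 0 1 * M 1 0"
    proof -
      have "D = (\<Sum>\<sigma> | \<sigma> permutes {..<2}. of_int (sign \<sigma>) * (\<Prod>i<2. M i (\<sigma> i)))" using P by blast
      then show ?thesis unfolding sum_permutes_2 by (simp add: sign_swap_id lessThan_2)
    qed
    have e: "e 0 \<in> U" "e 1 \<in> U" unfolding sp[symmetric] by (rule vec.span_base, simp)+
    have co: "\<exists>p q. u = p *s e 0 + q *s e 1" if "u \<in> U" for u using that sp span_two by metis
    show "b (e 0) (e 1) \<noteq> 0"
    proof
      assume "b (e 0) (e 1) = 0"
      moreover obtain p q r s where "u0 = p *s e 0 + q *s e 1" "u1 = r *s e 0 + s *s e 1"
        using co nz(1,2) by metis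
      ultimately show False using nz(3) alt_on_coords[OF b U e] by simp
    qed
    fix x y assume "x \<in> U" "y \<in> U"
    then obtain p q r s where pq: "x = p *s e 0 + q *s e 1" "y = r *s e 0 + s *s e 1" using co by metis
    have fx: "f (p *s e 0 + q *s e 1) = (p * M 0 0 + q * M 0 1) *s e 0 + (p * M 1 0 + q * M 1 1) *s e 1" for p q
      unfolding f(2)[of p "e 0" "q *s e 1"] f_scale fe by (simp add: vec_eq_iff algebra_simps)
    show "b (f x) (f y) = D * b x y"
      unfolding pq fx alt_on_coords[OF b U e] D by (simp add: algebra_simps)
  qed
  obtain B where B: "B \<subseteq> U" "vec.independent B" "U \<subseteq> vec.span B" "card B = vec.dim U"
    by (rule vec.basis_exists)
  then have "card B = 2" by (simp only: dim)
  then obtain e0 e1 where e01: "B = {e0, e1}" "e0 \<noteq> e1" unfolding card_2_iff by blast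
  have sp: "vec.span {e0, e1} = U" using vec.span_subspace[OF B(1,3) U] e01(1) by simp
  define e where "e i = (if i = 0 then e0 else e1)" for i :: nat
  have e: "e ` {..<2} = B" "e 0 = e0" "e 1 = e1" by (auto simp: e_def lessThan_2 e01(1))
  have ex: "\<exists>p q. f u = p *s e0 + q *s e1" if "u \<in> U" for u
    using f(1)[OF that] unfolding sp[symmetric] span_two .
  have "e0 \<in> U" "e1 \<in> U" using B(1) e01(1) by auto
  from ex[OF this(1)] ex[OF this(2)]
  obtain p q r s where pq: "f e0 = p *s e0 + q *s e1" "f e1 = r *s e0 + s *s e1" by blast
  define M where "M i j = (if j = 0 then (if i = 0 then p else q) else (if i = 0 then r else s))" for i j :: nat
  have P: "?P (\<Sum>\<sigma> | \<sigma> permutes {..<2}. of_int (sign \<sigma>) * (\<Prod>i<2. M i (\<sigma> i))) e M"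
  proof (intro conjI refl)
    show "inj_on e {..<2}" using e01(2) by (auto simp: inj_on_def e_def lessThan_2)
    show "vec.independent (e ` {..<2})" unfolding e(1) by (rule B(2))
    show "vec.span (e ` {..<2}) = U" unfolding e(1) e01(1) by (rule sp)
    show "\<forall>j<2. f (e j) = (\<Sum>i<2. M i j *s e i)"
    proof (intro allI impI)
      fix j :: nat assume "j < 2"
      then consider "j = 0" | "j = 1" by linarith
      then show "f (e j) = (\<Sum>i<2. M i j *s e i)"
        using pq unfolding lessThan_2 by cases (simp_all add: M_def e_def)
    qed
  qed
  let ?D = "\<Sum>\<sigma> | \<sigma> permutes {..<2}. of_int (sign \<sigma>) * (\<Prod>i<2. M i (\<sigma> i))"
  have "det_on U f = ?D"
    unfolding det_on_def dim
  proof (rule the_equality)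
    show "\<exists>e M. ?P ?D e M" using P by blast
    fix D assume "\<exists>e M. ?P D e M"
    then obtain e' M' where P': "?P D e' M'" by blast
    have "e' 0 \<in> vec.span (e' ` {..<2})" "e' 1 \<in> vec.span (e' ` {..<2})"
      by (rule vec.span_base, simp)+
    then have "e' 0 \<in> U" "e' 1 \<in> U" using P' by simp_all
    then have "D * b (e' 0) (e' 1) = ?D * b (e' 0) (e' 1)"
      using char(2)[OF P', of "e' 0" "e' 1"] char(2)[OF P, of "e' 0" "e' 1"] by metis
    then show "D = ?D" using char(1)[OF P'] by simp
  qed
  then show ?thesis using char(2)[OF P xy] by simp
qed

section \<open>Semi-invariants of degree zero at a group element\<close>

lemma ext_powD:
  assumes "y \<in> ext_pow V k"
  shows ext_pow_support: "\<not> (int (length xs) = k \<and> set xs \<subseteq> V) \<Longrightarrow> y xs = 0"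
    and ext_pow_lin: "v \<in> V \<Longrightarrow> w \<in> V \<Longrightarrow> y (us @ (c *s v + w) # vs) = c * y (us @ v # vs) + y (us @ w # vs)"
    and ext_pow_alt: "\<not> distinct xs \<Longrightarrow> y xs = 0"
  using assms unfolding ext_pow_def by blast+

lemma ext_pow_zero: "(\<lambda>_. 0) \<in> ext_pow V k"
  by (simp add: ext_pow_def)

lemma ext_pow_comb: "y \<in> ext_pow V k \<Longrightarrow> y' \<in> ext_pow V k \<Longrightarrow> (\<lambda>xs. c * y xs + y' xs) \<in> ext_pow V k"
  unfolding ext_pow_def by (simp add: algebra_simps)

lemma ext_pow_neg: "y \<in> ext_pow V k \<Longrightarrow> k < 0 \<Longrightarrow> y = (\<lambda>_. 0)"
  by (auto intro!: ext_pow_support)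

lemma ext_pow_0: "y \<in> ext_pow V 0 \<Longrightarrow> xs \<noteq> [] \<Longrightarrow> y xs = 0"
  by (auto intro!: ext_pow_support)

lemma ext_pow_2_alt:
  assumes "y \<in> ext_pow V 2"
  shows "alt_on V (\<lambda>v w. y [v, w])"
  using ext_pow_lin[OF assms, of _ _ "[]" _ "[_]"] ext_pow_lin[OF assms, of _ _ "[_]" _ "[]"]
    ext_pow_alt[OF assms]
  by (simp add: alt_on_def)

lemma skew_form_alt_on:
  assumes b: "alt_on V b" and V: "vec.subspace V" and p: "\<And>v. p v \<in> V"
    and lin: "\<And>c v w. p (c *s v + w) = c *s p v + p w"
  shows "skew_form (\<lambda>v w. k * b (p v) (p w))"
  unfolding skew_form_def
proof (intro conjI allI)
  show "k * b (p (c *s v + v')) (p w) = c * (k * b (p v) (p w)) + k * b (p v') (p w)" for v v' w c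
    unfolding lin alt_onD(1)[OF b p p p] by (simp add: distrib_left mult.left_commute)
  show "k * b (p v) (p w) = - (k * b (p w) (p v))" for v w
    using alt_on_swap[OF b V p p, of v w] by simp
qed

lemma ext_pow_2_nonzero:
  assumes y: "y \<in> ext_pow V 2" and "y \<noteq> (\<lambda>_. 0)"
  shows "\<exists>v\<in>V. \<exists>w\<in>V. y [v, w] \<noteq> 0"
proof -
  obtain xs where xs: "y xs \<noteq> 0" using assms(2) by auto
  then have "int (length xs) = 2" "set xs \<subseteq> V" using ext_pow_support[OF y, of xs] by blast+
  moreover from this obtain v w where "xs = [v, w]"
    by (auto simp: numeral_2_eq_2 length_Suc_conv)
  ultimately show ?thesis using xs by auto
qed

lemma mono_deg_eq_0: "mono_deg e = 0 \<Longrightarrow> e = 0"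
  by (rule poly_mapping_eqI) (simp add: mono_deg_def)

lemma sym_deg_eq_0: "sym_deg p = 0 \<Longrightarrow> p = scal (Poly_Mapping.lookup p 0)"
proof -
  assume p: "sym_deg p = 0"
  have "e = 0" if "e \<in> Poly_Mapping.keys p" for e
  proof -
    have "mono_deg e \<le> sym_deg p" unfolding sym_deg_def using that by (intro Max_ge) auto
    then show ?thesis using p mono_deg_eq_0 by simp
  qed
  then show ?thesis
    by (intro poly_mapping_eqI) (auto simp: scal_def lookup_single when_def in_keys_iff)
qed

lemma sym_deg_1: "sym_deg (1 :: 'n::finite spoly) = 0"
  by (simp add: sym_deg_def mono_deg_def)

lemma upt_0_2: "[0..<2] = [0, 1::nat]"
  by (simp add: upt_rec)

locale semi_point = finite_rep G \<rho> + hermitian_ip ip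
  for G :: "('a, 'm) monoid_scheme" (structure) and \<rho> :: "'a \<Rightarrow> complex ^ 'n ^ 'n::finite" and ip +
  fixes g :: 'a and \<omega> :: "(complex ^ 'n) list \<Rightarrow> complex"
  assumes invariant: "invariant_ip G \<rho> ip" and g: "g \<in> carrier G"
    and \<omega>: "\<omega> \<in> ext_pow (orth_compl ip (fixed_space (\<rho> g))) (int (codim (fixed_space (\<rho> g))))"
    and \<omega>_nonzero: "\<omega> \<noteq> (\<lambda>_. 0)"

sublocale semi_point \<subseteq> u: unitary_map ip "\<rho> g"
  using invariant g by unfold_locales (simp add: invariant_ip_def)

context semi_point begin

abbreviation W where "W \<equiv> fixed_space (\<rho> g)"
abbreviation U where "U \<equiv> orth_compl ip W"
abbreviation d where "d \<equiv> codim W"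

lemma u_W: "u.W = W" and u_U: "u.U = U" by (simp_all add: u.U_def u.W_def)

lemma d_eq: "d = vec.dim U" using u.codim_eq by (simp only: u_W u_U)

definition hoch0 where
  "hoch0 = {u \<in> HH2 G \<rho> ip g. u \<noteq> (\<lambda>_. 0) \<longrightarrow> has_degree W (form_degree \<rho> g) u 0}"

text \<open>What remains for a single \<open>a g\<close>: of equivariance only the part for elements
  commuting with \<open>g\<close>.\<close>

definition forms where
  "forms = {b. skew_form b \<and> jacobi_form (\<rho> g) b \<and>
     (\<forall>h\<in>centralizer G g. \<forall>v w. b (\<rho> h *v v) (\<rho> h *v w) = b v w)}"

text \<open>The scalar forms behind the semi-invariants of degree 0 (\<open>hoch0_eq\<close>).
  Constants are fixed by the action on S(V), so semi-invariance concerns the form alone.\<close>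

definition coeffs where
  "coeffs = {Y \<in> ext_pow W (form_degree \<rho> g). \<forall>h\<in>centralizer G g. \<forall>xs.
     Y (map (\<lambda>v. \<rho> (inv h) *v v) xs) = hoch_char \<rho> ip g h * Y xs}"

text \<open>Degree 0 makes every polynomial coefficient a constant, so a sum of tensors collapses to
  one scalar form. Conversely a form is a single tensor with coefficient 1, and if nonzero it is
  linearly independent by itself, as \<open>has_degree\<close> requires.\<close>

lemma hoch0_eq: "hoch0 = (\<lambda>Y xs. scal (Y xs)) ` coeffs"
proof (intro equalityI subsetI)
  fix u assume u: "u \<in> hoch0"
  have "\<exists>Y\<in>ext_pow W (form_degree \<rho> g). u = (\<lambda>xs. scal (Y xs))"
  proof (cases "u = (\<lambda>_. 0)")
    case True
    then show ?thesis by (intro bexI[of _ "\<lambda>_. 0"]) (simp_all add: ext_pow_zero)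
  next
    case False
    then have "has_degree W (form_degree \<rho> g) u 0" using u by (simp add: hoch0_def)
    then obtain N p y where N: "(N::nat) > 0" and py: "\<forall>i<N. p i \<in> sym_sub W \<and> y i \<in> ext_pow W (form_degree \<rho> g)"
      and u': "u = (\<lambda>xs. \<Sum>i<N. tensor_elem (p i) (y i) xs)" and M: "0 = Max ((\<lambda>i. sym_deg (p i)) ` {..<N})"
      unfolding has_degree_def by blast
    define c where "c i = Poly_Mapping.lookup (p i) 0" for i
    have p: "p i = scal (c i)" if "i < N" for i
    proof -
      have "sym_deg (p i) \<le> Max ((\<lambda>i. sym_deg (p i)) ` {..<N})" using that by (intro Max_ge) auto
      then show ?thesis using M sym_deg_eq_0[of "p i"] by (simp add: c_def)
    qed
    have ext: "(\<lambda>xs. \<Sum>i<n. c i * y i xs) \<in> ext_pow W (form_degree \<rho> g)" if "n \<le> N" for n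
      using that
    proof (induction n)
      case (Suc n)
      then show ?case using ext_pow_comb[of "y n" W _ "\<lambda>xs. \<Sum>i<n. c i * y i xs" "c n"] py by (simp add: add.commute)
    qed (simp add: ext_pow_zero)
    have "u = (\<lambda>xs. scal (\<Sum>i<N. c i * y i xs))"
      unfolding u' tensor_elem_def by (simp add: p scal_sum scal_mult mult.commute)
    then show ?thesis using ext[of N] by (intro bexI[of _ "\<lambda>xs. \<Sum>i<N. c i * y i xs"]) simp_all
  qed
  then obtain Y where Y: "Y \<in> ext_pow W (form_degree \<rho> g)" "u = (\<lambda>xs. scal (Y xs))" by blast
  have "Y (map (\<lambda>v. \<rho> (inv h) *v v) xs) = hoch_char \<rho> ip g h * Y xs" if "h \<in> centralizer G g" for h xs
  proof -
    have "diag_act G \<rho> h u = (\<lambda>xs. scal (hoch_char \<rho> ip g h) * u xs)"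
      using u that by (simp add: hoch0_def HH2_def)
    then have "diag_act G \<rho> h u xs = scal (hoch_char \<rho> ip g h) * u xs" by (rule fun_cong)
    then show ?thesis by (simp add: diag_act_def Y(2) scal_mult)
  qed
  then show "u \<in> (\<lambda>Y xs. scal (Y xs)) ` coeffs" using Y by (simp add: coeffs_def)
next
  fix u assume "u \<in> (\<lambda>Y xs. scal (Y xs) :: 'n spoly) ` coeffs"
  then obtain Y where Y: "Y \<in> ext_pow W (form_degree \<rho> g)" and u: "u = (\<lambda>xs. scal (Y xs))"
    and inv: "\<And>h xs. h \<in> centralizer G g \<Longrightarrow> Y (map (\<lambda>v. \<rho> (inv h) *v v) xs) = hoch_char \<rho> ip g h * Y xs"
    by (auto simp: coeffs_def)
  have one: "1 \<in> sym_sub W" using sym_sub.scal[of 1 W] by simp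
  have "u \<in> sym_tensor_ext W (form_degree \<rho> g)"
    unfolding sym_tensor_ext_def mem_Collect_eq using one Y
    by (intro exI[of _ "1::nat"] exI[of _ "\<lambda>_. 1"] exI[of _ "\<lambda>_. Y"]) (simp add: u tensor_elem_def)
  moreover have "diag_act G \<rho> h u = (\<lambda>xs. scal (hoch_char \<rho> ip g h) * u xs)" if "h \<in> centralizer G g" for h
    using inv[OF that] by (simp add: diag_act_def u scal_mult fun_eq_iff)
  moreover have "has_degree W (form_degree \<rho> g) u 0" if "u \<noteq> (\<lambda>_. 0)"
  proof -
    have "\<not> (\<forall>xs. Y xs = 0)" using \<open>u \<noteq> (\<lambda>_. 0)\<close> by (auto simp: u)
    then obtain xs where xs: "Y xs \<noteq> 0" by blast
    have l: "{..<Suc 0} = {0}" by auto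
    show ?thesis
      unfolding has_degree_def using one Y xs
      by (intro exI[of _ "1::nat"] exI[of _ "\<lambda>_. 1"] exI[of _ "\<lambda>_. Y"])
        (auto simp: u tensor_elem_def l sym_deg_1)
  qed
  ultimately show "u \<in> hoch0" by (simp add: hoch0_def HH2_def)
qed

text \<open>The complex number behind \<open>as_two_form\<close> for constant coefficients
  (\<open>as_two_form_scal\<close>): the exterior product of \<open>Y\<close> and
  \<open>\<omega>\<close>, pulled back along the two projections.\<close>

definition val :: "((complex ^ 'n) list \<Rightarrow> complex) \<Rightarrow> complex ^ 'n \<Rightarrow> complex ^ 'n \<Rightarrow> complex" where
  "val Y v w = 1 / (fact (2 - d) * fact d) * (\<Sum>\<sigma> | \<sigma> permutes {..<2 - d + d}.
     of_int (sign \<sigma>) * \<omega> (map u.pU (map (\<lambda>i. [v, w] ! \<sigma> i) [2 - d..<2 - d + d])) *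
     Y (map u.pW (map (\<lambda>i. [v, w] ! \<sigma> i) [0..<2 - d])))"

lemma as_two_form_scal: "as_two_form ip W \<omega> (\<lambda>xs. scal (Y xs)) v w = scal (val Y v w)"
proof -
  have p: "proj_along W U = u.pW" "proj_along U W = u.pU"
    by (simp_all add: u.pW_def u.pU_def u_W u_U)
  show ?thesis
    by (simp only: as_two_form_def wedge_form_def val_def p scal_mult flip: scal_sum)
qed

lemma val_comb: "val (\<lambda>xs. c * Y xs + Y' xs) v w = c * val Y v w + val Y' v w"
  by (simp add: val_def distrib_left sum.distrib sum_distrib_left mult.assoc mult.left_commute)

lemma val_zero: "val (\<lambda>_. 0) v w = 0"
  by (simp add: val_def)

lemma coeffs_comb: "Y \<in> coeffs \<Longrightarrow> Y' \<in> coeffs \<Longrightarrow> (\<lambda>xs. c * Y xs + Y' xs) \<in> coeffs"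
  by (simp add: coeffs_def ext_pow_comb distrib_left mult.left_commute)

lemma coeffs_zero: "(\<lambda>_. 0) \<in> coeffs"
  by (simp add: coeffs_def ext_pow_zero)

lemma hoch_char_eq: "hoch_char \<rho> ip g h = det_on U (\<lambda>v. \<rho> h *v v)"
  by (simp add: hoch_char_def)

lemma centralizer_carrier: "h \<in> centralizer G g \<Longrightarrow> h \<in> carrier G"
  by (simp add: centralizer_def)

lemma centralizer_comm:
  assumes "h \<in> centralizer G g" shows "\<rho> g *v (\<rho> h *v v) = \<rho> h *v (\<rho> g *v v)"
proof -
  have "\<rho> h ** \<rho> g = \<rho> g ** \<rho> h"
    using assms g by (simp add: centralizer_def flip: rho_mult)
  then show ?thesis by (simp add: matrix_vector_mul_assoc)
qed

lemma centralizer_inv: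
  assumes "h \<in> centralizer G g" shows "inv h \<in> centralizer G g"
proof -
  have h: "h \<in> carrier G" "h \<otimes> g = g \<otimes> h" using assms by (simp_all add: centralizer_def)
  have "inv h \<otimes> (h \<otimes> g) \<otimes> inv h = inv h \<otimes> (g \<otimes> h) \<otimes> inv h" using h(2) by simp
  then have "g \<otimes> inv h = inv h \<otimes> g" using h(1) g by (simp add: m_assoc)
  then show ?thesis using h(1) by (simp add: centralizer_def)
qed

lemma centralizer_W:
  assumes "h \<in> centralizer G g" "w \<in> W" shows "\<rho> h *v w \<in> W"
  using assms centralizer_comm by (simp add: fixed_space_def)

lemma centralizer_U:
  assumes h: "h \<in> centralizer G g" and v: "v \<in> U" shows "\<rho> h *v v \<in> U"
proof -
  have hc: "h \<in> carrier G" using h by (rule centralizer_carrier)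
  have "ip (\<rho> h *v v) w = 0" if "w \<in> W" for w
  proof -
    have "ip (\<rho> h *v v) (\<rho> h *v (\<rho> (inv h) *v w)) = ip v (\<rho> (inv h) *v w)"
      using invariant hc by (simp add: invariant_ip_def)
    also have "\<dots> = 0"
      using v centralizer_W[OF centralizer_inv[OF h] that] by (simp add: orth_compl_def)
    finally show ?thesis using hc by (simp add: rho_inv_vec)
  qed
  then show ?thesis by (simp add: orth_compl_def)
qed

lemma centralizer_pU:
  assumes h: "h \<in> centralizer G g" shows "u.pU (\<rho> h *v v) = \<rho> h *v u.pU v"
proof -
  have "\<rho> h *v v = \<rho> h *v u.pW v + \<rho> h *v u.pU v"
    using u.pW_pU[of v] by (metis matrix_vector_right_distrib)
  moreover have "\<rho> h *v u.pW v \<in> u.W" "\<rho> h *v u.pU v \<in> u.U"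
    using h centralizer_W centralizer_U u.pW_in u.pU_in by (simp_all add: u_W u_U)
  ultimately show ?thesis using u.pU_eq by simp
qed

lemma g_centralizer: "g \<in> centralizer G g"
  using g by (simp add: centralizer_def)

lemma zero_form: "(\<lambda>_ _. 0) \<in> forms"
  by (simp add: forms_def skew_form_def jacobi_form_def)

lemma coeffs_dim_ge_3: "3 \<le> d \<Longrightarrow> Y \<in> coeffs \<Longrightarrow> Y = (\<lambda>_. 0)"
  by (rule ext_pow_neg[of _ W "form_degree \<rho> g"]) (simp_all add: coeffs_def)

text \<open>The element \<open>g\<close> lies in its own centralizer and fixes \<open>W\<close>
  pointwise, so it leaves every form on \<open>W\<close> unchanged; but its character value is an
  eigenvalue different from 1.\<close>

lemma coeffs_dim_1:
  assumes d: "d = 1" and Y: "Y \<in> coeffs" shows "Y = (\<lambda>_. 0)"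
proof
  fix xs
  have ext: "Y \<in> ext_pow W (form_degree \<rho> g)" using Y by (simp add: coeffs_def)
  show "Y xs = 0"
  proof (cases "set xs \<subseteq> W")
    case True
    have "vec.dim u.U = 1" using d by (simp only: d_eq u_U)
    then obtain \<zeta> x where x: "x \<noteq> 0" "u.U = vec.span {x}" "\<zeta> \<noteq> 1" "\<And>v. v \<in> u.U \<Longrightarrow> \<rho> g *v v = \<zeta> *s v"
      using u.eigenvalue_dim_1 by blast
    have "hoch_char \<rho> ip g g = \<zeta>"
      unfolding hoch_char_eq u_U[symmetric] x(2) using x(4) by (intro det_on_line x(1)) (simp add: x(2))
    moreover have "\<rho> (inv g) *v v = v" if "v \<in> W" for v
      using rho_inv_vec(1)[OF g, of v] that by (simp add: fixed_space_def)
    then have "map (\<lambda>v. \<rho> (inv g) *v v) xs = xs" using True by (intro map_idI) blast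
    moreover have "Y (map (\<lambda>v. \<rho> (inv g) *v v) xs) = hoch_char \<rho> ip g g * Y xs"
      using Y g_centralizer unfolding coeffs_def by blast
    ultimately have "Y xs = \<zeta> * Y xs" by simp
    then show ?thesis using x(3) by simp
  qed (use ext_pow_support[OF ext] in blast)
qed

lemma dim_0:
  assumes d: "d = 0"
  shows "u.pW v = v" "W = UNIV" "hoch_char \<rho> ip g h = 1" "\<omega> [] \<noteq> 0" "\<rho> g *v v = v"
proof -
  have U: "U = {0}"
    using d vec.subspace_0[OF u.subspace_U] by (auto simp: d_eq u_U)
  have pU: "u.pU v = 0" for v using u.pU_in[of v] U by (simp add: u_U)
  show pW: "u.pW v = v" for v using u.pW_pU[of v] pU by simp
  show W: "W = UNIV" using u.pW_in pW by (metis UNIV_eq_I u_W)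
  show "hoch_char \<rho> ip g h = 1" unfolding hoch_char_eq U by (rule det_on_zero)
  show "\<rho> g *v v = v" using W by (auto simp: fixed_space_def)
  show "\<omega> [] \<noteq> 0"
  proof
    assume 0: "\<omega> [] = 0"
    have "\<omega> xs = 0" for xs
      using 0 ext_pow_0[of \<omega> U xs] \<omega> d by (cases "xs = []") simp_all
    then show False using \<omega>_nonzero by auto
  qed
qed

text \<open>The two permutations contribute equally because \<open>Y\<close> alternates, which
  cancels the factor 1/2 of the wedge product. In \<open>val_dim_2\<close> the same happens with
  \<open>\<omega>\<close>.\<close>

lemma val_dim_0:
  assumes d: "d = 0" and Y: "Y \<in> ext_pow W (form_degree \<rho> g)"
  shows "val Y v w = \<omega> [] * Y [v, w]"
proof -
  have "Y \<in> ext_pow W 2" using Y d by simp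
  then have "Y [w, v] = - Y [v, w]"
    using alt_on_swap[OF ext_pow_2_alt[of Y W], of w v] u.subspace_W dim_0(2)[OF d] by (simp add: u_W)
  then show ?thesis
    using d by (simp add: val_def sum_permutes_2 upt_0_2 sign_swap_id dim_0(1)[OF d] fact_2)
qed

lemma val_dim_2:
  assumes d: "d = 2"
  shows "val Y v w = Y [] * \<omega> [u.pU v, u.pU w]"
proof -
  have "\<omega> \<in> ext_pow U 2" using \<omega> d by simp
  then have "\<omega> [u.pU w, u.pU v] = - \<omega> [u.pU v, u.pU w]"
    using alt_on_swap[OF ext_pow_2_alt[of \<omega> U], of "u.pU w" "u.pU v"] u.subspace_U u.pU_in by (simp add: u_U)
  moreover have "2 - d = 0" "0 + d = 2" using d by simp_all
  ultimately show ?thesis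
    unfolding val_def by (simp only: sum_permutes_2) (simp add: d upt_0_2 sign_swap_id fact_2)
qed

lemma alt_\<omega>: "d = 2 \<Longrightarrow> alt_on u.U (\<lambda>v w. \<omega> [v, w])"
  using ext_pow_2_alt[of \<omega> U] \<omega> by (simp add: u_U)

text \<open>In codimension 2 \<open>\<omega>\<close> is a nonzero alternating form on the plane
  \<open>U\<close>, hence scaled by the determinant of \<open>h\<close> there, which is the
  Hochschild character.\<close>

lemma \<omega>_hoch_char:
  assumes d: "d = 2" and h: "h \<in> centralizer G g" and vw: "v \<in> u.U" "w \<in> u.U"
  shows "\<omega> [\<rho> h *v v, \<rho> h *v w] = hoch_char \<rho> ip g h * \<omega> [v, w]"
proof -
  obtain u0 u1 where "u0 \<in> u.U" "u1 \<in> u.U" "\<omega> [u0, u1] \<noteq> 0"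
    using ext_pow_2_nonzero[of \<omega> U] \<omega> \<omega>_nonzero d by (auto simp: u_U)
  moreover have "vec.dim u.U = 2" using d by (simp only: d_eq u_U)
  moreover have "\<rho> h *v v \<in> u.U" if "v \<in> u.U" for v using centralizer_U[OF h] that by (simp add: u_U)
  ultimately show ?thesis
    unfolding hoch_char_eq u_U[symmetric]
    using det_on_plane[OF alt_\<omega>[OF d], of _ _ "\<lambda>v. \<rho> h *v v" v w] u.subspace_U vw
    by (simp add: matrix_vector_right_distrib vector_scalar_commute)
qed

lemma val_in_forms:
  assumes Y: "Y \<in> coeffs" shows "val Y \<in> forms"
proof -
  have ext: "Y \<in> ext_pow W (form_degree \<rho> g)"
    and inv: "\<And>h xs. h \<in> centralizer G g \<Longrightarrow> Y (map (\<lambda>v. \<rho> (inv h) *v v) xs) = hoch_char \<rho> ip g h * Y xs"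
    using Y by (auto simp: coeffs_def)
  consider "d = 0" | "d = 1" | "d = 2" | "3 \<le> d" by linarith
  then show ?thesis
  proof cases
    case 1
    note D = dim_0[OF 1]
    have "Y \<in> ext_pow W 2" using ext 1 by simp
    then have alt: "alt_on UNIV (\<lambda>v w. Y [v, w])" using ext_pow_2_alt D(2) by metis
    have val: "val Y = (\<lambda>v w. \<omega> [] * Y [v, w])" using val_dim_0[OF 1 ext] by (simp add: fun_eq_iff)
    have "skew_form (val Y)"
      unfolding val by (rule skew_form_alt_on[OF alt vec.subspace_UNIV, of "\<lambda>v. v"]) simp_all
    moreover have "jacobi_form (\<rho> g) (val Y)" using D(5) by (simp add: jacobi_form_def)
    moreover have "val Y (\<rho> h *v v) (\<rho> h *v w) = val Y v w" if "h \<in> centralizer G g" for h v w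
      using inv[OF that, of "[\<rho> h *v v, \<rho> h *v w]"] D(3) centralizer_carrier[OF that]
      by (simp add: val rho_inv_vec)
    ultimately show ?thesis by (simp add: forms_def)
  next
    case 2
    then have "Y = (\<lambda>_. 0)" by (rule coeffs_dim_1[OF _ Y])
    then have "val Y v w = 0" for v w by (simp only: val_zero)
    then have "val Y = (\<lambda>_ _. 0)" by (simp only: fun_eq_iff simp_thms)
    then show ?thesis using zero_form by (simp only:)
  next
    case 3
    let ?b = "\<lambda>v w. \<omega> [v, w]"
    have val: "val Y = (\<lambda>v w. Y [] * ?b (u.pU v) (u.pU w))" using val_dim_2[OF 3] by (simp add: fun_eq_iff)
    note alt = alt_\<omega>[OF 3]
    have "skew_form (val Y)"
      unfolding val by (rule skew_form_alt_on[OF alt u.subspace_U u.pU_in]) (simp_all add: u.pU_add u.pU_scale)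
    moreover have "jacobi_form (\<rho> g) (val Y)"
    proof -
      have dim: "vec.dim u.U = 2" using 3 by (simp only: d_eq u_U)
      obtain B where B: "B \<subseteq> u.U" "vec.independent B" "u.U \<subseteq> vec.span B" "card B = vec.dim u.U"
        by (rule vec.basis_exists)
      then have "card B = 2" by (simp only: dim)
      then obtain b0 b1 where b01: "B = {b0, b1}" unfolding card_2_iff by blast
      have co: "\<exists>p q. u.pU v = p *s b0 + q *s b1" for v
      proof -
        have "u.pU v \<in> vec.span {b0, b1}" using u.pU_in[of v] B(3) b01 by blast
        then show ?thesis by (simp only: span_two)
      qed
      have b01U: "b0 \<in> u.U" "b1 \<in> u.U" using B(1) b01 by auto
      \<comment> \<open>\<open>N\<close> factors through \<open>pU\<close>, so the Jacobi expression
        is \<open>Y []\<close> times \<open>N\<close> applied to this vector, and three vectors of a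
        plane satisfy Cramer's rule.\<close>
      have plane: "?b (u.pU x) (u.pU y) *s u.pU z + ?b (u.pU y) (u.pU z) *s u.pU x + ?b (u.pU z) (u.pU x) *s u.pU y = 0" for x y z
      proof -
        obtain x0 x1 y0 y1 z0 z1 where "u.pU x = x0 *s b0 + x1 *s b1" "u.pU y = y0 *s b0 + y1 *s b1"
          "u.pU z = z0 *s b0 + z1 *s b1" using co by metis
        then show ?thesis
          by (rule u.plane_identity[where e = "?b b0 b1", OF alt_on_coords[OF alt u.subspace_U b01U]])
      qed
      have N0: "u.N 0 = 0" using u.N_lin(2)[of 0 0] by simp
      have "val Y x y *s u.N z + val Y y z *s u.N x + val Y z x *s u.N y = 0" for x y z
      proof -
        have "val Y x y *s u.N z + val Y y z *s u.N x + val Y z x *s u.N y =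
          Y [] *s u.N (?b (u.pU x) (u.pU y) *s u.pU z + ?b (u.pU y) (u.pU z) *s u.pU x + ?b (u.pU z) (u.pU x) *s u.pU y)"
          unfolding val u.N_pU[of x] u.N_pU[of y] u.N_pU[of z] by (simp add: u.N_lin vec_scale_simps)
        then show ?thesis by (simp add: plane N0)
      qed
      then show ?thesis by (simp add: jacobi_form_def u.N_def)
    qed
    moreover have "val Y (\<rho> h *v v) (\<rho> h *v w) = val Y v w" if h: "h \<in> centralizer G g" for h v w
    proof -
      \<comment> \<open>Semi-invariance of a 0-form says that it is zero or the character is 1 at
        \<open>h\<close>; either way the determinant picked up by \<open>\<omega>\<close>
        disappears.\<close>
      have "Y [] = hoch_char \<rho> ip g h * Y []" using inv[OF h, of "[]"] by simp
      moreover have "val Y (\<rho> h *v v) (\<rho> h *v w) = hoch_char \<rho> ip g h * Y [] * ?b (u.pU v) (u.pU w)"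
        using \<omega>_hoch_char[OF 3 h u.pU_in u.pU_in] by (simp add: val centralizer_pU[OF h])
      moreover have "val Y v w = Y [] * ?b (u.pU v) (u.pU w)" by (simp only: val)
      ultimately show ?thesis by metis
    qed
    ultimately show ?thesis by (simp add: forms_def)
  next
    case 4
    then have "Y = (\<lambda>_. 0)" by (rule coeffs_dim_ge_3[OF _ Y])
    then have "val Y v w = 0" for v w by (simp only: val_zero)
    then have "val Y = (\<lambda>_ _. 0)" by (simp only: fun_eq_iff simp_thms)
    then show ?thesis using zero_form by (simp only:)
  qed
qed

lemma val_inj:
  assumes Y: "Y \<in> coeffs" and 0: "val Y = (\<lambda>_ _. 0)" shows "Y = (\<lambda>_. 0)"
proof -
  have ext: "Y \<in> ext_pow W (form_degree \<rho> g)" using Y by (simp add: coeffs_def)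
  consider "d = 0" | "d = 1" | "d = 2" | "3 \<le> d" by linarith
  then show ?thesis
  proof cases
    case 1
    have ext2: "Y \<in> ext_pow W 2" using ext 1 by simp
    have "Y [v, w] = 0" for v w
      using fun_cong[OF fun_cong[OF 0, of v], of w] val_dim_0[OF 1 ext] dim_0(4)[OF 1] by simp
    then show ?thesis using ext_pow_2_nonzero[OF ext2] by blast
  next
    case 2
    then show ?thesis by (rule coeffs_dim_1[OF _ Y])
  next
    case 3
    obtain u0 u1 where u01: "u0 \<in> u.U" "u1 \<in> u.U" "\<omega> [u0, u1] \<noteq> 0"
      using ext_pow_2_nonzero[of \<omega> U] \<omega> \<omega>_nonzero 3 by (auto simp: u_U)
    have "Y [] * \<omega> [u.pU u0, u.pU u1] = 0"
      using fun_cong[OF fun_cong[OF 0, of u0], of u1] val_dim_2[OF 3] by simp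
    then have Y0: "Y [] = 0" using u01 by (simp add: u.pU_U)
    have "Y \<in> ext_pow W 0" using ext 3 by simp
    then have "Y xs = 0" for xs using Y0 ext_pow_0[of Y W xs] by (cases "xs = []") simp_all
    then show ?thesis by auto
  next
    case 4
    then show ?thesis by (rule coeffs_dim_ge_3[OF _ Y])
  qed
qed

lemma val_surj:
  assumes b: "b \<in> forms" shows "\<exists>Y\<in>coeffs. val Y = b"
proof -
  have skew: "skew_form b" and jac: "jacobi_form (\<rho> g) b"
    and inv: "\<And>h v w. h \<in> centralizer G g \<Longrightarrow> b (\<rho> h *v v) (\<rho> h *v w) = b v w"
    using b by (auto simp: forms_def)
  have zero: ?thesis if "\<And>v w. b v w = 0"
    using that coeffs_zero val_zero by (intro bexI[of _ "\<lambda>_. 0"]) (simp_all add: fun_eq_iff)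
  consider "d = 0" | "d = 1" | "d = 2" | "3 \<le> d" by linarith
  then show ?thesis
  proof cases
    case 1
    note D = dim_0[OF 1]
    \<comment> \<open>In codimension 0 the element \<open>\<omega>\<close> is a nonzero constant,
      and \<open>val\<close> multiplies by it.\<close>
    define Y where "Y xs = (if length xs = 2 then b (xs ! 0) (xs ! 1) / \<omega> [] else 0)" for xs
    have "Y \<in> ext_pow UNIV 2"
      unfolding ext_pow_def
    proof (intro CollectI conjI allI ballI impI)
      show "Y xs = 0" if "\<not> (int (length xs) = 2 \<and> set xs \<subseteq> UNIV)" for xs using that by (auto simp: Y_def)
      show "Y (us @ (c *s v + w) # vs) = c * Y (us @ v # vs) + Y (us @ w # vs)" for us vs c v w
      proof (cases "length us + length vs = 1")
        case True
        then consider x where "us = []" "vs = [x]" | x where "us = [x]" "vs = []"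
          by (cases us; cases vs) auto
        then show ?thesis
          by cases (simp_all add: Y_def skew_form_add_left[OF skew] skew_form_add_right[OF skew]
              skew_form_scale_left[OF skew] skew_form_scale_right[OF skew] add_divide_distrib)
      qed (simp add: Y_def)
      show "Y xs = 0" if "\<not> distinct xs" for xs
      proof (cases "length xs = 2")
        case True
        then obtain v w where "xs = [v, w]" by (auto simp: numeral_2_eq_2 length_Suc_conv)
        then show ?thesis using that by (simp add: Y_def skew_form_same[OF skew])
      qed (simp add: Y_def)
    qed
    then have ext: "Y \<in> ext_pow W (form_degree \<rho> g)" using 1 D(2) by simp
    have "Y (map (\<lambda>v. \<rho> (inv h) *v v) xs) = hoch_char \<rho> ip g h * Y xs" if "h \<in> centralizer G g" for h xs
      using inv[OF centralizer_inv[OF that]] D(3) by (simp add: Y_def)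
    then have "Y \<in> coeffs" using ext by (simp add: coeffs_def)
    moreover have "val Y = b" using val_dim_0[OF 1 ext] D(4) by (simp add: fun_eq_iff Y_def)
    ultimately show ?thesis by blast
  next
    case 2
    have "vec.dim u.U = 1" using 2 by (simp only: d_eq u_U)
    then show ?thesis using u.form_zero_dim_1[OF skew jac inv[OF g_centralizer]] by (intro zero)
  next
    case 3
    have dim: "vec.dim u.U = 2" using 3 by (simp only: d_eq u_U)
    note alt = alt_\<omega>[OF 3]
    obtain u0 u1 where u01: "u0 \<in> u.U" "u1 \<in> u.U" "\<omega> [u0, u1] \<noteq> 0"
      using ext_pow_2_nonzero[of \<omega> U] \<omega> \<omega>_nonzero 3 by (auto simp: u_U)
    \<comment> \<open>The ratio of two alternating forms on the plane \<open>U\<close>;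
      \<open>U\<close> below shows that it is the same for all pairs of vectors.\<close>
    define c where "c = b u0 u1 / \<omega> [u0, u1]"
    define Y where "Y xs = (if xs = [] then c else 0)" for xs :: "(complex ^ 'n) list"
    have alt_b: "alt_on u.U b"
      unfolding alt_on_def using skew_form_same[OF skew]
      by (simp add: skew_form_add_left[OF skew] skew_form_add_right[OF skew]
          skew_form_scale_left[OF skew] skew_form_scale_right[OF skew])
    obtain B where B: "B \<subseteq> u.U" "vec.independent B" "u.U \<subseteq> vec.span B" "card B = vec.dim u.U"
      by (rule vec.basis_exists)
    then have "card B = 2" by (simp only: dim)
    then obtain e0 e1 where e01: "B = {e0, e1}" unfolding card_2_iff by blast
    have co: "\<exists>p q. v = p *s e0 + q *s e1" if "v \<in> u.U" for v
    proof -
      have "v \<in> vec.span {e0, e1}" using that B(3) e01 by blast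
      then show ?thesis by (simp only: span_two)
    qed
    have eU: "e0 \<in> u.U" "e1 \<in> u.U" using B(1) e01 by auto
    note cb = alt_on_coords[OF alt_b u.subspace_U eU] and c\<omega> = alt_on_coords[OF alt u.subspace_U eU]
    obtain p q r s where pq: "u0 = p *s e0 + q *s e1" "u1 = r *s e0 + s *s e1" using co u01(1,2) by metis
    have U: "b v w = c * \<omega> [v, w]" if vw: "v \<in> u.U" "w \<in> u.U" for v w
    proof -
      obtain p' q' r' s' where pq': "v = p' *s e0 + q' *s e1" "w = r' *s e0 + s' *s e1" using co vw by metis
      have "(p * s - q * r) * \<omega> [e0, e1] \<noteq> 0" using u01(3) unfolding pq c\<omega> .
      then show ?thesis unfolding c_def pq pq' cb c\<omega> by simp
    qed
    have val: "val Y = b"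
    proof (intro ext)
      fix v w
      have "b v w = b (u.pU v) (u.pU w)" using dim by (intro u.form_pU[OF skew jac]) simp
      also have "\<dots> = c * \<omega> [u.pU v, u.pU w]" by (rule U[OF u.pU_in u.pU_in])
      finally show "val Y v w = b v w" by (simp add: val_dim_2[OF 3] Y_def)
    qed
    have "Y \<in> ext_pow W 0" by (auto simp: ext_pow_def Y_def)
    then have ext: "Y \<in> ext_pow W (form_degree \<rho> g)" using 3 by simp
    have "Y (map (\<lambda>v. \<rho> (inv h) *v v) xs) = hoch_char \<rho> ip g h * Y xs" if h: "h \<in> centralizer G g" for h xs
    proof -
      have hU: "\<rho> h *v v \<in> u.U" if "v \<in> u.U" for v using centralizer_U[OF h] that by (simp add: u_U)
      \<comment> \<open>Since \<open>b\<close> is invariant under \<open>h\<close> while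
        \<open>\<omega>\<close> is scaled by the character, \<open>c\<close> is zero or the
        character is 1 at \<open>h\<close>, which is the semi-invariance of the 0-form
        \<open>Y\<close>.\<close>
      have "c * \<omega> [\<rho> h *v u0, \<rho> h *v u1] = c * \<omega> [u0, u1]"
        using inv[OF h, of u0 u1] U[OF hU hU, OF u01(1,2)] U[OF u01(1,2)] by simp
      then have "hoch_char \<rho> ip g h * c = c"
        using \<omega>_hoch_char[OF 3 h u01(1,2)] u01(3) by simp
      then show ?thesis by (simp add: Y_def)
    qed
    then have "Y \<in> coeffs" using ext by (simp add: coeffs_def)
    then show ?thesis using val by blast
  next
    case 4
    have "3 \<le> vec.dim u.U" using 4 by (simp only: d_eq u_U)
    then show ?thesis using u.form_zero_ge_3[OF skew jac] by (intro zero)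
  qed
qed

text \<open>On \<open>hoch0\<close> the values of the two-form are constant polynomials
  (\<open>as_two_form_eval\<close>), so reading the coefficient of the monomial 1 loses
  nothing.\<close>

definition eval_form :: "((complex ^ 'n) list \<Rightarrow> 'n spoly) \<Rightarrow> complex ^ 'n \<Rightarrow> complex ^ 'n \<Rightarrow> complex" where
  "eval_form u v w = Poly_Mapping.lookup (as_two_form ip W \<omega> u v w) 0"

lemma eval_form_scal: "eval_form (\<lambda>xs. scal (Y xs)) = val Y"
  by (simp add: eval_form_def as_two_form_scal fun_eq_iff)

lemma as_two_form_eval: "u \<in> hoch0 \<Longrightarrow> as_two_form ip W \<omega> u v w = scal (eval_form u v w)"
  by (auto simp: hoch0_eq eval_form_scal as_two_form_scal)

lemma hoch0_zero: "(\<lambda>_. 0) \<in> hoch0"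
  unfolding hoch0_eq using coeffs_zero by (intro image_eqI[of _ _ "\<lambda>_. 0"]) simp_all

lemma hoch0_comb:
  assumes "u \<in> hoch0" "u' \<in> hoch0"
  shows "(\<lambda>xs. scal c * u xs + u' xs) \<in> hoch0"
    and "eval_form (\<lambda>xs. scal c * u xs + u' xs) v w = c * eval_form u v w + eval_form u' v w"
proof -
  obtain Y Y' where Y: "Y \<in> coeffs" "Y' \<in> coeffs" "u = (\<lambda>xs. scal (Y xs))" "u' = (\<lambda>xs. scal (Y' xs))"
    using assms by (auto simp: hoch0_eq)
  have eq: "(\<lambda>xs. scal c * u xs + u' xs) = (\<lambda>xs. scal (c * Y xs + Y' xs))"
    by (simp add: Y scal_add scal_mult)
  show "(\<lambda>xs. scal c * u xs + u' xs) \<in> hoch0"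
    unfolding eq hoch0_eq using coeffs_comb[OF Y(1,2)] by (rule imageI)
  show "eval_form (\<lambda>xs. scal c * u xs + u' xs) v w = c * eval_form u v w + eval_form u' v w"
    unfolding eq by (simp add: eval_form_scal val_comb Y(3,4))
qed

lemma bij_eval_form: "bij_betw eval_form hoch0 forms"
proof (rule bij_betw_imageI)
  show "inj_on eval_form hoch0"
  proof (rule inj_onI)
    fix u u' assume u: "u \<in> hoch0" "u' \<in> hoch0" and eq: "eval_form u = eval_form u'"
    obtain Y Y' where Y: "Y \<in> coeffs" "Y' \<in> coeffs" "u = (\<lambda>xs. scal (Y xs))" "u' = (\<lambda>xs. scal (Y' xs))"
      using u by (auto simp: hoch0_eq)
    have "val (\<lambda>xs. - 1 * Y xs + Y' xs) = (\<lambda>_ _. 0)"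
      using eq unfolding val_comb[abs_def] fun_eq_iff by (simp add: Y eval_form_scal)
    then have "(\<lambda>xs. - 1 * Y xs + Y' xs) = (\<lambda>_. 0)" by (rule val_inj[OF coeffs_comb[OF Y(1,2)]])
    then have "Y xs = Y' xs" for xs using fun_cong[of _ _ xs] by fastforce
    then show "u = u'" using Y(3,4) by simp
  qed
  show "eval_form ` hoch0 = forms"
  proof (intro equalityI subsetI)
    fix b assume "b \<in> eval_form ` hoch0"
    then obtain Y where "Y \<in> coeffs" "b = val Y" by (auto simp: hoch0_eq eval_form_scal)
    then show "b \<in> forms" using val_in_forms by simp
  next
    fix b assume "b \<in> forms"
    then obtain Y where "Y \<in> coeffs" "val Y = b" using val_surj by blast
    then show "b \<in> eval_form ` hoch0"
      unfolding hoch0_eq by (intro image_eqI[of _ _ "\<lambda>xs. scal (Y xs)"]) (simp_all add: eval_form_scal)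
  qed
qed

end

section \<open>Extension along conjugacy classes\<close>

locale class_reps = finite_rep G \<rho>
  for G :: "('a, 'm) monoid_scheme" (structure) and \<rho> :: "'a \<Rightarrow> complex ^ 'n ^ 'n::finite" +
  fixes C :: "'a set"
  assumes reps: "conj_class_reps G C"
begin

text \<open>The same set as \<open>forms\<close>, stated in a locale that has neither an inner
  product nor \<open>\<omega>\<close>.\<close>

definition local_forms :: "'a \<Rightarrow> (complex ^ 'n \<Rightarrow> complex ^ 'n \<Rightarrow> complex) set" where
  "local_forms g = {b. skew_form b \<and> jacobi_form (\<rho> g) b \<and>
     (\<forall>h\<in>centralizer G g. \<forall>v w. b (\<rho> h *v v) (\<rho> h *v w) = b v w)}"

text \<open>A representative together with a conjugating element. The former is unique; the latter
  is determined only up to left multiplication by the centralizer of the representative.\<close>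

definition sel :: "'a \<Rightarrow> 'a \<times> 'a" where
  "sel x = (SOME p. fst p \<in> C \<and> snd p \<in> carrier G \<and> x = inv (snd p) \<otimes> fst p \<otimes> snd p)"

definition conj_ext ::
  "('a \<Rightarrow> complex ^ 'n \<Rightarrow> complex ^ 'n \<Rightarrow> complex) \<Rightarrow> 'a \<Rightarrow> complex ^ 'n \<Rightarrow> complex ^ 'n \<Rightarrow> complex" where
  "conj_ext b x v w = (if x \<in> carrier G
     then b (fst (sel x)) (\<rho> (snd (sel x)) *v v) (\<rho> (snd (sel x)) *v w) else 0)"

lemma C_carrier: "g \<in> C \<Longrightarrow> g \<in> carrier G"
  using reps by (auto simp: conj_class_reps_def)

lemma sel:
  assumes "x \<in> carrier G"
  shows "fst (sel x) \<in> C" "snd (sel x) \<in> carrier G" "x = inv (snd (sel x)) \<otimes> fst (sel x) \<otimes> snd (sel x)"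
proof -
  have "\<exists>g h. g \<in> C \<and> h \<in> carrier G \<and> x = inv h \<otimes> g \<otimes> h"
    using reps assms unfolding conj_class_reps_def by blast
  then have "\<exists>p. fst p \<in> C \<and> snd p \<in> carrier G \<and> x = inv (snd p) \<otimes> fst p \<otimes> snd p" by simp
  from someI_ex[OF this] show "fst (sel x) \<in> C" "snd (sel x) \<in> carrier G"
    "x = inv (snd (sel x)) \<otimes> fst (sel x) \<otimes> snd (sel x)"
    unfolding sel_def by blast+
qed

text \<open>Independence of the choice made by \<open>sel\<close>: two conjugating elements differ
  by some \<open>k\<close> in the centralizer of \<open>g\<close>, under which \<open>b g\<close> is
  invariant.\<close>

lemma conj_ext_eq:
  assumes b: "\<And>g. g \<in> C \<Longrightarrow> b g \<in> local_forms g" and g: "g \<in> C" and h: "h \<in> carrier G"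
  shows "conj_ext b (inv h \<otimes> g \<otimes> h) v w = b g (\<rho> h *v v) (\<rho> h *v w)"
proof -
  let ?x = "inv h \<otimes> g \<otimes> h"
  have gc: "g \<in> carrier G" using g by (rule C_carrier)
  have x: "?x \<in> carrier G" using gc h by simp
  define h' where "h' = snd (sel ?x)"
  have h': "h' \<in> carrier G" using sel(2)[OF x] by (simp add: h'_def)
  have ex1: "\<exists>!g. g \<in> C \<and> (\<exists>h\<in>carrier G. ?x = inv h \<otimes> g \<otimes> h)"
    using reps x unfolding conj_class_reps_def by blast
  have "fst (sel ?x) \<in> C \<and> (\<exists>h\<in>carrier G. ?x = inv h \<otimes> fst (sel ?x) \<otimes> h)" using sel[OF x] by blast
  moreover have "g \<in> C \<and> (\<exists>h\<in>carrier G. ?x = inv h \<otimes> g \<otimes> h)" using g h by blast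
  ultimately have fst: "fst (sel ?x) = g" using ex1 by blast
  have eq: "?x = inv h' \<otimes> g \<otimes> h'" using sel(3)[OF x] by (simp only: fst h'_def)
  define k where "k = h' \<otimes> inv h"
  have k: "k \<in> carrier G" using h h' by (simp add: k_def)
  have "h' \<otimes> ?x \<otimes> inv h = h' \<otimes> (inv h' \<otimes> g \<otimes> h') \<otimes> inv h" using eq by simp
  then have "k \<otimes> g = g \<otimes> k" using h h' gc by (simp add: k_def m_assoc)
  then have kz: "k \<in> centralizer G g" using k by (simp add: centralizer_def)
  have kh: "\<rho> h' *v v = \<rho> k *v (\<rho> h *v v)" for v
  proof -
    have "h' = k \<otimes> h" using h h' by (simp add: k_def m_assoc)
    then show ?thesis using k h by (simp add: rho_mult matrix_vector_mul_assoc)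
  qed
  have "conj_ext b ?x v w = b g (\<rho> h' *v v) (\<rho> h' *v w)"
    using x by (simp only: conj_ext_def fst h'_def if_True)
  also have "\<dots> = b g (\<rho> h *v v) (\<rho> h *v w)"
    unfolding kh using b[OF g] kz by (simp add: local_forms_def)
  finally show ?thesis .
qed

lemma conj_ext_rep: "(\<And>g. g \<in> C \<Longrightarrow> b g \<in> local_forms g) \<Longrightarrow> g \<in> C \<Longrightarrow> conj_ext b g = b g"
proof (intro ext)
  fix v w
  assume b: "\<And>g. g \<in> C \<Longrightarrow> b g \<in> local_forms g" and g: "g \<in> C"
  show "conj_ext b g v w = b g v w"
    using conj_ext_eq[OF b g one_closed, of v w] C_carrier[OF g] by simp
qed

lemma conj_ext_parameters:
  assumes b: "\<And>g. g \<in> C \<Longrightarrow> b g \<in> local_forms g"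
  shows "conj_ext b \<in> hecke_parameters G \<rho>"
  unfolding hecke_parameters_iff
proof (intro conjI ballI allI impI)
  show "conj_ext b x = (\<lambda>_ _. 0)" if "x \<notin> carrier G" for x
    using that by (simp add: conj_ext_def fun_eq_iff)
next
  fix x assume x: "x \<in> carrier G"
  define g where "g = fst (sel x)"
  define h where "h = snd (sel x)"
  have g: "g \<in> C" and h: "h \<in> carrier G" and xgh: "x = inv h \<otimes> g \<otimes> h"
    using sel[OF x] by (simp_all only: g_def h_def)
  have gc: "g \<in> carrier G" using g by (rule C_carrier)
  have val: "conj_ext b x = (\<lambda>v w. b g (\<rho> h *v v) (\<rho> h *v w))"
    unfolding xgh by (intro ext conj_ext_eq[OF b g h])
  have skew: "skew_form (b g)" and jac: "jacobi_form (\<rho> g) (b g)"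
    using b[OF g] by (simp_all add: local_forms_def)
  show "skew_form (conj_ext b x)"
    unfolding val skew_form_def
  proof (intro conjI allI)
    show "b g (\<rho> h *v (c *s u + v)) (\<rho> h *v w) = c * b g (\<rho> h *v u) (\<rho> h *v w) + b g (\<rho> h *v v) (\<rho> h *v w)"
      for u v w c
      by (simp add: matrix_vector_right_distrib vector_scalar_commute skew_form_add_left[OF skew]
          skew_form_scale_left[OF skew])
    show "b g (\<rho> h *v v) (\<rho> h *v w) = - b g (\<rho> h *v w) (\<rho> h *v v)" for v w
      by (rule skew_form_swap[OF skew])
  qed
  show "jacobi_form (\<rho> x) (conj_ext b x)"
    unfolding jacobi_form_def
  proof (intro allI)
    fix u v w
    let ?H = "\<lambda>v. \<rho> h *v v" and ?B = "conj_ext b x"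
    \<comment> \<open>The operator of the Jacobi condition at \<open>x\<close> is conjugate by
      \<open>h\<close> to the one at \<open>g\<close>, so the identity at \<open>x\<close> is the
      transported identity at \<open>g\<close>.\<close>
    have N: "\<rho> x *v v - v = \<rho> (inv h) *v (\<rho> g *v ?H v - ?H v)" for v
    proof -
      have "\<rho> x *v v = \<rho> (inv h) *v (\<rho> g *v ?H v)"
        using h gc by (simp add: xgh rho_mult matrix_vector_mul_assoc m_assoc matrix_mul_assoc)
      then show ?thesis using h by (simp add: matrix_vector_mult_diff_distrib rho_inv_vec)
    qed
    have "?B u v *s (\<rho> x *v w - w) + ?B v w *s (\<rho> x *v u - u) + ?B w u *s (\<rho> x *v v - v) =
      \<rho> (inv h) *v (b g (?H u) (?H v) *s (\<rho> g *v ?H w - ?H w) + b g (?H v) (?H w) *s (\<rho> g *v ?H u - ?H u)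
        + b g (?H w) (?H u) *s (\<rho> g *v ?H v - ?H v))"
      unfolding N val by (simp only: matrix_vector_right_distrib vector_scalar_commute)
    also have "\<dots> = \<rho> (inv h) *v 0"
      using jac unfolding jacobi_form_def by metis
    finally show "?B u v *s (\<rho> x *v w - w) + ?B v w *s (\<rho> x *v u - u) + ?B w u *s (\<rho> x *v v - v) = 0"
      by simp
  qed
next
  show "equivariant_forms G \<rho> (conj_ext b)"
    unfolding equivariant_forms_def
  proof (intro ballI allI)
    fix x k v w assume x: "x \<in> carrier G" and k: "k \<in> carrier G"
    define g where "g = fst (sel x)"
    define h where "h = snd (sel x)"
    have g: "g \<in> C" and h: "h \<in> carrier G" and xgh: "x = inv h \<otimes> g \<otimes> h"
      using sel[OF x] by (simp_all only: g_def h_def)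
    have "inv k \<otimes> x \<otimes> k = inv (h \<otimes> k) \<otimes> g \<otimes> (h \<otimes> k)"
      using h k C_carrier[OF g] by (simp add: xgh inv_mult_group m_assoc)
    then have "conj_ext b (inv k \<otimes> x \<otimes> k) v w = b g (\<rho> (h \<otimes> k) *v v) (\<rho> (h \<otimes> k) *v w)"
      using conj_ext_eq[OF b g, of "h \<otimes> k" v w] h k by simp
    also have "\<dots> = b g (\<rho> h *v (\<rho> k *v v)) (\<rho> h *v (\<rho> k *v w))"
      using h k by (simp add: rho_mult matrix_vector_mul_assoc)
    also have "\<dots> = conj_ext b x (\<rho> k *v v) (\<rho> k *v w)"
      unfolding xgh by (rule conj_ext_eq[OF b g h, symmetric])
    finally show "conj_ext b (inv k \<otimes> x \<otimes> k) v w = conj_ext b x (\<rho> k *v v) (\<rho> k *v w)" .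
  qed
qed

lemma parameters_local:
  assumes a: "a \<in> hecke_parameters G \<rho>" and g: "g \<in> C"
  shows "a g \<in> local_forms g"
proof -
  have gc: "g \<in> carrier G" using g by (rule C_carrier)
  have "a g (\<rho> h *v v) (\<rho> h *v w) = a g v w" if "h \<in> centralizer G g" for h v w
  proof -
    have h: "h \<in> carrier G" "h \<otimes> g = g \<otimes> h" using that by (simp_all add: centralizer_def)
    have "inv h \<otimes> g \<otimes> h = g" using h gc by (simp add: m_assoc h(2)[symmetric])
    then show ?thesis
      using a h(1) gc unfolding hecke_parameters_iff equivariant_forms_def by metis
  qed
  then show ?thesis using a gc by (simp add: local_forms_def hecke_parameters_iff)
qed

lemma parameters_conj_ext:
  assumes a: "a \<in> hecke_parameters G \<rho>" and b: "\<And>g. g \<in> C \<Longrightarrow> b g = a g"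
  shows "conj_ext b = a"
proof (intro ext)
  fix x v w
  show "conj_ext b x v w = a x v w"
  proof (cases "x \<in> carrier G")
    case True
    define g where "g = fst (sel x)"
    define h where "h = snd (sel x)"
    have g: "g \<in> C" and h: "h \<in> carrier G" and xgh: "x = inv h \<otimes> g \<otimes> h"
      using sel[OF True] by (simp_all only: g_def h_def)
    have "conj_ext b x v w = a g (\<rho> h *v v) (\<rho> h *v w)"
      using True b[OF g] by (simp add: conj_ext_def g_def h_def)
    also have "\<dots> = a x v w"
      using a g h C_carrier unfolding xgh hecke_parameters_iff equivariant_forms_def by metis
    finally show ?thesis .
  next
    case False
    then show ?thesis using a by (simp add: conj_ext_def hecke_parameters_iff)
  qed
qed

end

section \<open>Linear structure of the parameter space and the isomorphism\<close>

lemma skew_form_comb: "skew_form b \<Longrightarrow> skew_form b' \<Longrightarrow> skew_form (\<lambda>v w. c * b v w + b' v w)"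
proof -
  assume b: "skew_form b" and b': "skew_form b'"
  show ?thesis
    unfolding skew_form_def
  proof (intro conjI allI)
    show "c * b (e *s u + v) w + b' (e *s u + v) w = e * (c * b u w + b' u w) + (c * b v w + b' v w)" for u v w e
      by (simp add: skew_form_add_left[OF b] skew_form_scale_left[OF b] skew_form_add_left[OF b']
          skew_form_scale_left[OF b'] algebra_simps)
    show "c * b v w + b' v w = - (c * b w v + b' w v)" for v w
      using skew_form_swap[OF b, of v w] skew_form_swap[OF b', of v w] by simp
  qed
qed

lemma jacobi_form_comb:
  assumes "jacobi_form M b" "jacobi_form M b'"
  shows "jacobi_form M (\<lambda>v w. c * b v w + b' v w)"
  unfolding jacobi_form_def
proof (intro allI)
  fix u v w
  let ?J = "\<lambda>b. b u v *s (M *v w - w) + b v w *s (M *v u - u) + b w u *s (M *v v - v)"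
  have eq: "?J (\<lambda>v w. c * b v w + b' v w) = c *s ?J b + ?J b'"
    by (simp add: vec_eq_iff algebra_simps)
  have 0: "?J b = 0" "?J b' = 0" using assms unfolding jacobi_form_def by blast+
  show "?J (\<lambda>v w. c * b v w + b' v w) = 0" unfolding eq 0 by simp
qed

lemma (in finite_rep) hecke_parameters_zero: "(\<lambda>_ _ _. 0) \<in> hecke_parameters G \<rho>"
  by (simp add: hecke_parameters_iff skew_form_def jacobi_form_def equivariant_forms_def)

text \<open>The definition through gr A does not show that the parameters form a vector space; the
  conditions of the criterion are linear in the family.\<close>

lemma (in finite_rep) hecke_parameters_comb:
  assumes "a \<in> hecke_parameters G \<rho>" "a' \<in> hecke_parameters G \<rho>"
  shows "(\<lambda>g v w. c * a g v w + a' g v w) \<in> hecke_parameters G \<rho>"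
  using assms unfolding hecke_parameters_iff equivariant_forms_def
  by (simp add: skew_form_comb jacobi_form_comb)

theorem theorem8p7:
  fixes G :: "('g, 'm) monoid_scheme"
    and \<rho> :: "'g \<Rightarrow> complex ^ 'n ^ 'n::finite"
    and ip :: "complex ^ 'n \<Rightarrow> complex ^ 'n \<Rightarrow> complex"
    and C :: "'g set"
    and \<omega> :: "'g \<Rightarrow> (complex ^ 'n) list \<Rightarrow> complex"
  assumes "group G" and "finite (carrier G)"
    and "is_representation G \<rho>"
    and "hermitian_inner_product ip" and "invariant_ip G \<rho> ip"
    and "conj_class_reps G C"
    and "\<And>g. g \<in> C \<Longrightarrow> \<omega> g \<in> ext_pow (orth_compl ip (fixed_space (\<rho> g)))
                                    (int (codim (fixed_space (\<rho> g))))"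
    and "\<And>g. g \<in> C \<Longrightarrow> \<omega> g \<noteq> (\<lambda>_. 0)"
  defines "\<F> \<equiv> semi_invariant_families G \<rho> ip C"
    and "\<P> \<equiv> hecke_parameters G \<rho>"
  shows "((\<lambda>_ _. 0) \<in> \<F> \<and>
          (\<forall>f\<in>\<F>. \<forall>f'\<in>\<F>. \<forall>c. (\<lambda>g xs. scal c * f g xs + f' g xs) \<in> \<F>)) \<and>
         ((\<lambda>_ _ _. 0) \<in> \<P> \<and>
          (\<forall>a\<in>\<P>. \<forall>a'\<in>\<P>. \<forall>c. (\<lambda>g v w. c * a g v w + a' g v w) \<in> \<P>)) \<and>
         (\<exists>\<Phi>. bij_betw \<Phi> \<F> \<P> \<and>
            (\<forall>f\<in>\<F>. \<forall>f'\<in>\<F>. \<forall>c.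
               \<Phi> (\<lambda>g xs. scal c * f g xs + f' g xs) =
               (\<lambda>g v w. c * \<Phi> f g v w + \<Phi> f' g v w)) \<and>
            (\<forall>f\<in>\<F>.
               (\<forall>g\<in>C. \<forall>v w. skew_elem (scal (\<Phi> f g v w)) g =
                  semi_inv_eval G \<rho> ip g (\<omega> g) (f g) 1 1 v w) \<and>
               (\<forall>g\<in>C. \<forall>h\<in>carrier G. \<forall>v w.
                  \<Phi> f (inv\<^bsub>G\<^esub> h \<otimes>\<^bsub>G\<^esub> g \<otimes>\<^bsub>G\<^esub> h) v w =
                  \<Phi> f g (\<rho> h *v v) (\<rho> h *v w))))"
proof -
  interpret class_reps G \<rho> C
    using assms(1-3,6) by (simp add: class_reps_def class_reps_axioms_def finite_rep_def finite_rep_axioms_def)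
  define H where "H g = {u \<in> HH2 G \<rho> ip g. u \<noteq> (\<lambda>_. 0) \<longrightarrow>
    has_degree (fixed_space (\<rho> g)) (form_degree \<rho> g) u 0}" for g
  define ev where "ev g u v w = Poly_Mapping.lookup (as_two_form ip (fixed_space (\<rho> g)) (\<omega> g) u v w) 0"
    for g u v w
  have point: "semi_point G \<rho> ip g (\<omega> g)" if "g \<in> C" for g
    using assms(4,5,7,8) that C_carrier finite_rep_axioms
    by (simp add: semi_point_def semi_point_axioms_def hermitian_ip_def)
  have ev_bij: "bij_betw (ev g) (H g) (local_forms g)"
    and ev_scal: "\<And>u v w. u \<in> H g \<Longrightarrow> as_two_form ip (fixed_space (\<rho> g)) (\<omega> g) u v w = scal (ev g u v w)"
    and H_zero: "(\<lambda>_. 0) \<in> H g"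
    and H_comb: "\<And>u u' c. u \<in> H g \<Longrightarrow> u' \<in> H g \<Longrightarrow> (\<lambda>xs. scal c * u xs + u' xs) \<in> H g"
    and ev_comb: "\<And>u u' c v w. u \<in> H g \<Longrightarrow> u' \<in> H g \<Longrightarrow>
      ev g (\<lambda>xs. scal c * u xs + u' xs) v w = c * ev g u v w + ev g u' v w"
    if g: "g \<in> C" for g
  proof -
    interpret s: semi_point G \<rho> ip g "\<omega> g" by (rule point[OF g])
    have H: "s.hoch0 = H g" by (simp add: s.hoch0_def H_def)
    have e: "s.eval_form = ev g" by (simp add: s.eval_form_def ev_def fun_eq_iff)
    have f: "s.forms = local_forms g" by (simp add: s.forms_def local_forms_def)
    show "bij_betw (ev g) (H g) (local_forms g)" using s.bij_eval_form by (simp only: H e f)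
    show "as_two_form ip (fixed_space (\<rho> g)) (\<omega> g) u v w = scal (ev g u v w)" if "u \<in> H g" for u v w
      using s.as_two_form_eval that by (simp only: H e)
    show "(\<lambda>_. 0) \<in> H g" using s.hoch0_zero by (simp only: H)
    show "(\<lambda>xs. scal c * u xs + u' xs) \<in> H g"
      "ev g (\<lambda>xs. scal c * u xs + u' xs) v w = c * ev g u v w + ev g u' v w"
      if "u \<in> H g" "u' \<in> H g" for u u' c v w
      using s.hoch0_comb that by (simp_all only: H e)
  qed
  have \<F>: "f \<in> \<F> \<longleftrightarrow> (\<forall>g\<in>C. f g \<in> H g) \<and> (\<forall>g. g \<notin> C \<longrightarrow> f g = (\<lambda>_. 0))" for f
    by (simp add: \<F>_def semi_invariant_families_def H_def)
  \<comment> \<open>Evaluation at each representative, transported to the rest of its class by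
    conjugation.\<close>
  define \<Phi> where "\<Phi> f = conj_ext (\<lambda>g. ev g (f g))" for f
  have forms: "ev g (f g) \<in> local_forms g" if "f \<in> \<F>" "g \<in> C" for f g
    using that bij_betwE[OF ev_bij[OF that(2)]] by (simp add: \<F>)
  have \<Phi>_rep: "\<Phi> f g = ev g (f g)" if "f \<in> \<F>" "g \<in> C" for f g
    unfolding \<Phi>_def using forms[OF that(1)] that(2) by (rule conj_ext_rep)
  have "bij_betw \<Phi> \<F> \<P>"
  proof (rule bij_betw_imageI)
    show "inj_on \<Phi> \<F>"
    proof (rule inj_onI)
      fix f f' assume f: "f \<in> \<F>" "f' \<in> \<F>" and eq: "\<Phi> f = \<Phi> f'"
      have "f g = f' g" for g
      proof (cases "g \<in> C")
        case True
        have "ev g (f g) = ev g (f' g)" using \<Phi>_rep[OF f(1) True] \<Phi>_rep[OF f(2) True] eq by simp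
        moreover have "inj_on (ev g) (H g)" using ev_bij[OF True] by (rule bij_betw_imp_inj_on)
        ultimately show ?thesis using f True by (auto simp: \<F> dest: inj_onD)
      next
        case False
        then show ?thesis using f by (simp add: \<F>)
      qed
      then show "f = f'" by (rule ext)
    qed
    show "\<Phi> ` \<F> = \<P>"
    proof (intro equalityI subsetI)
      fix a assume "a \<in> \<Phi> ` \<F>"
      then obtain f where f: "f \<in> \<F>" "a = \<Phi> f" by blast
      show "a \<in> \<P>" unfolding \<P>_def f(2) \<Phi>_def by (rule conj_ext_parameters) (rule forms[OF f(1)])
    next
      fix a assume "a \<in> \<P>"
      then have a: "a \<in> hecke_parameters G \<rho>" by (simp only: \<P>_def)
      \<comment> \<open>The inverse takes preimages at the representatives only, as conjugation
        recovers the other forms, and is zero off \<open>C\<close> as required of a family.\<close>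
      define f where "f g = (if g \<in> C then inv_into (H g) (ev g) (a g) else (\<lambda>_. 0))" for g
      have f: "f g \<in> H g \<and> ev g (f g) = a g" if g: "g \<in> C" for g
      proof -
        have "a g \<in> ev g ` H g"
          using parameters_local[OF a g] bij_betw_imp_surj_on[OF ev_bij[OF g]] by simp
        then show ?thesis using g by (simp add: f_def inv_into_into f_inv_into_f)
      qed
      then have "f \<in> \<F>" by (simp add: \<F>) (simp add: f_def)
      moreover have "\<Phi> f = a" unfolding \<Phi>_def using a f by (intro parameters_conj_ext) simp_all
      ultimately show "a \<in> \<Phi> ` \<F>" by blast
    qed
  qed
  moreover have \<F>_comb: "(\<lambda>g xs. scal c * f g xs + f' g xs) \<in> \<F>" if "f \<in> \<F>" "f' \<in> \<F>" for f f' c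
    using that H_comb by (simp add: \<F>)
  moreover have "\<Phi> (\<lambda>g xs. scal c * f g xs + f' g xs) = (\<lambda>g v w. c * \<Phi> f g v w + \<Phi> f' g v w)"
    if f: "f \<in> \<F>" "f' \<in> \<F>" for f f' c
  proof (intro ext)
    fix x v w
    show "\<Phi> (\<lambda>g xs. scal c * f g xs + f' g xs) x v w = c * \<Phi> f x v w + \<Phi> f' x v w"
      using f sel(1)[of x] ev_comb[of "fst (sel x)" "f (fst (sel x))" "f' (fst (sel x))"]
      by (simp add: \<Phi>_def conj_ext_def \<F>)
  qed
  moreover have "skew_elem (scal (\<Phi> f g v w)) g = semi_inv_eval G \<rho> ip g (\<omega> g) (f g) 1 1 v w"
    if f: "f \<in> \<F>" and g: "g \<in> C" for f g v w
  proof -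
    have gc: "g \<in> carrier G" using g by (rule C_carrier)
    have "f g \<in> H g" using f g by (simp add: \<F>)
    then show ?thesis
      using gc by (simp add: semi_inv_eval_def sym_skew_def Y.skew_elem_mult ev_scal[OF g] \<Phi>_rep[OF f g])
  qed
  moreover have "\<Phi> f (inv\<^bsub>G\<^esub> h \<otimes>\<^bsub>G\<^esub> g \<otimes>\<^bsub>G\<^esub> h) v w = \<Phi> f g (\<rho> h *v v) (\<rho> h *v w)"
    if f: "f \<in> \<F>" and g: "g \<in> C" and h: "h \<in> carrier G" for f g h v w
    unfolding \<Phi>_rep[OF f g] unfolding \<Phi>_def by (rule conj_ext_eq[OF forms[OF f] g h])
  moreover have "(\<lambda>_ _. 0) \<in> \<F>" using H_zero by (simp add: \<F>)
  ultimately show ?thesis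
    using hecke_parameters_zero hecke_parameters_comb unfolding \<P>_def by blast
qed

end
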